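(* Consider a branching random walk on $\mathbb{Z}$ satisfying Assumptions A–E (see context). Let $\beta\in(\beta_-,\beta_+)$ and let $k_n$ be an integer sequence with $k_n=\varphi'(\beta)n+c_n$, where $c_n=O(\sqrt n)$. Let $L_n^\circ(k_n)=L_n(k_n)-W_\infty(\beta)\,\mathbb{E}L_n(k_n)$. (a) If $c_n=\alpha\sigma(\beta)\sqrt n+o(\sqrt n)$ for some $\alpha\in\mathbb{R}$, then a.s. $$ n\,{\rm e}^{\beta k_n-\varphi(\beta)n}L_n^\circ(k_n)\longrightarrow\frac{1}{\sqrt{2\pi}\sigma^2(\beta)}\alpha{\rm e}^{-\frac12\alpha^2}W_\infty'(\beta).$$ (b) If $c_n\to+\infty$ but $c_n=o(\sqrt n)$, then a.s. $$ n^{3/2}c_n^{-1}{\rm e}^{\beta k_n-\varphi(\beta)n}L_n^\circ(k_n)\longrightarrow\frac{1}{\sqrt{2\pi}\sigma^3(\beta)}W_\infty'(\beta).$$ (c) If $c_n$ is bounded, then a.s. $$ n^{3/2}{\rm e}^{\beta k_n-\varphi(\beta)n}L_n^\circ(k_n)-R(c_n)\longrightarrow0,\qquad R(c):=\frac{1}{\sqrt{2\pi}\sigma^3(\beta)}\Big(W_\infty'(\beta)\Big(c+\frac{\kappa_3(\beta)}{2\sigma^2(\beta)}\Big)-\frac12W_\infty''(\beta)\Big).$$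
   Context: Branching random walk (BRW) on $\mathbb{Z}$: at time $0$ there is one particle at $0$. At each time $n\in\mathbb{N}_0$ every particle is replaced, independently of all other particles and of the past, by a random finite cluster of particles whose displacements relative to the parent are distributed according to a fixed point process $\zeta$ on $\mathbb{Z}$. $N_n$ is the number of particles at time $n$; $L_n(k)$ is the number of particles at site $k$ at time $n$; $\vartheta_n(\{k\})=\mathbb{E}L_n(k)$; $\varphi(\beta)=\log\mathbb{E}\big[\sum_k{\rm e}^{\beta k}L_1(k)\big]$. Assumptions: (A) $\{k:\vartheta_1(\{k\})>0\}$ has at least two elements. (B) $N_1\neq0$ a.s. and $m:=\mathbb{E}N_1\in(1,\infty)$. (C) $\varphi$ finite on an open interval containing $0$; $\mathcal{D}_\varphi$ the maximal open interval of finiteness. $\beta_-=\inf\{\beta\in\mathcal{D}_\varphi:\varphi'(\beta)\beta<\varphi(\beta)\}$, $\beta_+=\sup$ of the same set. $W_n(\beta)=\sum_k{\rm e}^{\beta k-\varphi(\beta)n}L_n(k)$. (D) There is $p>1$ with $\sup_{\beta\in K}\mathbb{E}[W_1(\beta)^p]<\infty$ for every compact $K\subset(\beta_-,\beta_+)$. (E) No $h\in\{2,3,\dots\}$, $a\in\mathbb{Z}$ with $\vartheta_1$ concentrated on $a+h\mathbb{Z}$. Then there are an open $V\subset\mathbb{C}$ containing $(\beta_-,\beta_+)$ and a random analytic function $W_\infty$ on $V$ with $W_n\to W_\infty$ a.s. uniformly on compacts of $V$; $W_\infty',W_\infty''$ are its derivatives. $\kappa_j(\beta)=\varphi^{(j)}(\beta)$,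 $\sigma^2(\beta)=\varphi''(\beta)$, $\sigma(\beta)>0$. *)

theory Defs
  imports "HOL-Probability.Probability" "HOL-Library.Landau_Symbols"
begin

text \<open>Ulam-Harris encoding of the branching random walk.  Individuals are
  labelled by words u :: nat list; xi u w is the (ordered) list of displacements
  of the children of u relative to u, i.e. the point process zeta attached to u.
  The child i of u (i < length (xi u w)) is u @ [i].\<close>

primrec particles :: "(nat list \<Rightarrow> 'a \<Rightarrow> int list) \<Rightarrow> nat \<Rightarrow> 'a \<Rightarrow> (nat list \<times> int) set" where
  "particles xi 0 w = {([], 0)}"
| "particles xi (Suc n) w =
     {(u @ [i], x + xi u w ! i) | u x i. (u, x) \<in> particles xi n w \<and> i < length (xi u w)}"

definition Lcount :: "(nat list \<Rightarrow> 'a \<Rightarrow> int list) \<Rightarrow> nat \<Rightarrow> int \<Rightarrow> 'a \<Rightarrow> real" where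
  "Lcount xi n k w = real (card {u. (u, k) \<in> particles xi n w})"

definition Npart :: "(nat list \<Rightarrow> 'a \<Rightarrow> int list) \<Rightarrow> nat \<Rightarrow> 'a \<Rightarrow> real" where
  "Npart xi n w = real (card (particles xi n w))"

definition expsum :: "(nat list \<Rightarrow> 'a \<Rightarrow> int list) \<Rightarrow> nat \<Rightarrow> real \<Rightarrow> 'a \<Rightarrow> real" where
  "expsum xi n \<beta> w = (\<Sum>(u, x) \<in> particles xi n w. exp (\<beta> * real_of_int x))"

definition phi_finite :: "'a measure \<Rightarrow> (nat list \<Rightarrow> 'a \<Rightarrow> int list) \<Rightarrow> real \<Rightarrow> bool" where
  "phi_finite M xi \<beta> \<longleftrightarrow> (\<integral>\<^sup>+ w. ennreal (expsum xi 1 \<beta> w) \<partial>M) < \<infinity>"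

text \<open>phi(beta) = log E[sum_k e^(beta k) L_1(k)] (meaningful where finite).\<close>
definition phi :: "'a measure \<Rightarrow> (nat list \<Rightarrow> 'a \<Rightarrow> int list) \<Rightarrow> real \<Rightarrow> real" where
  "phi M xi \<beta> = ln (enn2real (\<integral>\<^sup>+ w. ennreal (expsum xi 1 \<beta> w) \<partial>M))"

text \<open>D_phi: maximal open interval of finiteness (interior of the convex finiteness set).\<close>
definition Dphi :: "'a measure \<Rightarrow> (nat list \<Rightarrow> 'a \<Rightarrow> int list) \<Rightarrow> real set" where
  "Dphi M xi = interior {\<beta>. phi_finite M xi \<beta>}"

definition beta_set :: "'a measure \<Rightarrow> (nat list \<Rightarrow> 'a \<Rightarrow> int list) \<Rightarrow> real set" where
  "beta_set M xi = {\<beta> \<in> Dphi M xi. deriv (phi M xi) \<beta> * \<beta> < phi M xi \<beta>}"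

text \<open>beta_- and beta_+ may be infinite, hence extended reals.\<close>
definition beta_minus :: "'a measure \<Rightarrow> (nat list \<Rightarrow> 'a \<Rightarrow> int list) \<Rightarrow> ereal" where
  "beta_minus M xi = Inf (ereal ` beta_set M xi)"

definition beta_plus :: "'a measure \<Rightarrow> (nat list \<Rightarrow> 'a \<Rightarrow> int list) \<Rightarrow> ereal" where
  "beta_plus M xi = Sup (ereal ` beta_set M xi)"

definition Ibeta :: "'a measure \<Rightarrow> (nat list \<Rightarrow> 'a \<Rightarrow> int list) \<Rightarrow> real set" where
  "Ibeta M xi = {\<beta>. beta_minus M xi < ereal \<beta> \<and> ereal \<beta> < beta_plus M xi}"

definition Wn :: "'a measure \<Rightarrow> (nat list \<Rightarrow> 'a \<Rightarrow> int list) \<Rightarrow> nat \<Rightarrow> real \<Rightarrow> 'a \<Rightarrow> real" where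
  "Wn M xi n \<beta> w = (\<Sum>(u, x) \<in> particles xi n w. exp (\<beta> * real_of_int x - phi M xi \<beta> * real n))"

definition sigma_brw :: "'a measure \<Rightarrow> (nat list \<Rightarrow> 'a \<Rightarrow> int list) \<Rightarrow> real \<Rightarrow> real" where
  "sigma_brw M xi \<beta> = sqrt (deriv (deriv (phi M xi)) \<beta>)"

definition kappa3 :: "'a measure \<Rightarrow> (nat list \<Rightarrow> 'a \<Rightarrow> int list) \<Rightarrow> real \<Rightarrow> real" where
  "kappa3 M xi \<beta> = (deriv ^^ 3) (phi M xi) \<beta>"

definition Lcirc :: "'a measure \<Rightarrow> (nat list \<Rightarrow> 'a \<Rightarrow> int list) \<Rightarrow> (real \<Rightarrow> 'a \<Rightarrow> real) \<Rightarrow> real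
    \<Rightarrow> nat \<Rightarrow> int \<Rightarrow> 'a \<Rightarrow> real" where
  "Lcirc M xi Winf \<beta> n k w = Lcount xi n k w - Winf \<beta> w * (\<integral>v. Lcount xi n k v \<partial>M)"

end

theory Submission
  imports Defs "HOL-Complex_Analysis.Complex_Analysis" "HOL-Real_Asymp.Real_Asymp"
begin

text \<open>Let \<open>Z\<^sub>n(z)\<close> be the sum of \<open>e\<^sup>z\<^sup>x\<close> over the positions \<open>x\<close> of the particles at time \<open>n\<close>, and
  \<open>m(z)\<close> the mean of \<open>Z\<^sub>1(z)\<close>, so that \<open>Z\<^sub>n(z)\<close> has mean \<open>m(z)\<^sup>n\<close>.  By Fourier inversion, \<open>exp (\<beta>k) L\<^sub>n(k)\<close> is the
  average of \<open>Z\<^sub>n(\<beta> + i\<eta>) exp (-i\<eta>k)\<close> over \<open>-\<pi> \<le> \<eta> \<le> \<pi>\<close>, and its expectation is the same with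
  \<open>m(\<beta> + i\<eta>)\<^sup>n\<close> in place of \<open>Z\<^sub>n\<close>.  After division by \<open>m(\<beta>)\<^sup>n\<close> and subtraction there are three contributions:

  \<^item> for \<open>\<eta>\<close> away from 0, aperiodicity gives \<open>|m(\<beta> + i\<eta>)| < m(\<beta>)\<close>, and the expectation of
    \<open>|Z\<^sub>n(\<beta> + i\<eta>)| / m(\<beta>)\<^sup>n\<close> decays geometrically;

  \<^item> for small \<open>\<eta>\<close>, \<open>Z\<^sub>n(z) / m(z)\<^sup>n\<close> is geometrically close to a limit \<open>W(z)\<close> that is holomorphic near \<open>\<beta>\<close>;

  \<^item> what remains is the integral of \<open>(m(\<beta> + i\<eta>) / m(\<beta>))\<^sup>n (W(\<beta> + i\<eta>) - W(\<beta>)) exp (-i\<eta>k)\<close>, to which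
    Laplace's method applies after Taylor expansion of \<open>log m\<close> to third and of \<open>W\<close> to second order.

  Both geometric estimates rest on a bound for the \<open>L\<^sup>1\<close> norm of \<open>Z\<^sub>n\<^sub>+\<^sub>1 - m Z\<^sub>n\<close>: given the first \<open>n\<close> generations this
  is a sum of independent centred variables.  They are truncated at level 1, and the bounded part is estimated
  in \<open>L\<^sup>2\<close>, the rest in \<open>L\<^sup>1\<close>; both are controlled by \<open>p\<close>-th moments, where \<open>p > 1\<close> is so close to 1 that
  \<open>m(p\<beta>) < m(\<beta>)\<^sup>p\<close>.  Such \<open>p\<close> exist because \<open>\<beta> \<phi>'(\<beta>) < \<phi>(\<beta>)\<close>.\<close>

section \<open>Particle configurations and independence of generations\<close>

text \<open>Two difficulties shape the argument. Moments are available only for some exponent above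
  1, so Z_n need not be square integrable. And the exceptional null set must not depend on z or
  \<eta>, although increments are estimated for one z at a time. The remedy is to integrate first:
  the expected increment is averaged over a circle around \<beta>, and the expected modulus of Z_n
  over \<delta> \<le> |\<eta>| \<le> \<pi>; only then is almost sure geometric decay deduced. On the
  circle Cauchy's formula makes the averaged bound uniform on a smaller disc; far from 0 the
  averaged bound is itself what the Fourier integral needs.

  All regimes come from one expansion with error o(n^(-3/2)). Subtracting W(\<beta>) removes the
  term of order n^(-1/2). The rest starts with i W'(\<beta>) \<eta>, whose Gaussian integral is
  proportional to c_n / sqrt n times an exponential. For bounded c_n this is no larger than the next
  order, where the product of W'(\<beta>) with the cubic term of \<phi> yields kappa_3 and the
  quadratic term of W yields W''(\<beta>).\<close>

lemma particles_length: "(u, x) \<in> particles xi n w \<Longrightarrow> length u = n"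
  by (induction n arbitrary: u x) auto

lemma particles_unique: "(u, x) \<in> particles xi n w \<Longrightarrow> (u, y) \<in> particles xi n w \<Longrightarrow> x = y"
  by (induction n arbitrary: u x y) auto

lemma particles_Suc_eq:
  "particles xi (Suc n) w = (\<Union>p\<in>particles xi n w.
     (\<lambda>i. (fst p @ [i], snd p + xi (fst p) w ! i)) ` {..<length (xi (fst p) w)})"
  by (force simp: image_iff)

lemma finite_particles: "finite (particles xi n w)"
proof (induction n)
  case (Suc n)
  then show ?case unfolding particles_Suc_eq by blast
qed simp

lemma particles_cong:
  assumes "\<And>u. length u < n \<Longrightarrow> X u w = Y u w'"
  shows "particles X n w = particles Y n w'"
  using assms
proof (induction n)
  case (Suc n)
  then have "particles X n w = particles Y n w'" by simp
  moreover have "X (fst p) w = Y (fst p) w'" if "p \<in> particles X n w" for p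
    using Suc.prems particles_length[of "fst p" "snd p" X n w] that by auto
  ultimately show ?case unfolding particles_Suc_eq by simp
qed simp

text \<open>A countable set containing every possible configuration of generation \<open>n\<close>.
  It makes the configuration a discrete random variable: a function of it and of further randomness
  is measurable as soon as it is so for each fixed configuration.\<close>

definition gens :: "nat \<Rightarrow> (nat list \<times> int) set set" where
  "gens n = {P. finite P \<and> (\<forall>p\<in>P. length (fst p) = n) \<and> inj_on fst P}"

lemma countable_gens: "countable (gens n)"
  by (rule countable_subset[OF _ countable_Collect_finite]) (auto simp: gens_def)

lemma particles_gens: "particles xi n w \<in> gens n"
  by (auto simp: gens_def finite_particles inj_on_def dest: particles_length particles_unique)

definition lsum :: "complex \<Rightarrow> int list \<Rightarrow> complex" where
  "lsum z l = (\<Sum>x\<leftarrow>l. exp (z * of_int x))"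

definition psum :: "complex \<Rightarrow> (nat list \<times> int) set \<Rightarrow> complex" where
  "psum z P = (\<Sum>p\<in>P. exp (z * of_int (snd p)))"

lemma psum_0: "psum z (particles xi 0 w) = 1"
  by (simp add: psum_def)

lemma lsum_nth: "lsum z l = (\<Sum>i<length l. exp (z * of_int (l ! i)))"
  by (simp add: lsum_def sum_list_sum_nth lessThan_atLeast0)

lemma psum_Suc:
  "psum z (particles xi (Suc n) w) =
    (\<Sum>p\<in>particles xi n w. exp (z * of_int (snd p)) * lsum z (xi (fst p) w))"
proof -
  let ?h = "\<lambda>p i. (fst p @ [i], snd p + xi (fst p) w ! i)"
  have "psum z (particles xi (Suc n) w) =
    (\<Sum>p\<in>particles xi n w. \<Sum>q\<in>?h p ` {..<length (xi (fst p) w)}. exp (z * of_int (snd q)))"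
    unfolding psum_def particles_Suc_eq
  proof (rule sum.UNION_disjoint[OF finite_particles])
    show "\<forall>i\<in>particles xi n w. \<forall>j\<in>particles xi n w. i \<noteq> j \<longrightarrow>
       ?h i ` {..<length (xi (fst i) w)} \<inter> ?h j ` {..<length (xi (fst j) w)} = {}"
      using particles_unique[of _ _ xi n w] by fastforce
  qed auto
  also have "\<dots> = (\<Sum>p\<in>particles xi n w. exp (z * of_int (snd p)) * lsum z (xi (fst p) w))"
  proof (rule sum.cong[OF refl])
    fix p
    have "inj_on (?h p) {..<length (xi (fst p) w)}" by (auto simp: inj_on_def)
    then show "(\<Sum>q\<in>?h p ` {..<length (xi (fst p) w)}. exp (z * of_int (snd q)))
       = exp (z * of_int (snd p)) * lsum z (xi (fst p) w)"
      by (simp add: sum.reindex lsum_nth sum_distrib_left exp_add algebra_simps)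
  qed
  finally show ?thesis .
qed

text \<open>Stated for an arbitrary family \<open>X\<close> on an arbitrary space \<open>N\<close>
  because it serves twice: for \<open>xi\<close> on the probability space, and for the coordinate
  maps on the product space that carries the offspring lists of earlier generations.\<close>

lemma pred_particles:
  assumes "\<And>u. length u < n \<Longrightarrow> X u \<in> N \<rightarrow>\<^sub>M count_space UNIV"
  shows "Measurable.pred N (\<lambda>w. p \<in> particles X n w)"
  using assms
proof (induction n arbitrary: p)
  case (Suc n)
  obtain v y where p: "p = (v, y)" by force
  show ?case
  proof (cases "v \<noteq> [] \<and> length (butlast v) = n")
    case True
    define u i where "u = butlast v" and "i = last v"
    \<comment> \<open>The label fixes the parent \<open>u\<close> and the index \<open>i\<close>;
      only the position \<open>x\<close> of the parent is unknown, and it ranges over a countable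
      set.\<close>
    have eq: "p \<in> particles X (Suc n) w \<longleftrightarrow>
      (\<exists>x. (u, x) \<in> particles X n w \<and> (\<lambda>l. i < length l \<and> y = x + l ! i) (X u w))" for w
    proof -
      have v: "v = u @ [i]" using True by (simp add: u_def i_def)
      show ?thesis unfolding p v by (simp add: conj_ac)
    qed
    have 1: "Measurable.pred N (\<lambda>w. (u, x) \<in> particles X n w)" for x
      using Suc by simp
    have Xu: "X u \<in> N \<rightarrow>\<^sub>M count_space UNIV" using Suc.prems True by (simp add: u_def)
    have 2: "Measurable.pred N (\<lambda>w. (\<lambda>l. i < length l \<and> y = x + l ! i) (X u w))" for x
      by (rule measurable_compose[OF Xu]) simp
    show ?thesis unfolding eq using 1 2 by measurable
  next
    case False
    then have "p \<notin> particles X (Suc n) w" for w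
      using particles_length[of v y X "Suc n" w] p by auto
    then have "(\<lambda>w. p \<in> particles X (Suc n) w) = (\<lambda>w. False)" by blast
    then show ?thesis by simp
  qed
qed simp

lemma measurable_particles:
  assumes "\<And>u. length u < n \<Longrightarrow> X u \<in> N \<rightarrow>\<^sub>M count_space UNIV"
  shows "particles X n \<in> N \<rightarrow>\<^sub>M count_space (gens n)"
proof (rule iffD2[OF measurable_count_space_eq_countable[OF countable_gens]], intro conjI ballI)
  show "particles X n \<in> space N \<rightarrow> gens n" by (simp add: particles_gens)
  fix P
  have [measurable]: "Measurable.pred N (\<lambda>w. p \<in> particles X n w)" for p
    by (rule pred_particles[OF assms])
  have "Measurable.pred N (\<lambda>w. \<forall>p. p \<in> particles X n w \<longleftrightarrow> p \<in> P)" by measurable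
  then show "particles X n -` {P} \<inter> space N \<in> sets N"
    by (simp add: pred_def set_eq_iff vimage_def Int_def conj_commute)
qed

section \<open>Independence of the offspring of a generation from its past\<close>

locale brw = prob_space M for M :: "'a measure" +
  fixes xi :: "nat list \<Rightarrow> 'a \<Rightarrow> int list"
  assumes indep: "indep_vars (\<lambda>_. count_space UNIV) xi UNIV"
    and distr: "\<And>u. distr M (count_space UNIV) (xi u) = distr M (count_space UNIV) (xi [])"
begin

lemma xi_meas [measurable]: "xi u \<in> M \<rightarrow>\<^sub>M count_space UNIV"
  using indep unfolding indep_vars_def by auto

lemma particles_meas [measurable]: "particles xi n \<in> M \<rightarrow>\<^sub>M count_space (gens n)"
  by (rule measurable_particles) simp

lemma psum_meas [measurable]: "(\<lambda>w. f (particles xi n w)) \<in> M \<rightarrow>\<^sub>M borel"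
  by (rule measurable_compose[OF particles_meas]) simp

lemma xi_nn_integral: "(\<integral>\<^sup>+w. f (xi u w) \<partial>M) = (\<integral>\<^sup>+w. f (xi [] w) \<partial>M)"
proof -
  have "(\<integral>\<^sup>+w. f (xi u w) \<partial>M) = (\<integral>\<^sup>+l. f l \<partial>distr M (count_space UNIV) (xi u))" for u
    by (simp add: nn_integral_distr)
  then show ?thesis by (simp only: distr[of u])
qed

lemma xi_integral: 
  fixes f :: "int list \<Rightarrow> 'b :: {banach, second_countable_topology}"
  shows "(\<integral>w. f (xi u w) \<partial>M) = (\<integral>w. f (xi [] w) \<partial>M)"
proof -
  have "(\<integral>w. f (xi u w) \<partial>M) = (\<integral>l. f l \<partial>distr M (count_space UNIV) (xi u))" for u
    by (simp add: integral_distr)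
  then show ?thesis by (simp only: distr[of u])
qed

lemma xi_integrable: 
  fixes f :: "int list \<Rightarrow> 'b :: {banach, second_countable_topology}"
  shows "integrable M (\<lambda>w. f (xi u w)) \<longleftrightarrow> integrable M (\<lambda>w. f (xi [] w))"
proof -
  have "integrable M (\<lambda>w. f (xi u w)) \<longleftrightarrow> integrable (distr M (count_space UNIV) (xi u)) f" for u
    by (simp add: integrable_distr_eq)
  then show ?thesis by (simp only: distr[of u])
qed

abbreviation "gen n \<equiv> {u :: nat list. length u = n}"
abbreviation "PG n \<equiv> PiM (gen n) (\<lambda>_. count_space (UNIV :: int list set))"

abbreviation "old n \<equiv> {u :: nat list. length u < n}"
abbreviation "PO n \<equiv> PiM (old n) (\<lambda>_. count_space (UNIV :: int list set))"

lemma indep_gen: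
  "distr M (PO n) (\<lambda>w. \<lambda>u\<in>old n. xi u w) \<Otimes>\<^sub>M distr M (PG n) (\<lambda>w. \<lambda>u\<in>gen n. xi u w)
    = distr M (PO n \<Otimes>\<^sub>M PG n) (\<lambda>w. (\<lambda>u\<in>old n. xi u w, \<lambda>u\<in>gen n. xi u w))"
proof -
  have "indep_var (PO n) (\<lambda>w. \<lambda>u\<in>old n. xi u w) (PG n) (\<lambda>w. \<lambda>u\<in>gen n. xi u w)"
    by (rule indep_var_restrict[OF indep]) auto
  then show ?thesis unfolding indep_var_distribution_eq by blast
qed

text \<open>The configuration of generation \<open>n\<close> depends only on the offspring lists of
  shorter labels. Written on their product space it can be handed to Fubini's theorem.\<close>

lemma particles_old: "particles (\<lambda>u y. y u) n (\<lambda>u\<in>old n. xi u w) = particles xi n w"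
  by (intro particles_cong) simp

lemma measurable_particles_old [measurable]:
  "particles (\<lambda>u y. y u) n \<in> PO n \<rightarrow>\<^sub>M count_space (gens n)"
  by (rule measurable_particles) simp

lemma measurable_particles_pair:
  assumes f: "\<And>P. P \<in> gens n \<Longrightarrow> f P \<in> PG n \<rightarrow>\<^sub>M N"
  shows "(\<lambda>x. f (particles (\<lambda>u y. y u) n (fst x)) (snd x)) \<in> PO n \<Otimes>\<^sub>M PG n \<rightarrow>\<^sub>M N"
  by (rule measurable_compose_countable'[where f = "\<lambda>P x. f P (snd x)" and I = "gens n"])
     (auto intro!: measurable_compose[OF measurable_snd f] countable_gens)

lemma gen_rv: "(\<lambda>w. \<lambda>u\<in>gen n. xi u w) \<in> M \<rightarrow>\<^sub>M PG n"
  by (intro measurable_restrict) simp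

lemma old_rv: "(\<lambda>w. \<lambda>u\<in>old n. xi u w) \<in> M \<rightarrow>\<^sub>M PO n"
  by (intro measurable_restrict) simp

text \<open>Takes the place of conditioning on the first \<open>n\<close> generations. The labels of
  length below \<open>n\<close> and those of length \<open>n\<close> are disjoint, so past and new
  offspring lists have a product law, and Fubini lets the offspring be redrawn from an independent
  copy \<open>v\<close> while the configuration stays frozen at \<open>w\<close>.\<close>

lemma gen_nn_integral:
  assumes f: "\<And>P. P \<in> gens n \<Longrightarrow> f P \<in> borel_measurable (PG n)"
  shows "(\<integral>\<^sup>+w. f (particles xi n w) (\<lambda>u\<in>gen n. xi u w) \<partial>M)
    = (\<integral>\<^sup>+w. (\<integral>\<^sup>+v. f (particles xi n w) (\<lambda>u\<in>gen n. xi u v) \<partial>M) \<partial>M)"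
proof -
  let ?X = "\<lambda>w. \<lambda>u\<in>old n. xi u w" and ?p = "particles (\<lambda>u y. y u) n"
  let ?Q = "distr M (PO n) ?X"
  let ?Y = "\<lambda>w. \<lambda>u\<in>gen n. xi u w"
  let ?N = "distr M (PG n) ?Y"
  note gen_rv[measurable] old_rv[measurable]
  interpret Q: prob_space ?Q by (rule prob_space_distr) (rule old_rv)
  interpret N: prob_space ?N by (rule prob_space_distr) (rule gen_rv)
  have mf: "(\<lambda>x. f (?p (fst x)) (snd x)) \<in> borel_measurable (PO n \<Otimes>\<^sub>M PG n)"
    by (rule measurable_particles_pair[OF f])
  have mf': "(\<lambda>x. f (?p (fst x)) (snd x)) \<in> borel_measurable (?Q \<Otimes>\<^sub>M ?N)"
    using mf by (subst measurable_cong_sets[OF sets_pair_measure_cong refl]) auto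
  have "(\<integral>\<^sup>+w. f (particles xi n w) (?Y w) \<partial>M) = (\<integral>\<^sup>+x. f (?p (fst x)) (snd x) \<partial>(?Q \<Otimes>\<^sub>M ?N))"
    unfolding indep_gen by (subst nn_integral_distr) (use mf in \<open>auto simp: particles_old\<close>)
  also have "\<dots> = (\<integral>\<^sup>+P. \<integral>\<^sup>+y. f (?p P) y \<partial>?N \<partial>?Q)"
    using N.nn_integral_fst[OF mf'] by simp
  also have "\<dots> = (\<integral>\<^sup>+w. (\<integral>\<^sup>+y. f (particles xi n w) y \<partial>?N) \<partial>M)"
    by (subst nn_integral_distr) (auto simp: particles_old intro!: measurable_compose[OF measurable_particles_old])
  also have "\<dots> = (\<integral>\<^sup>+w. (\<integral>\<^sup>+v. f (particles xi n w) (?Y v) \<partial>M) \<partial>M)"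
    by (intro nn_integral_cong nn_integral_distr) (auto intro: f particles_gens)
  finally show ?thesis .
qed

lemma gen_integral:
  fixes f :: "_ \<Rightarrow> _ \<Rightarrow> 'b :: {banach, second_countable_topology}"
  assumes f: "\<And>P. P \<in> gens n \<Longrightarrow> f P \<in> borel_measurable (PG n)"
    and int: "integrable M (\<lambda>w. f (particles xi n w) (\<lambda>u\<in>gen n. xi u w))"
  shows "(\<integral>w. f (particles xi n w) (\<lambda>u\<in>gen n. xi u w) \<partial>M)
    = (\<integral>w. (\<integral>v. f (particles xi n w) (\<lambda>u\<in>gen n. xi u v) \<partial>M) \<partial>M)"
proof -
  let ?X = "\<lambda>w. \<lambda>u\<in>old n. xi u w" and ?p = "particles (\<lambda>u y. y u) n"
  let ?Q = "distr M (PO n) ?X"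
  let ?Y = "\<lambda>w. \<lambda>u\<in>gen n. xi u w"
  let ?N = "distr M (PG n) ?Y"
  note gen_rv[measurable] old_rv[measurable]
  interpret Q: prob_space ?Q by (rule prob_space_distr) (rule old_rv)
  interpret N: prob_space ?N by (rule prob_space_distr) (rule gen_rv)
  interpret QN: pair_sigma_finite ?Q ?N ..
  have mf: "(\<lambda>x. f (?p (fst x)) (snd x)) \<in> borel_measurable (PO n \<Otimes>\<^sub>M PG n)"
    by (rule measurable_particles_pair[OF f])
  have int': "integrable (?Q \<Otimes>\<^sub>M ?N) (\<lambda>x. f (?p (fst x)) (snd x))"
    unfolding indep_gen by (subst integrable_distr_eq) (use mf int in \<open>auto simp: particles_old\<close>)
  have "(\<integral>w. f (particles xi n w) (?Y w) \<partial>M) = (\<integral>x. f (?p (fst x)) (snd x) \<partial>(?Q \<Otimes>\<^sub>M ?N))"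
    unfolding indep_gen by (subst integral_distr) (use mf in \<open>auto simp: particles_old\<close>)
  also have "\<dots> = (\<integral>P. \<integral>y. f (?p P) y \<partial>?N \<partial>?Q)"
    using QN.integral_fst'[OF int'] by simp
  also have "\<dots> = (\<integral>w. (\<integral>y. f (particles xi n w) y \<partial>?N) \<partial>M)"
    by (subst integral_distr) (auto simp: particles_old intro!: measurable_compose[OF measurable_particles_old])
  also have "\<dots> = (\<integral>w. (\<integral>v. f (particles xi n w) (?Y v) \<partial>M) \<partial>M)"
    by (intro Bochner_Integration.integral_cong refl integral_distr) (auto intro: f particles_gens)
  finally show ?thesis .
qed

end

section \<open>Sums of independent centred variables in \<open>L\<^sup>1\<close>\<close>

text \<open>Each \<open>V i\<close> is split at modulus 1. The bounded parts, once centred, are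
  orthogonal, and since \<open>p \<le> 2\<close> their variances are at most the \<open>p\<close>-th
  moments; the excess is at most |V|^p because \<open>p > 1\<close>. The free parameter
  \<open>c\<close> comes from x \<le> (x^2 / c + c) / 2. This replaces a square root and keeps the
  bound affine in \<open>A\<close>, which matters because \<open>A\<close> is later averaged over
  configurations.\<close>

lemma (in prob_space) truncation_L1_bound:
  fixes V :: "'i \<Rightarrow> 'a \<Rightarrow> complex"
  assumes I: "finite I" and ind: "indep_vars (\<lambda>_. borel) V I"
    and int: "\<And>i. i \<in> I \<Longrightarrow> integrable M (V i)"
    and intp: "\<And>i. i \<in> I \<Longrightarrow> integrable M (\<lambda>w. norm (V i w) powr p)"
    and p: "1 < p" "p \<le> 2" and c: "c > 0"
  defines "A \<equiv> \<Sum>i\<in>I. \<integral>w. norm (V i w) powr p \<partial>M"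
  shows "(\<integral>w. norm (\<Sum>i\<in>I. V i w - expectation (V i)) \<partial>M) \<le> (A / c + c) / 2 + 2 * A"
proof -
  define t :: "complex \<Rightarrow> complex" where "t x = (if norm x \<le> 1 then x else 0)" for x
  define T where "T = (\<lambda>i w. t (V i w))"
  define U where "U = (\<lambda>i w. T i w - expectation (T i))"
  have t_meas [measurable]: "t \<in> borel_measurable borel" unfolding t_def by measurable
  have [measurable]: "cnj \<in> borel_measurable borel"
    by (intro borel_measurable_continuous_onI continuous_intros)
  have t1: "norm (t x) \<le> 1" for x by (simp add: t_def)
  have V [measurable]: "V i \<in> borel_measurable M" if "i \<in> I" for i using int[OF that] by auto
  have T [measurable]: "T i \<in> borel_measurable M" if "i \<in> I" for i
    unfolding T_def using that by measurable
  have Tint [simp]: "integrable M (T i)" if "i \<in> I" for i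
    by (rule integrable_const_bound[where B = 1]) (use that in \<open>auto simp: T_def t1\<close>)
  have U [measurable]: "U i \<in> borel_measurable M" if "i \<in> I" for i
    unfolding U_def using that by measurable
  have nET: "norm (expectation (T i)) \<le> 1" for i
  proof -
    have "norm (expectation (T i)) \<le> expectation (\<lambda>w. norm (T i w))" by (rule integral_norm_bound)
    also have "\<dots> \<le> expectation (\<lambda>w. 1)"
    \<comment> \<open>For \<open>i\<close> outside \<open>I\<close> nothing is known about
      \<open>T i\<close>; if its norm is not integrable, the integral is 0 by convention.\<close>
    proof (cases "integrable M (\<lambda>w. norm (T i w))")
      case True then show ?thesis by (intro integral_mono) (auto simp: T_def t1)
    next
      case False then show ?thesis by (simp add: not_integrable_integral_eq)
    qed
    finally show ?thesis by (simp add: prob_space)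
  qed
  have U2: "norm (U i w) \<le> 2" for i w
    using norm_triangle_ineq4[of "T i w" "expectation (T i)"] t1[of "V i w"] nET[of i]
    by (simp add: U_def T_def)
  have Uint [simp]: "integrable M (U i)" if "i \<in> I" for i
    unfolding U_def using that by simp
  have EU: "expectation (U i) = 0" if "i \<in> I" for i
    using that by (simp add: U_def prob_space)
  have indU: "indep_vars (\<lambda>_. borel) U I"
    using indep_vars_compose2[OF ind, of "\<lambda>i x. t x - expectation (T i)" "\<lambda>_. borel"]
    by (simp add: U_def T_def)
  have UUint [simp]: "integrable M (\<lambda>w. U i w * cnj (U j w))" if "i \<in> I" "j \<in> I" for i j
  proof (rule integrable_const_bound[where B = 4])
    show "AE w in M. norm (U i w * cnj (U j w)) \<le> 4"
      using mult_mono[OF U2 U2] by (auto simp: norm_mult)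
  qed (use that in measurable)
  have orth: "expectation (\<lambda>w. U i w * cnj (U j w)) = 0" if ij: "i \<in> I" "j \<in> I" "i \<noteq> j" for i j
  proof -
    have "indep_var (PiM {i} (\<lambda>_. borel)) (\<lambda>w. \<lambda>i\<in>{i}. U i w) (PiM {j} (\<lambda>_. borel)) (\<lambda>w. \<lambda>j\<in>{j}. U j w)"
      by (rule indep_var_restrict[OF indU]) (use ij in auto)
    then have "indep_var borel ((\<lambda>y. y i) \<circ> (\<lambda>w. \<lambda>i\<in>{i}. U i w)) borel ((\<lambda>y. cnj (y j)) \<circ> (\<lambda>w. \<lambda>j\<in>{j}. U j w))"
      by (rule indep_var_compose) auto
    then have "expectation (\<lambda>w. U i w * cnj (U j w)) = expectation (U i) * expectation (\<lambda>w. cnj (U j w))"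
      using ij by (intro indep_var_lebesgue_integral) (auto simp: comp_def)
    then show ?thesis using EU ij by simp
  qed
  \<comment> \<open>The variance is at most the second moment. Where \<open>T i\<close> does not
    vanish, |V| is at most 1, and there the smaller exponent \<open>p\<close> gives the larger
    power.\<close>
  have Usq: "expectation (\<lambda>w. (norm (U i w))\<^sup>2) \<le> expectation (\<lambda>w. norm (V i w) powr p)" if i: "i \<in> I" for i
  proof -
    let ?e = "expectation (T i)"
    define g where "g w = Re (T i w * cnj ?e)" for w
    have eq: "(norm (U i w))\<^sup>2 = (norm (T i w))\<^sup>2 - 2 * g w + (norm ?e)\<^sup>2" for w
      unfolding U_def cmod_power2 g_def by (simp add: power2_eq_square algebra_simps)
    have T2: "integrable M (\<lambda>w. (norm (T i w))\<^sup>2)"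
      by (rule integrable_const_bound[where B = 1])
        (use i in \<open>auto simp: T_def t1 power_le_one\<close>)
    have "expectation (\<lambda>w. Re (T i w * cnj ?e)) = Re (?e * cnj ?e)"
      using i by simp
    also have "\<dots> = (norm ?e)\<^sup>2" by (simp add: complex_norm_square[symmetric] del: of_real_power)
    finally have cross: "expectation g = (norm ?e)\<^sup>2" by (simp only: g_def[abs_def])
    have crossint: "integrable M g"
      unfolding g_def[abs_def] using i by (intro integrable_Re integrable_mult_left) auto
    have "expectation (\<lambda>w. (norm (U i w))\<^sup>2)
        = expectation (\<lambda>w. (norm (T i w))\<^sup>2) - 2 * (norm ?e)\<^sup>2 + (norm ?e)\<^sup>2"
      unfolding eq using T2 crossint cross by (simp add: prob_space)
    also have "\<dots> \<le> expectation (\<lambda>w. (norm (T i w))\<^sup>2)" by simp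
    also have "\<dots> \<le> expectation (\<lambda>w. norm (V i w) powr p)"
    proof (rule integral_mono[OF T2 intp[OF i]])
      fix w
      show "(norm (T i w))\<^sup>2 \<le> norm (V i w) powr p"
      proof (cases "norm (V i w) \<le> 1 \<and> V i w \<noteq> 0")
        case True
        then have "norm (V i w) powr 2 \<le> norm (V i w) powr p"
          using p by (intro powr_mono') auto
        then show ?thesis using True by (simp add: T_def t_def)
      qed (auto simp: T_def t_def)
    qed
    finally show ?thesis .
  qed
  have S2: "expectation (\<lambda>w. (norm (\<Sum>i\<in>I. U i w))\<^sup>2) \<le> A"
  proof -
    have "complex_of_real ((norm (\<Sum>i\<in>I. U i w))\<^sup>2) = (\<Sum>i\<in>I. \<Sum>j\<in>I. U i w * cnj (U j w))" for w
      unfolding complex_norm_square by (simp add: sum_product)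
    then have "complex_of_real (expectation (\<lambda>w. (norm (\<Sum>i\<in>I. U i w))\<^sup>2))
       = expectation (\<lambda>w. \<Sum>i\<in>I. \<Sum>j\<in>I. U i w * cnj (U j w))"
      by (subst integral_complex_of_real[symmetric]) simp
    also have "\<dots> = (\<Sum>i\<in>I. \<Sum>j\<in>I. expectation (\<lambda>w. U i w * cnj (U j w)))"
      by (subst Bochner_Integration.integral_sum; simp)+
    also have "\<dots> = (\<Sum>i\<in>I. expectation (\<lambda>w. U i w * cnj (U i w)))"
    proof (rule sum.cong[OF refl])
      fix i assume i: "i \<in> I"
      have "(\<Sum>j\<in>I. expectation (\<lambda>w. U i w * cnj (U j w))) = (\<Sum>j\<in>{i}. expectation (\<lambda>w. U i w * cnj (U j w)))"
        using i I orth by (intro sum.mono_neutral_right) auto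
      then show "(\<Sum>j\<in>I. expectation (\<lambda>w. U i w * cnj (U j w))) = expectation (\<lambda>w. U i w * cnj (U i w))"
        by simp
    qed
    also have "\<dots> = complex_of_real (\<Sum>i\<in>I. expectation (\<lambda>w. (norm (U i w))\<^sup>2))"
      unfolding complex_norm_square[symmetric] by (simp add: integral_complex_of_real[symmetric] del: integral_complex_of_real)
    finally have "expectation (\<lambda>w. (norm (\<Sum>i\<in>I. U i w))\<^sup>2) = (\<Sum>i\<in>I. expectation (\<lambda>w. (norm (U i w))\<^sup>2))"
      using of_real_eq_iff by blast
    also have "\<dots> \<le> A" unfolding A_def by (intro sum_mono Usq)
    finally show ?thesis .
  qed
  define R where "R = (\<lambda>i w. V i w - T i w)"
  have Rint [simp]: "integrable M (R i)" if "i \<in> I" for i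
    unfolding R_def using that int by simp
  have Rb: "expectation (\<lambda>w. norm (R i w)) \<le> expectation (\<lambda>w. norm (V i w) powr p)" if i: "i \<in> I" for i
  proof (rule integral_mono)
    fix w
    show "norm (R i w) \<le> norm (V i w) powr p"
    proof (cases "norm (V i w) \<le> 1")
      case False
      then have "norm (V i w) powr 1 \<le> norm (V i w) powr p" using p by (intro powr_mono) auto
      then show ?thesis using False by (simp add: R_def T_def t_def)
    qed (simp add: R_def T_def t_def)
  qed (use i intp in auto)
  have S2int: "integrable M (\<lambda>w. (norm (\<Sum>i\<in>I. U i w))\<^sup>2)"
  proof (rule integrable_const_bound[where B = "(\<Sum>i\<in>I. 2)\<^sup>2"])
    show "AE w in M. norm ((norm (\<Sum>i\<in>I. U i w))\<^sup>2) \<le> (\<Sum>i\<in>I. 2)\<^sup>2"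
      by (auto intro!: AE_I2 power_mono sum_norm_le U2 simp del: sum_constant)
  qed measurable
  let ?b = "\<lambda>w. ((norm (\<Sum>i\<in>I. U i w))\<^sup>2 / c + c) / 2 + (\<Sum>i\<in>I. norm (R i w) + norm (expectation (R i)))"
  have "(\<integral>w. norm (\<Sum>i\<in>I. V i w - expectation (V i)) \<partial>M) \<le> expectation ?b"
  proof (rule integral_mono)
    show "integrable M (\<lambda>w. norm (\<Sum>i\<in>I. V i w - expectation (V i)))"
      using int by simp
    show "integrable M ?b" using S2int by simp
    fix w
    have "(\<Sum>i\<in>I. V i w - expectation (V i)) = (\<Sum>i\<in>I. U i w) + (\<Sum>i\<in>I. R i w - expectation (R i))"
      unfolding sum.distrib[symmetric] by (intro sum.cong refl) (simp add: U_def R_def int)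
    also have "norm \<dots> \<le> norm (\<Sum>i\<in>I. U i w) + norm (\<Sum>i\<in>I. R i w - expectation (R i))"
      by (rule norm_triangle_ineq)
    also have "norm (\<Sum>i\<in>I. U i w) \<le> ((norm (\<Sum>i\<in>I. U i w))\<^sup>2 / c + c) / 2"
      using c zero_le_power2[of "norm (\<Sum>i\<in>I. U i w) - c"]
      by (simp add: field_simps power2_eq_square)
    also have "norm (\<Sum>i\<in>I. R i w - expectation (R i)) \<le> (\<Sum>i\<in>I. norm (R i w) + norm (expectation (R i)))"
      by (intro sum_norm_le norm_triangle_ineq4)
    finally show "norm (\<Sum>i\<in>I. V i w - expectation (V i)) \<le> ?b w" by simp
  qed
  also have "\<dots> = (expectation (\<lambda>w. (norm (\<Sum>i\<in>I. U i w))\<^sup>2) / c + c) / 2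
      + (\<Sum>i\<in>I. expectation (\<lambda>w. norm (R i w)) + norm (expectation (R i)))"
    using S2int by (simp add: prob_space)
  also have "\<dots> \<le> (A / c + c) / 2 + (\<Sum>i\<in>I. 2 * expectation (\<lambda>w. norm (V i w) powr p))"
  proof (intro add_mono divide_right_mono sum_mono S2)
    fix i assume i: "i \<in> I"
    have "norm (expectation (R i)) \<le> expectation (\<lambda>w. norm (R i w))" by (rule integral_norm_bound)
    then show "expectation (\<lambda>w. norm (R i w)) + norm (expectation (R i))
       \<le> 2 * expectation (\<lambda>w. norm (V i w) powr p)"
      using Rb[OF i] by linarith
  qed (use c in auto)
  finally show ?thesis by (simp add: A_def sum_distrib_left)
qed

section \<open>Increments of the partition function\<close>

definition lsumr :: "real \<Rightarrow> int list \<Rightarrow> real" where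
  "lsumr \<theta> l = (\<Sum>x\<leftarrow>l. exp (\<theta> * real_of_int x))"

definition psumr :: "real \<Rightarrow> (nat list \<times> int) set \<Rightarrow> real" where
  "psumr \<theta> P = (\<Sum>p\<in>P. exp (\<theta> * real_of_int (snd p)))"

lemma lsumr_nonneg: "0 \<le> lsumr \<theta> l"
  by (auto simp: lsumr_def intro!: sum_list_nonneg)

lemma psumr_nonneg: "0 \<le> psumr \<theta> P"
  by (auto simp: psumr_def intro!: sum_nonneg)

lemma lsum_of_real: "lsum (of_real \<theta>) l = of_real (lsumr \<theta> l)"
  by (simp add: lsum_nth lsumr_def sum_list_sum_nth lessThan_atLeast0 flip: exp_of_real)

lemma psum_of_real: "psum (of_real \<theta>) P = of_real (psumr \<theta> P)"
  by (simp add: psum_def psumr_def flip: exp_of_real)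

lemma norm_lsum_le: "norm (lsum z l) \<le> lsumr (Re z) l"
  by (simp add: lsum_nth lsumr_def sum_list_sum_nth lessThan_atLeast0 sum_norm_le)

lemma norm_psum_le: "norm (psum z P) \<le> psumr (Re z) P"
  by (simp add: psum_def psumr_def sum_norm_le)

lemma psumr_Suc:
  "psumr \<theta> (particles xi (Suc n) w) =
    (\<Sum>p\<in>particles xi n w. exp (\<theta> * real_of_int (snd p)) * lsumr \<theta> (xi (fst p) w))"
proof -
  have "complex_of_real (psumr \<theta> (particles xi (Suc n) w)) =
     (\<Sum>p\<in>particles xi n w. exp (of_real \<theta> * of_int (snd p)) * lsum (of_real \<theta>) (xi (fst p) w))"
    unfolding psum_of_real[symmetric] by (rule psum_Suc)
  also have "\<dots> = complex_of_real (\<Sum>p\<in>particles xi n w. exp (\<theta> * real_of_int (snd p)) * lsumr \<theta> (xi (fst p) w))"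
    by (simp add: lsum_of_real flip: exp_of_real)
  finally show ?thesis using of_real_eq_iff by blast
qed

text \<open>Passes from labels to particles: the increment is a sum over pairs of label and
  position, and \<open>fst\<close> is injective on a configuration.\<close>

lemma (in prob_space) indep_vars_reindex_inj:
  assumes "indep_vars (\<lambda>_. N) X (f ` I)" "inj_on f I"
  shows "indep_vars (\<lambda>_. N) (X \<circ> f) I"
  unfolding indep_vars_def2 indep_sets_def
proof (intro conjI ballI allI impI)
  fix J A assume J: "J \<subseteq> I" "J \<noteq> {}" "finite J" 
    and A: "A \<in> (\<Pi> j\<in>J. {(X \<circ> f) j -` A \<inter> space M |A. A \<in> sets N})"
  have inj: "inj_on f J" using J assms(2) inj_on_subset by blast
  define A' where "A' = A \<circ> the_inv_into J f"
  have A'f: "A' (f j) = A j" if "j \<in> J" for j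
    using that inj by (simp add: A'_def the_inv_into_f_f)
  have "indep_sets (\<lambda>i. {X i -` A \<inter> space M |A. A \<in> sets N}) (f ` I)"
    using assms(1) by (simp add: indep_vars_def2)
  then have "prob (\<Inter>j\<in>f ` J. A' j) = (\<Prod>j\<in>f ` J. prob (A' j))"
    by (rule indep_setsD) (use J A A'f in auto)
  then show "prob (\<Inter> (A ` J)) = (\<Prod>j\<in>J. prob (A j))"
    using A'f inj by (simp add: prod.reindex)
qed (use assms in \<open>auto simp: indep_vars_def2 indep_sets_def\<close>)

context brw
begin

definition fin :: "real \<Rightarrow> bool" where
  "fin \<theta> \<longleftrightarrow> integrable M (\<lambda>w. lsumr \<theta> (xi [] w))"

definition mR :: "real \<Rightarrow> real" where
  "mR \<theta> = (\<integral>w. lsumr \<theta> (xi [] w) \<partial>M)"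

definition mC :: "complex \<Rightarrow> complex" where
  "mC z = (\<integral>w. lsum z (xi [] w) \<partial>M)"

lemma xi_fun_meas [measurable]: "(\<lambda>w. f (xi u w)) \<in> M \<rightarrow>\<^sub>M borel"
  by (rule measurable_compose[OF xi_meas]) simp

lemma mC_of_real: "mC (of_real \<theta>) = of_real (mR \<theta>)"
  by (simp add: mC_def mR_def lsum_of_real)

lemma mR_nonneg: "0 \<le> mR \<theta>"
  unfolding mR_def by (intro Bochner_Integration.integral_nonneg lsumr_nonneg)

lemma integrable_lsum: "fin (Re z) \<Longrightarrow> integrable M (\<lambda>w. lsum z (xi u w))"
  unfolding xi_integrable[of "lsum z" u] fin_def
  by (erule Bochner_Integration.integrable_bound) (auto simp: norm_lsum_le lsumr_nonneg)

lemma gen_psum_Suc: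
  "psum z (particles xi (Suc n) w) =
    (\<Sum>p\<in>particles xi n w. exp (z * of_int (snd p)) * lsum z ((\<lambda>u\<in>gen n. xi u w) (fst p)))"
  unfolding psum_Suc by (intro sum.cong refl) (auto dest: particles_length)

lemma PG_sum_meas:
  fixes g :: "_ \<Rightarrow> int list \<Rightarrow> 'b :: {second_countable_topology, topological_comm_monoid_add}"
  assumes "P \<in> gens n"
  shows "(\<lambda>y. \<Sum>p\<in>P. g p (y (fst p))) \<in> borel_measurable (PG n)"
proof (rule borel_measurable_sum)
  fix p assume "p \<in> P"
  then have "fst p \<in> gen n" using assms by (auto simp: gens_def)
  then have "(\<lambda>y. y (fst p)) \<in> PG n \<rightarrow>\<^sub>M count_space UNIV" by (rule measurable_component_singleton)
  then show "(\<lambda>y. g p (y (fst p))) \<in> borel_measurable (PG n)" by (rule measurable_compose) simp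
qed

section \<open>Means of the partition functions\<close>

text \<open>Nonnegative integrals ask for no integrability, which for generation
  \<open>Suc n\<close> is itself part of what has to be shown. Integrability, real and complex, is
  read off afterwards.\<close>

lemma nn_integral_psumr:
  assumes "fin \<theta>"
  shows "(\<integral>\<^sup>+w. ennreal (psumr \<theta> (particles xi n w)) \<partial>M) = ennreal (mR \<theta> ^ n)"
proof (induction n)
  case 0
  then show ?case by (simp add: psumr_def emeasure_space_1)
next
  case (Suc n)
  define f where "f P y = (\<Sum>p\<in>P. ennreal (exp (\<theta> * real_of_int (snd p)) * lsumr \<theta> (y (fst p))))"
    for P :: "(nat list \<times> int) set" and y :: "nat list \<Rightarrow> int list"
  have "ennreal (psumr \<theta> (particles xi (Suc n) w)) = f (particles xi n w) (\<lambda>u\<in>gen n. xi u w)" for w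
    unfolding psumr_Suc f_def
    by (subst sum_ennreal) (auto intro!: sum.cong arg_cong[where f=ennreal] simp: lsumr_nonneg dest: particles_length)
  then have "(\<integral>\<^sup>+w. ennreal (psumr \<theta> (particles xi (Suc n) w)) \<partial>M)
     = (\<integral>\<^sup>+w. f (particles xi n w) (\<lambda>u\<in>gen n. xi u w) \<partial>M)" by simp
  also have "\<dots> = (\<integral>\<^sup>+w. (\<integral>\<^sup>+v. f (particles xi n w) (\<lambda>u\<in>gen n. xi u v) \<partial>M) \<partial>M)"
    by (rule gen_nn_integral) (simp only: f_def[abs_def] PG_sum_meas[where g = "\<lambda>p l. ennreal (exp (\<theta> * real_of_int (snd p)) * lsumr \<theta> l)"])
  also have "\<dots> = (\<integral>\<^sup>+w. ennreal (psumr \<theta> (particles xi n w)) * ennreal (mR \<theta>) \<partial>M)"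
  proof (rule nn_integral_cong)
    fix w
    let ?P = "particles xi n w"
    have 1: "(\<integral>\<^sup>+v. ennreal (lsumr \<theta> (xi u v)) \<partial>M) = ennreal (mR \<theta>)" for u
      unfolding xi_nn_integral[of "\<lambda>l. ennreal (lsumr \<theta> l)" u] mR_def
      by (rule nn_integral_eq_integral) (use assms in \<open>auto simp: fin_def lsumr_nonneg\<close>)
    have "(\<integral>\<^sup>+v. f ?P (\<lambda>u\<in>gen n. xi u v) \<partial>M) =
        (\<integral>\<^sup>+v. (\<Sum>p\<in>?P. ennreal (exp (\<theta> * real_of_int (snd p))) * ennreal (lsumr \<theta> (xi (fst p) v))) \<partial>M)"
      unfolding f_def
      by (intro nn_integral_cong sum.cong refl) (auto dest: particles_length simp: ennreal_mult lsumr_nonneg)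
    also have "\<dots> = (\<Sum>p\<in>?P. ennreal (exp (\<theta> * real_of_int (snd p))) * ennreal (mR \<theta>))"
      by (subst nn_integral_sum) (simp_all add: nn_integral_cmult 1)
    also have "\<dots> = ennreal (psumr \<theta> ?P) * ennreal (mR \<theta>)"
      by (simp add: sum_distrib_right[symmetric] psumr_def)
    finally show "(\<integral>\<^sup>+v. f ?P (\<lambda>u\<in>gen n. xi u v) \<partial>M) = ennreal (psumr \<theta> ?P) * ennreal (mR \<theta>)" .
  qed
  also have "\<dots> = ennreal (mR \<theta> ^ n) * ennreal (mR \<theta>)"
    by (subst nn_integral_multc) (simp_all add: Suc)
  also have "\<dots> = ennreal (mR \<theta> ^ Suc n)"
    by (simp add: mR_nonneg ennreal_mult[symmetric] mult.commute)
  finally show ?case .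
qed

lemma integrable_psumr: "fin \<theta> \<Longrightarrow> integrable M (\<lambda>w. psumr \<theta> (particles xi n w))"
  by (rule integrableI_nonneg) (auto simp: psumr_nonneg nn_integral_psumr)

lemma integral_psumr: "fin \<theta> \<Longrightarrow> (\<integral>w. psumr \<theta> (particles xi n w) \<partial>M) = mR \<theta> ^ n"
  by (subst integral_eq_nn_integral) (auto simp: psumr_nonneg nn_integral_psumr mR_nonneg)

lemma integrable_psum: "fin (Re z) \<Longrightarrow> integrable M (\<lambda>w. psum z (particles xi n w))"
  by (rule Bochner_Integration.integrable_bound[OF integrable_psumr[of "Re z" n]])
     (auto simp: norm_psum_le psumr_nonneg)

lemma integral_psum:
  assumes "fin (Re z)"
  shows "(\<integral>w. psum z (particles xi n w) \<partial>M) = mC z ^ n"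
proof (induction n)
  case 0
  then show ?case by (simp add: psum_def prob_space)
next
  case (Suc n)
  define f where "f P y = (\<Sum>p\<in>P. exp (z * of_int (snd p)) * lsum z (y (fst p)))"
    for P :: "(nat list \<times> int) set" and y :: "nat list \<Rightarrow> int list"
  have eq: "psum z (particles xi (Suc n) w) = f (particles xi n w) (\<lambda>u\<in>gen n. xi u w)" for w
    unfolding f_def by (rule gen_psum_Suc)
  have "(\<integral>w. psum z (particles xi (Suc n) w) \<partial>M)
     = (\<integral>w. f (particles xi n w) (\<lambda>u\<in>gen n. xi u w) \<partial>M)" unfolding eq ..
  also have "\<dots> = (\<integral>w. (\<integral>v. f (particles xi n w) (\<lambda>u\<in>gen n. xi u v) \<partial>M) \<partial>M)"
  proof (rule gen_integral)
    show "integrable M (\<lambda>w. f (particles xi n w) (\<lambda>u\<in>gen n. xi u w))"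
      unfolding eq[symmetric] by (rule integrable_psum[OF assms])
  qed (simp only: f_def[abs_def] PG_sum_meas[where g = "\<lambda>p l. exp (z * of_int (snd p)) * lsum z l"])
  also have "\<dots> = (\<integral>w. psum z (particles xi n w) * mC z \<partial>M)"
  proof (rule Bochner_Integration.integral_cong[OF refl])
    fix w
    let ?P = "particles xi n w"
    have 1: "(\<integral>v. lsum z (xi u v) \<partial>M) = mC z" for u
      unfolding mC_def by (rule xi_integral)
    have "(\<integral>v. f ?P (\<lambda>u\<in>gen n. xi u v) \<partial>M) =
        (\<integral>v. (\<Sum>p\<in>?P. exp (z * of_int (snd p)) * lsum z (xi (fst p) v)) \<partial>M)"
      unfolding f_def
      by (intro Bochner_Integration.integral_cong sum.cong refl) (auto dest: particles_length)
    also have "\<dots> = (\<Sum>p\<in>?P. exp (z * of_int (snd p)) * mC z)"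
      by (subst Bochner_Integration.integral_sum) (simp_all add: integrable_lsum assms 1)
    also have "\<dots> = psum z ?P * mC z"
      by (simp add: sum_distrib_right[symmetric] psum_def)
    finally show "(\<integral>v. f ?P (\<lambda>u\<in>gen n. xi u v) \<partial>M) = psum z ?P * mC z" .
  qed
  also have "\<dots> = mC z ^ Suc n"
    by (simp add: integrable_psum assms Suc)
  finally show ?case .
qed

section \<open>One generation step in L^1\<close>

text \<open>The weights e^(zx) are divided by \<open>b\<close> before truncation, so that level 1
  acts at the scale \<open>b\<close>. Their \<open>p\<close>-th powers have modulus e^(p Re z x);
  hence the partition function at \<open>p * Re z\<close> enters \<open>A\<close>.\<close>

lemma increment_fixed_generation:
  assumes P: "P \<in> gens n" and fin: "fin (Re z)"
    and p: "1 < p" "p \<le> 2" 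
    and intp: "integrable M (\<lambda>w. lsumr (Re z) (xi [] w) powr p)"
    and C: "(\<integral>w. lsumr (Re z) (xi [] w) powr p \<partial>M) \<le> C"
    and b: "b > 0" and c: "c > 0"
  defines "A \<equiv> C * psumr (p * Re z) P / b powr p"
  shows "(\<integral>\<^sup>+v. ennreal (norm (\<Sum>p\<in>P. exp (z * of_int (snd p)) * (lsum z (xi (fst p) v) - mC z))) \<partial>M)
     \<le> ennreal (b * ((A / c + c) / 2 + 2 * A))"
proof -
  have finP: "finite P" and len: "\<And>p. p \<in> P \<Longrightarrow> length (fst p) = n" and inj: "inj_on fst P"
    using P by (auto simp: gens_def)
  define V where "V = (\<lambda>p v. exp (z * of_int (snd p)) / b * lsum z (xi (fst p) v))"
  have "indep_vars (\<lambda>_. count_space UNIV) xi (fst ` P)"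
    by (rule indep_vars_subset[OF indep]) simp
  then have "indep_vars (\<lambda>_. count_space UNIV) (xi \<circ> fst) P"
    using inj by (rule indep_vars_reindex_inj)
  then have ind: "indep_vars (\<lambda>_. borel) V P"
    unfolding V_def comp_def
    by (rule indep_vars_compose2[where Y = "\<lambda>p l. exp (z * of_int (snd p)) / b * lsum z l"]) simp
  have Vint: "integrable M (V p)" for p
    unfolding V_def using fin by (intro integrable_mult_right integrable_lsum)
  have EV: "expectation (V q) = exp (z * of_int (snd q)) / b * mC z" for q
    unfolding V_def mC_def using xi_integral[of "lsum z" "fst q"] by simp
  define K where "K = (\<lambda>q :: nat list \<times> int. exp (p * Re z * real_of_int (snd q)) / b powr p)"
  have Vp: "norm (V q v) powr p = K q * norm (lsum z (xi (fst q) v)) powr p" for q v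
    using b by (simp add: V_def norm_mult norm_divide powr_mult powr_divide K_def
        exp_powr_real mult_ac)
  have lint: "integrable M (\<lambda>v. norm (lsum z (xi u v)) powr p)" for u
  proof -
    have "integrable M (\<lambda>v. norm (lsum z (xi [] v)) powr p)"
      by (rule Bochner_Integration.integrable_bound[OF intp])
         (use p in \<open>auto intro!: powr_mono2 norm_lsum_le\<close>)
    then show ?thesis using xi_integrable[of "\<lambda>l. norm (lsum z l) powr p" u] by simp
  qed
  have lE: "(\<integral>v. norm (lsum z (xi u v)) powr p \<partial>M) \<le> C" for u
  proof -
    have "(\<integral>v. norm (lsum z (xi u v)) powr p \<partial>M) = (\<integral>v. norm (lsum z (xi [] v)) powr p \<partial>M)"
      using xi_integral[of "\<lambda>l. norm (lsum z l) powr p" u] by simp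
    also have "\<dots> \<le> (\<integral>w. lsumr (Re z) (xi [] w) powr p \<partial>M)"
      by (intro integral_mono lint intp) (use p in \<open>auto intro!: powr_mono2 norm_lsum_le\<close>)
    finally show ?thesis using C by simp
  qed
  define A' where "A' = (\<Sum>q\<in>P. \<integral>w. norm (V q w) powr p \<partial>M)"
  have "A' \<le> (\<Sum>q\<in>P. K q * C)"
    unfolding A'_def
  proof (rule sum_mono)
    fix q
    have "(\<integral>w. norm (V q w) powr p \<partial>M) = K q * (\<integral>w. norm (lsum z (xi (fst q) w)) powr p \<partial>M)"
      unfolding Vp by simp
    also have "\<dots> \<le> K q * C" by (rule mult_left_mono[OF lE]) (simp add: K_def)
    finally show "(\<integral>w. norm (V q w) powr p \<partial>M) \<le> K q * C" .
  qed
  also have "\<dots> = A"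
    unfolding A_def K_def psumr_def sum_distrib_left sum_divide_distrib
    by (intro sum.cong refl) (simp add: mult_ac)
  finally have AA: "A' \<le> A" .
  have "(\<integral>w. norm (\<Sum>q\<in>P. V q w - expectation (V q)) \<partial>M) \<le> (A' / c + c) / 2 + 2 * A'"
    unfolding A'_def
    by (rule truncation_L1_bound[OF finP ind Vint _ p c]) (simp add: Vp lint)
  also have "\<dots> \<le> (A / c + c) / 2 + 2 * A"
    using AA c by (intro add_mono divide_right_mono mult_left_mono) auto
  finally have main: "(\<integral>w. norm (\<Sum>q\<in>P. V q w - expectation (V q)) \<partial>M) \<le> (A / c + c) / 2 + 2 * A" .
  have eq: "norm (\<Sum>q\<in>P. exp (z * of_int (snd q)) * (lsum z (xi (fst q) v) - mC z))
      = b * norm (\<Sum>q\<in>P. V q v - expectation (V q))" for v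
  proof -
    have "(\<Sum>q\<in>P. exp (z * of_int (snd q)) * (lsum z (xi (fst q) v) - mC z))
       = of_real b * (\<Sum>q\<in>P. V q v - expectation (V q))"
      unfolding sum_distrib_left EV using b
      by (intro sum.cong refl) (simp add: V_def field_simps)
    then show ?thesis using b by (simp add: norm_mult)
  qed
  have "(\<integral>\<^sup>+v. ennreal (b * norm (\<Sum>q\<in>P. V q v - expectation (V q))) \<partial>M)
      = ennreal (\<integral>v. b * norm (\<Sum>q\<in>P. V q v - expectation (V q)) \<partial>M)"
    using b Vint by (intro nn_integral_eq_integral) auto
  also have "\<dots> \<le> ennreal (b * ((A / c + c) / 2 + 2 * A))"
    using main b by (intro ennreal_leI) (simp add: mult_left_mono)
  finally show ?thesis unfolding eq .
qed

text \<open>Here b = B^n and c = q^n. The mean of \<open>A\<close> is at most C (m(p Re z) / B^p)^n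
  \<le> C q^(2n), and dividing by \<open>c\<close> costs one factor q^n; this is why
  \<open>q\<close> is squared in the hypothesis. \<open>B\<close> is left free since the estimate is
  used with |m(z)| near \<beta> and with m(\<beta>) along the vertical line.\<close>

lemma increment_bound:
  assumes fin: "fin (Re z)" and finp: "fin (p * Re z)"
    and p: "1 < p" "p \<le> 2" 
    and intp: "integrable M (\<lambda>w. lsumr (Re z) (xi [] w) powr p)"
    and C: "(\<integral>w. lsumr (Re z) (xi [] w) powr p \<partial>M) \<le> C"
    and B: "B > 0" and q: "0 < q" "q \<le> 1" and mB: "mR (p * Re z) \<le> B powr p * q\<^sup>2"
  shows "(\<integral>\<^sup>+w. ennreal (norm (psum z (particles xi (Suc n) w) - mC z * psum z (particles xi n w))) \<partial>M)
     \<le> ennreal (B ^ n * (3 * C + 1) * q ^ n)"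
proof -
  have C0: "C \<ge> 0" using C by (rule order_trans[rotated]) (simp add: Bochner_Integration.integral_nonneg)
  define f where "f P y = ennreal (norm (\<Sum>p\<in>P. exp (z * of_int (snd p)) * (lsum z (y (fst p)) - mC z)))"
    for P :: "(nat list \<times> int) set" and y :: "nat list \<Rightarrow> int list"
  have eq: "ennreal (norm (psum z (particles xi (Suc n) w) - mC z * psum z (particles xi n w)))
       = f (particles xi n w) (\<lambda>u\<in>gen n. xi u w)" for w
    by (subst gen_psum_Suc) (simp only: f_def psum_def sum_distrib_left sum_subtractf[symmetric] algebra_simps)
  define A where "A w = C * psumr (p * Re z) (particles xi n w) / (B ^ n) powr p" for w
  have A0: "A w \<ge> 0" for w unfolding A_def using C0 psumr_nonneg by simp
  have Aint: "integrable M A"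
    unfolding A_def using integrable_psumr[OF finp] by (intro integrable_divide integrable_mult_right) 
  have EA: "expectation A \<le> C * q ^ (2 * n)"
  proof -
    have "expectation A = C * (mR (p * Re z) ^ n / (B ^ n) powr p)"
      unfolding A_def by (simp add: integral_psumr[OF finp])
    also have "(B ^ n) powr p = (B powr p) ^ n"
      using B by (simp add: powr_powr powr_realpow[symmetric] mult.commute)
    also have "mR (p * Re z) ^ n / (B powr p) ^ n \<le> q ^ (2 * n)"
    proof -
      have "mR (p * Re z) ^ n \<le> (B powr p * q\<^sup>2) ^ n" by (intro power_mono mB mR_nonneg)
      also have "\<dots> = (B powr p) ^ n * q ^ (2 * n)" by (simp add: power_mult_distrib power_mult)
      finally show ?thesis using B by (simp add: field_simps)
    qed
    finally show ?thesis using C0 by (simp add: mult_left_mono)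
  qed
  have "(\<integral>\<^sup>+w. f (particles xi n w) (\<lambda>u\<in>gen n. xi u w) \<partial>M)
      = (\<integral>\<^sup>+w. (\<integral>\<^sup>+v. f (particles xi n w) (\<lambda>u\<in>gen n. xi u v) \<partial>M) \<partial>M)"
  proof (rule gen_nn_integral)
    fix P assume "P \<in> gens n"
    then have 1: "(\<lambda>y. \<Sum>p\<in>P. exp (z * of_int (snd p)) * (lsum z (y (fst p)) - mC z)) \<in> borel_measurable (PG n)"
      by (rule PG_sum_meas[where g = "\<lambda>p l. exp (z * of_int (snd p)) * (lsum z l - mC z)"])
    show "f P \<in> borel_measurable (PG n)" unfolding f_def[abs_def]
      by (rule measurable_compose[OF 1, where g = "\<lambda>x. ennreal (norm x)"]) simp
  qed
  also have "\<dots> \<le> (\<integral>\<^sup>+w. ennreal (B ^ n * ((A w / q ^ n + q ^ n) / 2 + 2 * A w)) \<partial>M)"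
  proof (rule nn_integral_mono)
    fix w
    have "(\<integral>\<^sup>+v. f (particles xi n w) (\<lambda>u\<in>gen n. xi u v) \<partial>M)
      = (\<integral>\<^sup>+v. ennreal (norm (\<Sum>p\<in>particles xi n w. exp (z * of_int (snd p)) * (lsum z (xi (fst p) v) - mC z))) \<partial>M)"
      unfolding f_def by (intro nn_integral_cong arg_cong[where f = ennreal] arg_cong[where f = norm] sum.cong refl)
        (auto dest: particles_length)
    also have "\<dots> \<le> ennreal (B ^ n * ((A w / q ^ n + q ^ n) / 2 + 2 * A w))"
      unfolding A_def
      by (rule increment_fixed_generation[OF particles_gens fin p intp C]) (use B q in auto)
    finally show "(\<integral>\<^sup>+v. f (particles xi n w) (\<lambda>u\<in>gen n. xi u v) \<partial>M)
       \<le> ennreal (B ^ n * ((A w / q ^ n + q ^ n) / 2 + 2 * A w))" .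
  qed
  also have "\<dots> = ennreal (\<integral>w. B ^ n * ((A w / q ^ n + q ^ n) / 2 + 2 * A w) \<partial>M)"
    using Aint A0 B q by (intro nn_integral_eq_integral) auto
  also have "(\<integral>w. B ^ n * ((A w / q ^ n + q ^ n) / 2 + 2 * A w) \<partial>M)
     = B ^ n * ((expectation A / q ^ n + q ^ n) / 2 + 2 * expectation A)"
    using Aint by (simp add: prob_space)
  \<comment> \<open>Both \<open>expectation A / q ^ n\<close> and \<open>expectation A\<close> are
    at most C q^n, so the bracket is at most (5 C / 2 + 1 / 2) q^n, which is rounded up.\<close>
  also have "\<dots> \<le> B ^ n * ((3 * C + 1) * q ^ n)"
  proof (rule mult_left_mono)
    have 1: "expectation A / q ^ n \<le> C * q ^ n"
      using EA q by (simp add: field_simps power_add[symmetric] mult_2_right)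
    have "q ^ (2 * n) \<le> q ^ n" using q by (intro power_decreasing) auto
    then have 2: "expectation A \<le> C * q ^ n" using EA C0 
      by (meson mult_left_mono order_trans)
    have "0 \<le> C * q ^ n" using C0 q by simp
    moreover have gen: "(x + y) / 2 + 2 * e \<le> 3 * k + y"
      if "x \<le> k" "e \<le> k" "0 \<le> k" "0 \<le> y" for x y e k :: real
      using that by (simp add: field_simps)
    ultimately show "(expectation A / q ^ n + q ^ n) / 2 + 2 * expectation A \<le> (3 * C + 1) * q ^ n"
      unfolding distrib_right mult.assoc mult_1_left
      using gen[OF 1 2] zero_le_power[OF less_imp_le[OF q(1)], of n] by simp
  qed (use B in simp)
  finally show ?thesis unfolding eq by (simp only: mult.assoc ennreal_leI)
qed

end

section \<open>Tools from complex analysis\<close>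

text \<open>Differentiation under the integral needs a majorant for the difference quotients, not
  just for \<open>f\<close>. Holomorphy supplies it: by Cauchy's inequality the derivative on a disc
  is at most \<open>g w / r\<close>, hence so are the difference quotients, and dominated
  convergence applies.\<close>

lemma holomorphic_on_lebesgue_integral:
  fixes f :: "complex \<Rightarrow> 'a \<Rightarrow> complex"
  assumes S: "open S"
    and hol: "\<And>w. w \<in> space M \<Longrightarrow> (\<lambda>z. f z w) holomorphic_on S"
    and meas: "\<And>z. z \<in> S \<Longrightarrow> f z \<in> borel_measurable M"
    and g: "integrable M g" and bound: "\<And>z w. z \<in> S \<Longrightarrow> w \<in> space M \<Longrightarrow> norm (f z w) \<le> g w"
  shows "(\<lambda>z. \<integral>w. f z w \<partial>M) holomorphic_on S"
proof -
  have "(\<lambda>z. \<integral>w. f z w \<partial>M) field_differentiable at z0" if z0: "z0 \<in> S" for z0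
  proof -
    \<comment> \<open>Twice the radius must fit into \<open>S\<close>, so that a disc of radius
      \<open>r\<close> fits around every point of \<open>cball z0 r\<close>.\<close>
    obtain r where r: "r > 0" "cball z0 (2 * r) \<subseteq> S"
    proof -
      from S z0 obtain e where "e > 0" "cball z0 e \<subseteq> S" using open_contains_cball by blast
      then show ?thesis using that[of "e / 2"] by simp
    qed
    have int: "integrable M (f z)" if "z \<in> S" for z
      by (rule Bochner_Integration.integrable_bound[OF g meas[OF that]])
         (use bound[OF that] in \<open>auto intro!: AE_I2 order_trans[OF _ abs_ge_self]\<close>)
    have der: "norm (deriv (\<lambda>z. f z w) z) \<le> g w / r" if w: "w \<in> space M" and z: "z \<in> cball z0 r" for w z
    proof -
      have sub: "cball z r \<subseteq> S"
      proof
        fix y assume "y \<in> cball z r"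
        then have "dist z0 y \<le> r + r" using z by (intro order_trans[OF dist_triangle[of z0 y z]] add_mono) auto
        then show "y \<in> S" using r by auto
      qed
      have "norm ((deriv ^^ 1) (\<lambda>z. f z w) z) \<le> fact 1 * g w / r ^ 1"
      proof (rule Cauchy_inequality)
        show "(\<lambda>z. f z w) holomorphic_on ball z r"
          using hol[OF w] sub by (meson ball_subset_cball holomorphic_on_subset order_trans)
        show "continuous_on (cball z r) (\<lambda>z. f z w)"
          using hol[OF w] sub by (meson holomorphic_on_imp_continuous_on holomorphic_on_subset)
        show "norm (f x w) \<le> g w" if "norm (z - x) = r" for x
          using that sub by (intro bound w) (auto simp: dist_norm)
      qed (use r in auto)
      then show ?thesis by simp
    qed
    have lip: "norm (f z w - f z0 w) \<le> g w / r * norm (z - z0)" if w: "w \<in> space M" and z: "z \<in> cball z0 r" for w z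
    proof (rule field_differentiable_bound[of "cball z0 r" "\<lambda>z. f z w" "deriv (\<lambda>z. f z w)"])
      fix y assume y: "y \<in> cball z0 r"
      then have "y \<in> S" using r by auto
      then show "((\<lambda>z. f z w) has_field_derivative deriv (\<lambda>z. f z w) y) (at y within cball z0 r)"
        using holomorphic_derivI[OF hol[OF w] S] by (simp add: has_field_derivative_at_within)
      show "norm (deriv (\<lambda>z. f z w) y) \<le> g w / r" by (rule der[OF w y])
    qed (use z r in auto)
    let ?q = "\<lambda>z w. (f z w - f z0 w) / (z - z0)"
    have "((\<lambda>z. \<integral>w. ?q z w \<partial>M) \<longlongrightarrow> (\<integral>w. deriv (\<lambda>z. f z w) z0 \<partial>M)) (at z0)"
    proof (subst tendsto_at_iff_sequentially, intro allI impI, unfold comp_def)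
      fix X assume X: "\<forall>i. X i \<in> UNIV - {z0}" "X \<longlonglongrightarrow> z0"
      obtain N where N: "\<And>n. n \<ge> N \<Longrightarrow> X n \<in> cball z0 r"
      proof -
        have "\<forall>\<^sub>F n in sequentially. X n \<in> ball z0 r"
          by (rule topological_tendstoD[OF X(2)]) (use r in auto)
        then obtain N where "\<forall>n\<ge>N. X n \<in> ball z0 r" by (auto simp: eventually_sequentially)
        then show ?thesis using that[of N] by (auto intro: less_imp_le)
      qed
      have XS: "X (n + N) \<in> S" for n using N[of "n + N"] r by auto
      have lim: "(\<lambda>n. ?q (X (n + N)) w) \<longlonglongrightarrow> deriv (\<lambda>z. f z w) z0" if w: "w \<in> space M" for w
      proof -
        have "((\<lambda>z. f z w) has_field_derivative deriv (\<lambda>z. f z w) z0) (at z0)"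
          using holomorphic_derivI[OF hol[OF w] S z0] .
        then have "((\<lambda>z. ?q z w) \<longlongrightarrow> deriv (\<lambda>z. f z w) z0) (at z0)"
          by (simp add: has_field_derivative_iff)
        then have "(\<lambda>n. ?q (X n) w) \<longlonglongrightarrow> deriv (\<lambda>z. f z w) z0"
          using X unfolding tendsto_at_iff_sequentially comp_def by blast
        then show ?thesis by (rule LIMSEQ_ignore_initial_segment)
      qed
      have qm: "(\<lambda>w. ?q (X (n + N)) w) \<in> borel_measurable M" for n
        using meas[OF XS[of n]] meas[OF z0] by measurable
      have dm: "(\<lambda>w. deriv (\<lambda>z. f z w) z0) \<in> borel_measurable M"
        by (rule borel_measurable_LIMSEQ_metric[OF qm lim])
      have "(\<lambda>n. \<integral>w. ?q (X (n + N)) w \<partial>M) \<longlonglongrightarrow> (\<integral>w. deriv (\<lambda>z. f z w) z0 \<partial>M)"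
      proof (rule integral_dominated_convergence[where w = "\<lambda>w. g w / r"])
        show "AE w in M. norm (?q (X (n + N)) w) \<le> g w / r" for n
        proof (rule AE_I2)
          fix w assume w: "w \<in> space M"
          have "X (n + N) \<noteq> z0" using X by auto
          then show "norm (?q (X (n + N)) w) \<le> g w / r"
            using lip[OF w N[of "n + N"]] by (simp add: norm_divide field_simps)
        qed
      qed (use dm qm lim g in auto)
      then show "(\<lambda>n. \<integral>w. ?q (X n) w \<partial>M) \<longlonglongrightarrow> (\<integral>w. deriv (\<lambda>z. f z w) z0 \<partial>M)"
        by (rule LIMSEQ_offset)
    qed
    moreover have "\<forall>\<^sub>F z in at z0. (\<integral>w. ?q z w \<partial>M) = ((\<integral>w. f z w \<partial>M) - (\<integral>w. f z0 w \<partial>M)) / (z - z0)"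
    proof -
      have "\<forall>\<^sub>F z in at z0. z \<in> S" using S z0 by (rule eventually_at_in_open')
      then show ?thesis by eventually_elim (use int z0 in simp)
    qed
    ultimately have "((\<lambda>z. ((\<integral>w. f z w \<partial>M) - (\<integral>w. f z0 w \<partial>M)) / (z - z0)) \<longlongrightarrow> (\<integral>w. deriv (\<lambda>z. f z w) z0 \<partial>M)) (at z0)"
      by (rule Lim_transform_eventually)
    then show ?thesis
      unfolding field_differentiable_def has_field_derivative_iff by blast
  qed
  then show ?thesis using S by (simp add: holomorphic_on_open field_differentiable_def)
qed

text \<open>Transfers derivatives between the real line and the plane: \<open>phi\<close> and the
  martingale limit are given on the reals, whereas Taylor expansion is done for their holomorphic
  extensions. A function that is real on the real axis has real derivatives there, so the imaginary
  part drops out.\<close>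

lemma deriv_of_real_part:
  fixes F :: "complex \<Rightarrow> complex" and f :: "real \<Rightarrow> real"
  assumes F: "F holomorphic_on ball (of_real \<beta>) r"
    and f: "\<And>x. \<bar>x - \<beta>\<bar> < r \<Longrightarrow> F (of_real x) = of_real (f x)"
    and x: "\<bar>x - \<beta>\<bar> < r"
  shows "(deriv ^^ j) F (of_real x) = of_real ((deriv ^^ j) f x)"
    and "((deriv ^^ j) f has_field_derivative (deriv ^^ Suc j) f x) (at x)"
proof -
  let ?B = "ball (complex_of_real \<beta>) r"
  have B: "of_real y \<in> ?B \<longleftrightarrow> \<bar>y - \<beta>\<bar> < r" for y :: real
    by (simp add: dist_of_real dist_real_def abs_minus_commute)
  have step: "deriv G (of_real x) = of_real (deriv h x) \<and> (h has_field_derivative deriv h x) (at x)"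
    if G: "G holomorphic_on ?B" and h: "\<And>x. \<bar>x - \<beta>\<bar> < r \<Longrightarrow> G (of_real x) = of_real (h x)"
      and x: "\<bar>x - \<beta>\<bar> < r" for G h x
  proof -
    have xB: "of_real x \<in> ?B" using x B by simp
    have "(G has_field_derivative deriv G (of_real x)) (at (of_real x))"
      by (rule holomorphic_derivI[OF G open_ball xB])
    then have v: "((\<lambda>t. G (of_real t)) has_vector_derivative deriv G (of_real x)) (at x)"
      by (rule has_vector_derivative_real_field)
    have o: "open {x - (r - \<bar>x - \<beta>\<bar>)<..<x + (r - \<bar>x - \<beta>\<bar>)}" by simp
    have v': "((\<lambda>t. complex_of_real (h t)) has_vector_derivative deriv G (of_real x)) (at x)"
      by (rule has_vector_derivative_transform_within_open[OF v o]) (use x h in auto)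
    have "((\<lambda>t. Re (complex_of_real (h t))) has_vector_derivative Re (deriv G (of_real x))) (at x)"
      using v' by (rule bounded_linear.has_vector_derivative[OF bounded_linear_Re])
    then have d: "(h has_field_derivative Re (deriv G (of_real x))) (at x)"
      by (simp add: has_real_derivative_iff_has_vector_derivative)
    have "((\<lambda>t. Im (complex_of_real (h t))) has_vector_derivative Im (deriv G (of_real x))) (at x)"
      using v' by (rule bounded_linear.has_vector_derivative[OF bounded_linear_Im])
    then have "((\<lambda>t. 0 :: real) has_field_derivative Im (deriv G (of_real x))) (at x)"
      by (simp add: has_real_derivative_iff_has_vector_derivative)
    then have "Im (deriv G (of_real x)) = 0" using DERIV_unique[OF _ DERIV_const] by blast
    then show ?thesis using d DERIV_imp_deriv[OF d] by (simp add: complex_eq_iff)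
  qed
  have all: "\<forall>x. \<bar>x - \<beta>\<bar> < r \<longrightarrow> (deriv ^^ j) F (of_real x) = of_real ((deriv ^^ j) f x)" for j
  proof (induction j)
    case 0 then show ?case using f by simp
  next
    case (Suc j)
    have "(deriv ^^ j) F holomorphic_on ?B" by (rule holomorphic_higher_deriv[OF F open_ball])
    then show ?case using step[of "(deriv ^^ j) F" "(deriv ^^ j) f"] Suc by simp
  qed
  then show "(deriv ^^ j) F (of_real x) = of_real ((deriv ^^ j) f x)" using x by blast
  have "(deriv ^^ j) F holomorphic_on ?B" by (rule holomorphic_higher_deriv[OF F open_ball])
  then show "((deriv ^^ j) f has_field_derivative (deriv ^^ Suc j) f x) (at x)"
    using step[of "(deriv ^^ j) F" "(deriv ^^ j) f" x] all x by simp
qed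

text \<open>Applied with order 3 to the logarithm of m and with order 2 to W. The next derivative is
  bounded because the closed disc lies strictly inside the domain.\<close>

lemma holomorphic_taylor_bound:
  assumes F: "F holomorphic_on ball z0 r" and r: "0 < d" "d < r"
  obtains K where "K \<ge> 0" 
    "\<And>z. norm (z - z0) \<le> d \<Longrightarrow> norm (F z - (\<Sum>i\<le>n. (deriv ^^ i) F z0 * (z - z0) ^ i / fact i)) \<le> K * norm (z - z0) ^ Suc n"
proof -
  have sub: "cball z0 d \<subseteq> ball z0 r" using r by auto
  have "continuous_on (cball z0 d) ((deriv ^^ Suc n) F)"
    using holomorphic_higher_deriv[OF F open_ball] sub
    by (meson holomorphic_on_imp_continuous_on holomorphic_on_subset)
  then have "bounded ((deriv ^^ Suc n) F ` cball z0 d)"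
    by (intro compact_imp_bounded compact_continuous_image) auto
  then obtain B where B: "\<And>z. z \<in> cball z0 d \<Longrightarrow> norm ((deriv ^^ Suc n) F z) \<le> B" "B > 0"
    unfolding bounded_pos by blast
  have "norm (F z - (\<Sum>i\<le>n. (deriv ^^ i) F z0 * (z - z0) ^ i / fact i)) \<le> (B / fact n) * norm (z - z0) ^ Suc n"
    if z: "norm (z - z0) \<le> d" for z
  proof -
    have "norm ((deriv ^^ 0) F z - (\<Sum>i\<le>n. (deriv ^^ i) F z0 * (z - z0) ^ i / fact i)) \<le> B * norm (z - z0) ^ Suc n / fact n"
    proof (rule complex_Taylor[of "cball z0 d"])
      fix i x assume "x \<in> cball z0 d"
      then have x: "x \<in> ball z0 r" using sub by auto
      show "((deriv ^^ i) F has_field_derivative (deriv ^^ Suc i) F x) (at x within cball z0 d)"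
        using holomorphic_derivI[OF holomorphic_higher_deriv[OF F open_ball] open_ball x, of i]
        by (simp add: has_field_derivative_at_within)
    qed (use B z r in \<open>auto simp: dist_norm norm_minus_commute\<close>)
    then show ?thesis by simp
  qed
  moreover have "B / fact n \<ge> 0" using B by simp
  ultimately show ?thesis using that by blast
qed

text \<open>The expectations, weighted with the slightly larger rate, are summable.\<close>
lemma AE_geometric_bound:
  assumes X: "\<And>n. X n \<in> borel_measurable M"
    and bound: "\<And>n. (\<integral>\<^sup>+w. X n w \<partial>M) \<le> ennreal (K * q ^ n)"
    and q: "0 \<le> q" "q < r" "K \<ge> 0"
  shows "AE w in M. \<exists>C\<ge>0. \<forall>n. X n w \<le> ennreal (C * r ^ n)"
proof -
  have r: "r > 0" using q by simp
  let ?S = "\<lambda>w. \<Sum>n. X n w * ennreal ((1 / r) ^ n)"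
  have "(\<integral>\<^sup>+w. ?S w \<partial>M) = (\<Sum>n. (\<integral>\<^sup>+w. X n w * ennreal ((1 / r) ^ n) \<partial>M))"
    using X by (intro nn_integral_suminf) auto
  also have "\<dots> \<le> (\<Sum>n. ennreal (K * (q / r) ^ n))"
  proof (intro suminf_le summableI)
    fix n
    have "(\<integral>\<^sup>+w. X n w * ennreal ((1 / r) ^ n) \<partial>M) = (\<integral>\<^sup>+w. X n w \<partial>M) * ennreal ((1 / r) ^ n)"
      using X by (intro nn_integral_multc) auto
    also have "\<dots> \<le> ennreal (K * q ^ n) * ennreal ((1 / r) ^ n)" by (intro mult_right_mono bound) auto
    also have "\<dots> = ennreal (K * (q / r) ^ n)"
      using q r by (subst ennreal_mult[symmetric]) (auto simp: power_divide)
    finally show "(\<integral>\<^sup>+w. X n w * ennreal ((1 / r) ^ n) \<partial>M) \<le> ennreal (K * (q / r) ^ n)" .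
  qed
  also have "\<dots> = ennreal (\<Sum>n. K * (q / r) ^ n)"
    using q r by (intro suminf_ennreal2 summable_mult summable_geometric) auto
  also have "\<dots> < \<infinity>" by simp
  finally have "(\<integral>\<^sup>+w. ?S w \<partial>M) \<noteq> \<infinity>" by simp
  then have "AE w in M. ?S w \<noteq> \<infinity>"
    using X by (intro nn_integral_noteq_infinite borel_measurable_suminf_order) auto
  then show ?thesis
  proof eventually_elim
    case (elim w)
    then obtain C where C: "?S w = ennreal C" "C \<ge> 0" by (cases "?S w") auto
    have "X n w \<le> ennreal (C * r ^ n)" for n
    proof -
      have "X n w * ennreal ((1 / r) ^ n) = (\<Sum>i\<in>{n}. X i w * ennreal ((1 / r) ^ i))" by simp
      also have "\<dots> \<le> ?S w" by (rule sum_le_suminf) auto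
      finally have "X n w * ennreal ((1 / r) ^ n) * ennreal (r ^ n) \<le> ennreal C * ennreal (r ^ n)"
        unfolding C by (rule mult_right_mono) simp
      also have "X n w * ennreal ((1 / r) ^ n) * ennreal (r ^ n) = X n w"
        using r by (simp add: mult.assoc ennreal_mult[symmetric] power_mult_distrib[symmetric])
      also have "ennreal C * ennreal (r ^ n) = ennreal (C * r ^ n)"
        using C r by (simp add: ennreal_mult)
      finally show ?thesis .
    qed
    then show ?case using C by blast
  qed
qed

text \<open>The hypothesis bounds a mean over the circle, not a supremum, because means are what
  expectations control. In Cauchy's formula the kernel is at most 2 / r and the circle has length 2
  \<pi> r; after division by 2 \<pi> this leaves the factor 2.\<close>

lemma holomorphic_bound_circle:
  assumes f: "f holomorphic_on S" "open S" "cball z0 r \<subseteq> S" and r: "r > 0"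
    and z: "norm (z - z0) \<le> r / 2" and C: "C \<ge> 0"
    and bound: "(\<integral>\<^sup>+t. ennreal (norm (f (circlepath z0 r t)) * indicator {0..1} t) \<partial>lborel) \<le> ennreal C"
  shows "norm (f z) \<le> 2 * C"
proof -
  have fc: "f holomorphic_on cball z0 r" using f holomorphic_on_subset by blast
  have zr: "norm (z - z0) < r" using z r by simp
  let ?\<gamma> = "circlepath z0 r"
  let ?h = "\<lambda>t. f (?\<gamma> t) / (?\<gamma> t - z) * vector_derivative ?\<gamma> (at t)"
  let ?n = "\<lambda>t. norm (f (?\<gamma> t))"
  have "((\<lambda>u. f u / (u - z)) has_contour_integral (2 * of_real pi * \<i> * f z)) ?\<gamma>"
    by (rule Cauchy_integral_circlepath_simple[OF fc zr])
  then have hi: "(?h has_integral (2 * of_real pi * \<i> * f z)) {0..1}"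
    by (simp only: has_contour_integral)
  have \<gamma>in: "norm (?\<gamma> t - z0) = r" for t
    using r by (simp add: circlepath norm_mult)
  have \<gamma>c: "continuous_on {0..1} ?\<gamma>"
    unfolding circlepath by (intro continuous_intros)
  have nc: "continuous_on {0..1} ?n"
    by (intro continuous_on_norm continuous_on_compose2[OF holomorphic_on_imp_continuous_on[OF f(1)] \<gamma>c])
       (use \<gamma>in f(3) in \<open>auto simp: dist_norm norm_minus_commute\<close>)
  have ni: "set_integrable lborel {0..1} ?n" by (rule borel_integrable_atLeastAtMost'[OF nc])
  have nhi: "?n integrable_on {0..1}" "integral {0..1} ?n = (LINT t:{0..1}|lborel. ?n t)"
    using set_borel_integral_eq_integral[OF ni] by auto
  have I: "(LINT t:{0..1}|lborel. ?n t) \<le> C"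
  proof -
    have "ennreal (LINT t:{0..1}|lborel. ?n t) = (\<integral>\<^sup>+t. ennreal (indicator {0..1} t *\<^sub>R ?n t) \<partial>lborel)"
      unfolding set_lebesgue_integral_def using ni unfolding set_integrable_def
      by (intro nn_integral_eq_integral[symmetric]) auto
    also have "\<dots> \<le> ennreal C" using bound by (simp add: mult.commute)
    finally show ?thesis using C by simp
  qed
  have "norm (2 * of_real pi * \<i> * f z) = norm (integral {0..1} ?h)"
    using hi by (simp add: integral_unique)
  also have "\<dots> \<le> integral {0..1} (\<lambda>t. 4 * pi * ?n t)"
  proof (rule integral_norm_bound_integral)
    show "?h integrable_on {0..1}" using hi by blast
    show "(\<lambda>t. 4 * pi * ?n t) integrable_on {0..1}" by (intro integrable_on_mult_right nhi)
    fix t :: real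
    have 1: "norm (vector_derivative ?\<gamma> (at t)) = 2 * pi * r"
      using r by (simp add: vector_derivative_circlepath norm_mult)
    have "r = norm ((?\<gamma> t - z) + (z - z0))" using \<gamma>in[of t] by simp
    also have "\<dots> \<le> norm (?\<gamma> t - z) + norm (z - z0)" by (rule norm_triangle_ineq)
    finally have 2: "r / 2 \<le> norm (?\<gamma> t - z)" using z by simp
    have "norm (?h t) = ?n t / norm (?\<gamma> t - z) * (2 * pi * r)" by (simp add: norm_mult norm_divide 1)
    also have "\<dots> \<le> ?n t / (r / 2) * (2 * pi * r)"
      using 2 r by (intro mult_right_mono divide_left_mono mult_pos_pos) auto
    also have "\<dots> = 4 * pi * ?n t" using r by simp
    finally show "norm (?h t) \<le> 4 * pi * ?n t" .
  qed
  also have "\<dots> = 4 * pi * (LINT t:{0..1}|lborel. ?n t)" using nhi(2) by simp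
  also have "\<dots> \<le> 4 * pi * C" using I by simp
  finally show ?thesis by (simp add: norm_mult)
qed

section \<open>Gaussian integrals and Laplace's method\<close>

lemma integrable_power_gauss:
  fixes c :: real
  assumes "c > 0"
  shows "integrable lborel (\<lambda>t. \<bar>t\<bar> ^ j * exp (- c * t\<^sup>2))"
proof -
  define s where "s = 1 / sqrt (2 * c)"
  have s: "s > 0" "s\<^sup>2 = 1 / (2 * c)" using assms by (auto simp: s_def power_divide)
  have "integrable lborel (\<lambda>x. normal_density 0 s x * \<bar>x - 0\<bar> ^ j)"
    by (rule integrable_normal_moment_abs) (rule s)
  then have "integrable lborel (\<lambda>x. sqrt (2 * pi * s\<^sup>2) * (normal_density 0 s x * \<bar>x - 0\<bar> ^ j))"
    by (rule integrable_mult_right)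
  moreover have "sqrt (2 * pi * s\<^sup>2) * (normal_density 0 s x * \<bar>x - 0\<bar> ^ j) = \<bar>x\<bar> ^ j * exp (- c * x\<^sup>2)" for x
    using s assms by (simp add: normal_density_def)
  ultimately show ?thesis by (simp only:)
qed

lemma integrable_cpower_gauss:
  fixes c :: real
  assumes "c > 0"
  shows "integrable lborel (\<lambda>t. complex_of_real (t ^ j * exp (- c * t\<^sup>2)) * exp (- \<i> * of_real (t * s)))"
  by (rule Bochner_Integration.integrable_bound[OF integrable_power_gauss[OF assms, of j]])
     (auto simp: norm_mult norm_power power_abs intro!: borel_measurable_continuous_onI continuous_intros)

text \<open>Up to constant factors the \<open>j\<close>-th derivative in \<open>s\<close> of the
  characteristic function of a centred normal law with variance 1 / \<sigma>^2. It is left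
  unnormalised since this is the form in which the rescaled Fourier integral produces it.\<close>

definition gaussint :: "real \<Rightarrow> nat \<Rightarrow> real \<Rightarrow> complex" where
  "gaussint \<sigma> j s = (LINT t|lborel. complex_of_real (t ^ j * exp (- (\<sigma>\<^sup>2 / 2) * t\<^sup>2)) * exp (- \<i> * of_real (t * s)))"

lemma gaussint_0:
  assumes "\<sigma> > 0"
  shows "gaussint \<sigma> 0 s = of_real (sqrt (2 * pi) / \<sigma> * exp (- s\<^sup>2 / (2 * \<sigma>\<^sup>2)))"
proof -
  have "char std_normal_distribution (- s / \<sigma>) = of_real (exp (- s\<^sup>2 / (2 * \<sigma>\<^sup>2)))"
    using assms by (simp add: char_std_normal_distribution power_divide)
  moreover have "char std_normal_distribution (- s / \<sigma>) = 
    (LINT x|lborel. std_normal_density x *\<^sub>R iexp (- s / \<sigma> * x))"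
    unfolding char_def by (subst integral_density) auto
  moreover have "(LINT x|lborel. std_normal_density x *\<^sub>R iexp (- s / \<sigma> * x))
     = \<bar>\<sigma>\<bar> *\<^sub>R (LINT t|lborel. std_normal_density (0 + \<sigma> * t) *\<^sub>R iexp (- s / \<sigma> * (0 + \<sigma> * t)))"
    using assms by (intro lborel_integral_real_affine) auto
  moreover have "std_normal_density (0 + \<sigma> * t) *\<^sub>R iexp (- s / \<sigma> * (0 + \<sigma> * t))
     = of_real (1 / sqrt (2 * pi)) * (complex_of_real (t ^ 0 * exp (- (\<sigma>\<^sup>2 / 2) * t\<^sup>2)) * exp (- \<i> * of_real (t * s)))" for t
    using assms by (simp add: std_normal_density_def scaleR_conv_of_real power_mult_distrib mult_ac exp_of_real[symmetric])
  ultimately have "of_real (exp (- s\<^sup>2 / (2 * \<sigma>\<^sup>2))) = of_real (\<sigma> / sqrt (2 * pi)) * gaussint \<sigma> 0 s"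
    unfolding gaussint_def using assms by (simp add: scaleR_conv_of_real mult_ac)
  then show ?thesis using assms by (simp add: field_simps)
qed

text \<open>Integration by parts: exp (-\<sigma>^2 t^2 / 2 - i t s) tends to 0 at both ends, so its
  derivative, a combination of the integrands for j = 1 and j = 0, integrates to 0.\<close>

lemma gaussint_1:
  assumes "\<sigma> > 0"
  shows "gaussint \<sigma> 1 s = - \<i> * of_real (s / \<sigma>\<^sup>2) * gaussint \<sigma> 0 s"
proof -
  define c where "c = \<sigma>\<^sup>2 / 2"
  have c: "c > 0" using assms by (simp add: c_def)
  define G where "G z = exp (- of_real c * z\<^sup>2 - \<i> * z * of_real s)" for z :: complex
  define F where "F t = G (of_real t)" for t :: real
  let ?g = "\<lambda>j t. complex_of_real (t ^ j * exp (- c * t\<^sup>2)) * exp (- \<i> * of_real (t * s))"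
  have Fg: "F t = ?g 0 t" for t
    by (simp add: F_def G_def exp_of_real[symmetric] exp_add[symmetric] mult.assoc)
  define f where "f t = - of_real (\<sigma>\<^sup>2) * ?g 1 t - \<i> * of_real s * ?g 0 t" for t :: real
  have fF: "f t = (- of_real c * (2 * of_real t) - \<i> * of_real s) * F t" for t
    unfolding f_def Fg c_def by (simp add: algebra_simps)
  have "(G has_field_derivative (- of_real c * (2 * z) - \<i> * of_real s) * G z) (at z)" for z
    unfolding G_def by (auto intro!: derivative_eq_intros simp: algebra_simps)
  then have F': "(F has_vector_derivative f t) (at t)" for t
    unfolding fF F_def by (intro has_vector_derivative_real_field) simp
  have lim: "(F \<longlongrightarrow> 0) F'" if "filterlim (\<lambda>t :: real. t\<^sup>2) at_top F'" for F'
  proof (rule tendsto_norm_zero_cancel)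
    have "((\<lambda>t. exp (- (c * t\<^sup>2))) \<longlongrightarrow> 0) F'"
      using filterlim_tendsto_pos_mult_at_top[OF tendsto_const c that]
      by (intro filterlim_compose[OF exp_at_bot]) (simp add: filterlim_uminus_at_top)
    then show "((\<lambda>t. norm (F t)) \<longlongrightarrow> 0) F'" by (simp add: Fg norm_mult)
  qed
  have int: "integrable lborel f"
    unfolding f_def using integrable_cpower_gauss[OF c, of 1 s] integrable_cpower_gauss[OF c, of 0 s]
    by (intro Bochner_Integration.integrable_diff integrable_mult_right) auto
  have "(LBINT t=-\<infinity>..\<infinity>. f t) = 0 - 0"
  proof (rule interval_integral_FTC_integrable)
    show "(F has_vector_derivative f x) (at x)" for x by (rule F')
    have "isCont (\<lambda>t. (- of_real c * (2 * of_real t) - \<i> * of_real s) * F t) x" for x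
      unfolding F_def G_def by (intro continuous_intros)
    then show "isCont f x" for x unfolding fF .
    show "set_integrable lborel (einterval (-\<infinity>) \<infinity>) f" 
      using int by (simp add: set_integrable_def)
    have "filterlim (\<lambda>t :: real. t\<^sup>2) at_top at_top" "filterlim (\<lambda>t :: real. t\<^sup>2) at_top at_bot"
      by real_asymp+
    then show "((F \<circ> real_of_ereal) \<longlongrightarrow> 0) (at_right (- \<infinity>))" "((F \<circ> real_of_ereal) \<longlongrightarrow> 0) (at_left \<infinity>)"
      unfolding ereal_tendsto_simps by (auto intro: lim)
  qed simp
  then have "(LINT t|lborel. f t) = 0" by (simp add: interval_integral_to_infinity_eq interval_lebesgue_integral_def einterval_def set_lebesgue_integral_def)
  moreover have "(LINT t|lborel. f t) = - of_real (\<sigma>\<^sup>2) * gaussint \<sigma> 1 s - \<i> * of_real s * gaussint \<sigma> 0 s"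
    unfolding f_def gaussint_def c_def[symmetric]
    using integrable_cpower_gauss[OF c, of 1 s] integrable_cpower_gauss[OF c, of 0 s]
    by (subst Bochner_Integration.integral_diff) auto
  ultimately have "- of_real (\<sigma>\<^sup>2) * gaussint \<sigma> 1 s - \<i> * of_real s * gaussint \<sigma> 0 s = 0" by simp
  then have "of_real (\<sigma>\<^sup>2) * gaussint \<sigma> 1 s = - \<i> * of_real s * gaussint \<sigma> 0 s" by algebra
  moreover have "complex_of_real (\<sigma>\<^sup>2) \<noteq> 0" using assms by simp
  ultimately show ?thesis by (simp only: of_real_divide) (simp add: field_simps)
qed

lemma gaussint_moments:
  assumes "\<sigma> > 0"
  shows "gaussint \<sigma> 2 0 = of_real (sqrt (2 * pi) / \<sigma> ^ 3)" "gaussint \<sigma> 4 0 = of_real (3 * sqrt (2 * pi) / \<sigma> ^ 5)"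
proof -
  have "gaussint \<sigma> (2 * k) 0 = of_real (sqrt (2 * pi) / \<sigma> * (fact (2 * k) / ((2 * \<sigma>\<^sup>2) ^ k * fact k)))" for k
  proof -
    let ?s = "1 / \<sigma>"
    have "gaussint \<sigma> (2 * k) 0 = of_real (LINT t|lborel. t ^ (2 * k) * exp (- (\<sigma>\<^sup>2 / 2) * t\<^sup>2))"
      unfolding gaussint_def integral_complex_of_real[symmetric] by simp
    also have "(LINT t|lborel. t ^ (2 * k) * exp (- (\<sigma>\<^sup>2 / 2) * t\<^sup>2))
       = (LINT t|lborel. sqrt (2 * pi) / \<sigma> * (normal_density 0 ?s t * (t - 0) ^ (2 * k)))"
      using assms by (intro Bochner_Integration.integral_cong refl)
        (simp add: normal_density_def real_sqrt_mult power_divide real_sqrt_divide)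
    also have "\<dots> = sqrt (2 * pi) / \<sigma> * (fact (2 * k) / ((2 / ?s\<^sup>2) ^ k * fact k))"
      by (subst integral_mult_right_zero, subst integral_normal_moment_even) (use assms in auto)
    finally show ?thesis by (simp add: power_divide)
  qed
  from this[of 1] this[of 2] show "gaussint \<sigma> 2 0 = of_real (sqrt (2 * pi) / \<sigma> ^ 3)" "gaussint \<sigma> 4 0 = of_real (3 * sqrt (2 * pi) / \<sigma> ^ 5)"
    using assms by (simp_all add: fact_numeral power2_eq_square power3_eq_cube eval_nat_numeral)
qed

lemma norm_gaussint_le:
  assumes "\<sigma> > 0"
  shows "norm (gaussint \<sigma> j s) \<le> (LINT t|lborel. \<bar>t\<bar> ^ j * exp (- (\<sigma>\<^sup>2 / 2) * t\<^sup>2))"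
proof -
  have "norm (gaussint \<sigma> j s) \<le> (LINT t|lborel. norm (complex_of_real (t ^ j * exp (- (\<sigma>\<^sup>2 / 2) * t\<^sup>2)) * exp (- \<i> * of_real (t * s))))"
    unfolding gaussint_def by (rule integral_norm_bound)
  also have "\<dots> = (LINT t|lborel. \<bar>t\<bar> ^ j * exp (- (\<sigma>\<^sup>2 / 2) * t\<^sup>2))"
    by (simp add: norm_mult norm_power power_abs)
  finally show ?thesis .
qed

lemma tendsto_gaussint:
  assumes "\<sigma> > 0" "s \<longlonglongrightarrow> s0"
  shows "(\<lambda>n. gaussint \<sigma> j (s n)) \<longlonglongrightarrow> gaussint \<sigma> j s0"
  unfolding gaussint_def
proof (rule integral_dominated_convergence)
  show "integrable lborel (\<lambda>t. \<bar>t\<bar> ^ j * exp (- (\<sigma>\<^sup>2 / 2) * t\<^sup>2))"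
    using assms by (intro integrable_power_gauss) simp
  show "AE t in lborel. (\<lambda>n. complex_of_real (t ^ j * exp (- (\<sigma>\<^sup>2 / 2) * t\<^sup>2)) * exp (- \<i> * of_real (t * s n)))
     \<longlonglongrightarrow> complex_of_real (t ^ j * exp (- (\<sigma>\<^sup>2 / 2) * t\<^sup>2)) * exp (- \<i> * of_real (t * s0))"
    by (intro AE_I2 tendsto_intros assms)
qed (auto simp: norm_mult norm_power power_abs intro!: borel_measurable_continuous_onI continuous_intros)


section \<open>Laplace's method to second order\<close>

text \<open>A mean value bound along the segment, which stays in the half plane Re \<le> r. It
  compares the integrand with its Gaussian limit at a decay rate common to both.\<close>

lemma norm_exp_diff_le:
  fixes x y :: complex
  assumes "Re x \<le> r" "Re y \<le> r"
  shows "norm (exp x - exp y) \<le> norm (x - y) * exp r"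
proof -
  have "norm (exp x - exp y) \<le> exp r * norm (x - y)"
  proof (rule field_differentiable_bound[of "closed_segment x y" exp exp])
    fix z assume z: "z \<in> closed_segment x y"
    show "(exp has_field_derivative exp z) (at z within closed_segment x y)"
      by (rule has_field_derivative_at_within) (rule DERIV_exp)
    from z obtain u where u: "0 \<le> u" "u \<le> 1" "z = (1 - u) *\<^sub>R x + u *\<^sub>R y"
      by (auto simp: closed_segment_def)
    have "Re z = (1 - u) * Re x + u * Re y" using u by simp
    also have "\<dots> \<le> (1 - u) * r + u * r" using u assms by (intro add_mono mult_left_mono) auto
    finally show "norm (exp z) \<le> exp r" by (simp add: norm_exp_eq_Re algebra_simps)
  qed auto
  then show ?thesis by (simp add: mult.commute)
qed

text \<open>The factorisation holds at 0 as well, so the limit of sqrt n (exp x_n - 1) can be read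
  off from that of sqrt n x_n even if some x_n vanish.\<close>

lemma exp_minus_one_quotient:
  "\<exists>q :: complex \<Rightarrow> complex. (\<forall>x. exp x - 1 = x * q x) \<and> q \<midarrow>0\<rightarrow> 1"
proof -
  define q :: "complex \<Rightarrow> complex" where "q x = (if x = 0 then 1 else (exp x - 1) / x)" for x
  have "((\<lambda>y. (exp y - exp 0) / (y - 0)) \<longlongrightarrow> exp 0) (at (0::complex))"
    using DERIV_exp[of "0::complex"] unfolding has_field_derivative_iff by simp
  then have "((\<lambda>y. (exp y - 1) / y) \<longlongrightarrow> 1) (at (0::complex))" by simp
  then have "q \<midarrow>0\<rightarrow> 1"
    by (rule Lim_transform_eventually) (auto simp: q_def eventually_at_filter)
  moreover have "exp x - 1 = x * q x" for x by (simp add: q_def)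
  ultimately show ?thesis by blast
qed

text \<open>After \<eta> = t / sqrt n and apart from a phase, n V f^n is g(t) n (i a t / sqrt n - b
  t^2 / (2 n)) (1 - i \<kappa> t^3 / (6 sqrt n)) up to o(1). The term of order sqrt n and the terms
  of order 1 are those subtracted in the statement. The phase e^(-its) has modulus 1 and is kept out
  of the dominated convergence argument, which makes the error uniform in \<open>k\<close>.\<close>

lemma laplace_expansion:
  fixes f V e :: "real \<Rightarrow> complex" and k :: "nat \<Rightarrow> int" and a b :: complex
  assumes pos: "\<delta> > 0" "\<sigma> > 0" "c > 0" "K \<ge> 0"
    and cont: "continuous_on {-\<delta>..\<delta>} f" "continuous_on {-\<delta>..\<delta>} V"
    and f: "\<And>\<eta>. \<bar>\<eta>\<bar> \<le> \<delta> \<Longrightarrow> 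
      f \<eta> = exp (\<i> * of_real (\<mu> * \<eta>) - of_real (\<sigma>\<^sup>2 * \<eta>\<^sup>2 / 2) - \<i> * of_real (\<kappa> * \<eta> ^ 3 / 6) + e \<eta>)"
    and e: "\<And>\<eta>. \<bar>\<eta>\<bar> \<le> \<delta> \<Longrightarrow> norm (e \<eta>) \<le> K * \<bar>\<eta>\<bar> ^ 4"
    and fb: "\<And>\<eta>. \<bar>\<eta>\<bar> \<le> \<delta> \<Longrightarrow> norm (f \<eta>) \<le> exp (- c * \<eta>\<^sup>2)"
    and V: "\<And>\<eta>. \<bar>\<eta>\<bar> \<le> \<delta> \<Longrightarrow> norm (V \<eta> - \<i> * of_real \<eta> * a + of_real (\<eta>\<^sup>2 / 2) * b) \<le> K * \<bar>\<eta>\<bar> ^ 3"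
  defines "s \<equiv> \<lambda>n. (real_of_int (k n) - \<mu> * real n) / sqrt (real n)"
  shows "(\<lambda>n. of_real (real n powr (3/2)) * 
       (LINT \<eta>|lborel. indicator {-\<delta>..\<delta>} \<eta> *\<^sub>R (f \<eta> ^ n * V \<eta> * exp (- \<i> * of_real (\<eta> * real_of_int (k n)))))
     - of_real (sqrt (real n)) * (\<i> * a * gaussint \<sigma> 1 (s n))
     - (of_real (\<kappa> / 6) * a * gaussint \<sigma> 4 (s n) - b / 2 * gaussint \<sigma> 2 (s n))) \<longlonglongrightarrow> 0"
proof -
  \<comment> \<open>A decay rate common to |f|^n and to the limiting Gaussian.\<close>
  define c' where "c' = min c (\<sigma>\<^sup>2 / 2)"
  have c': "c' > 0" "c' \<le> c" "c' \<le> \<sigma>\<^sup>2 / 2" using pos by (auto simp: c'_def)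
  define g where "g t = exp (- (\<sigma>\<^sup>2 / 2) * t\<^sup>2)" for t :: real
  \<comment> \<open>The terms of order 1: the product of i a t with -i \<kappa> t^3 / 6, and the
    quadratic term of \<open>V\<close>.\<close>
  define h where "h t = of_real (\<kappa> / 6 * t ^ 4) * a - of_real (t\<^sup>2 / 2) * b" for t :: real
  define F where "F n t = f (t / sqrt (real n)) ^ n * exp (- \<i> * of_real (t * \<mu> * sqrt (real n)))" for n t
  define I where "I n t = (if \<bar>t / sqrt (real n)\<bar> \<le> \<delta> then 1 else 0 :: complex)" for n and t :: real
  \<comment> \<open>\<open>I\<close> cuts off at |t| \<le> \<delta> sqrt n, but the subtracted
    Gaussian terms extend over the whole line; the difference therefore has to be controlled outside
    the interval too.\<close>
  define D where "D n t = I n t * (of_nat n * F n t * V (t / sqrt (real n)))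
     - of_real (sqrt (real n)) * \<i> * of_real t * a * of_real (g t) - h t * of_real (g t)" for n t
  define x where "x n t = of_nat n * (- \<i> * of_real (\<kappa> * (t / sqrt (real n)) ^ 3 / 6) + e (t / sqrt (real n)))" for n t
  \<comment> \<open>Covers the majorants inside and outside the interval; the summand
    \<open>norm a / \<delta>\<close> belongs to the outside.\<close>
  define dom where "dom t = ((K * \<delta> + norm b / 2 + norm a / \<delta> + norm b / 2) * \<bar>t\<bar> ^ 2
      + (norm a * (\<bar>\<kappa>\<bar> / 6 + K * \<delta>) + \<bar>\<kappa>\<bar> / 6 * norm a) * \<bar>t\<bar> ^ 4) * exp (- c' * t\<^sup>2)" for t :: real
  have g0: "g t > 0" for t by (simp add: g_def)
  have gc': "g t \<le> exp (- c' * t\<^sup>2)" for t 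
    using mult_right_mono[OF c'(3), of "t\<^sup>2"] by (simp add: g_def)
  have dom_int: "integrable lborel dom"
    unfolding dom_def distrib_right mult.assoc 
    using integrable_power_gauss[OF c'(1), of 2] integrable_power_gauss[OF c'(1), of 4]
    by (intro Bochner_Integration.integrable_add integrable_mult_right) (auto simp: mult.assoc)
  have sqn: "sqrt (real n) > 0" "sqrt (real n) * sqrt (real n) = real n" "(sqrt (real n))\<^sup>2 = real n" if "n \<ge> 1" for n
    using that by auto
  have FX: "F n t = of_real (g t) * exp (x n t)" if n: "n \<ge> 1" and t: "\<bar>t / sqrt (real n)\<bar> \<le> \<delta>" for n t
  proof -
    have "F n t = exp (of_nat n * (\<i> * of_real (\<mu> * (t / sqrt (real n))) - of_real (\<sigma>\<^sup>2 * (t / sqrt (real n))\<^sup>2 / 2) 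
       - \<i> * of_real (\<kappa> * (t / sqrt (real n)) ^ 3 / 6) + e (t / sqrt (real n))) - \<i> * of_real (t * \<mu> * sqrt (real n)))"
      unfolding F_def f[OF t] exp_of_nat_mult[symmetric] exp_add[symmetric] by simp
    also have "of_nat n * (\<i> * of_real (\<mu> * (t / sqrt (real n))) - of_real (\<sigma>\<^sup>2 * (t / sqrt (real n))\<^sup>2 / 2) 
       - \<i> * of_real (\<kappa> * (t / sqrt (real n)) ^ 3 / 6) + e (t / sqrt (real n))) - \<i> * of_real (t * \<mu> * sqrt (real n))
      = of_real (- (\<sigma>\<^sup>2 / 2) * t\<^sup>2) + x n t"
    proof -
      have N: "(of_nat n :: complex) = of_real (real n)" by simp
      have dist: "m * (A - B - C + E) - Y = (m * A - Y) - m * B + m * (- C + E)" for m A B C E Y :: complex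
        by (simp add: algebra_simps)
      have 1: "of_nat n * (\<i> * of_real (\<mu> * (t / sqrt (real n)))) = \<i> * of_real (t * \<mu> * sqrt (real n))"
      proof -
        have "real n * (\<mu> * (t / sqrt (real n))) = t * \<mu> * sqrt (real n)"
          using sqn[OF n] by (simp add: field_simps)
        then show ?thesis unfolding N by (metis mult.left_commute of_real_mult)
      qed
      have 2: "of_nat n * complex_of_real (\<sigma>\<^sup>2 * (t / sqrt (real n))\<^sup>2 / 2) = of_real (\<sigma>\<^sup>2 / 2 * t\<^sup>2)"
      proof -
        have "real n * (\<sigma>\<^sup>2 * (t / sqrt (real n))\<^sup>2 / 2) = \<sigma>\<^sup>2 / 2 * t\<^sup>2"
          using n by (simp add: power_divide)
        then show ?thesis unfolding N by (metis of_real_mult)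
      qed
      show ?thesis unfolding x_def dist 1 2 by simp
    qed
    finally show ?thesis by (simp only: exp_add g_def exp_of_real)
  qed
  have Fb: "norm (F n t) \<le> exp (- c * t\<^sup>2)" if n: "n \<ge> 1" and t: "\<bar>t / sqrt (real n)\<bar> \<le> \<delta>" for n t
  proof -
    have "norm (F n t) = norm (f (t / sqrt (real n))) ^ n" by (simp add: F_def norm_mult norm_power)
    also have "\<dots> \<le> exp (- c * (t / sqrt (real n))\<^sup>2) ^ n" by (intro power_mono fb[OF t]) simp
    also have "\<dots> = exp (- c * t\<^sup>2)" using n by (simp add: exp_of_nat_mult[symmetric] power_divide)
    finally show ?thesis .
  qed
  have eta2: "real n * \<bar>t / sqrt (real n)\<bar> ^ 2 = t\<^sup>2" if "n \<ge> 1" for n t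
    using that by (simp add: power_divide)
  have eta3: "real n * \<bar>t / sqrt (real n)\<bar> ^ 3 = \<bar>t\<bar> ^ 3 / sqrt (real n)" if "n \<ge> 1" for n t
    using sqn[OF that] by (simp add: power_divide power3_eq_cube field_simps)
  have eta4: "real n * \<bar>t / sqrt (real n)\<bar> ^ 4 = t ^ 4 / real n" if "n \<ge> 1" for n t
  proof -
    have "sqrt (real n) ^ 4 = (real n)\<^sup>2" using sqn(3)[OF that] by (metis mult_2_right numeral_Bit0 power2_eq_square power_add)
    then show ?thesis using that by (simp add: power_divide power2_eq_square)
  qed
  have xb: "norm (x n t) \<le> \<bar>t\<bar> ^ 3 / sqrt (real n) * (\<bar>\<kappa>\<bar> / 6 + K * \<delta>)"
    if n: "n \<ge> 1" and t: "\<bar>t / sqrt (real n)\<bar> \<le> \<delta>" for n t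
  proof -
    let ?y = "t / sqrt (real n)"
    have "norm (x n t) \<le> real n * (\<bar>\<kappa>\<bar> / 6 * \<bar>?y\<bar> ^ 3 + K * \<bar>?y\<bar> ^ 4)"
      unfolding x_def norm_mult norm_of_nat
      by (intro mult_left_mono norm_triangle_le add_mono e[OF t])
        (auto simp: norm_mult norm_divide norm_power abs_mult power_abs)
    also have "K * \<bar>?y\<bar> ^ 4 \<le> K * (\<delta> * \<bar>?y\<bar> ^ 3)"
      using t pos mult_right_mono[OF t, of "\<bar>?y\<bar> ^ 3"] by (intro mult_left_mono) (auto simp: eval_nat_numeral)
    also have "real n * (\<bar>\<kappa>\<bar> / 6 * \<bar>?y\<bar> ^ 3 + K * (\<delta> * \<bar>?y\<bar> ^ 3)) = (real n * \<bar>?y\<bar> ^ 3) * (\<bar>\<kappa>\<bar> / 6 + K * \<delta>)"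
      by (simp add: algebra_simps)
    finally show ?thesis using eta3[OF n] by (simp add: mult_left_mono)
  qed
  \<comment> \<open>n V alone is of order sqrt n. Its linear part is split off and paired with F -
    g, which is small.\<close>
  have Deq: "D n t = F n t * (of_nat n * (V (t / sqrt (real n)) - \<i> * of_real (t / sqrt (real n)) * a))
     + of_real (sqrt (real n)) * \<i> * of_real t * a * (F n t - of_real (g t)) - h t * of_real (g t)"
    if n: "n \<ge> 1" and t: "\<bar>t / sqrt (real n)\<bar> \<le> \<delta>" for n t
  proof -
    have "real n * (t / sqrt (real n)) = sqrt (real n) * t"
      using sqn[OF n] by (simp add: field_simps)
    then have 1: "of_nat n * of_real (t / sqrt (real n)) = complex_of_real (sqrt (real n)) * of_real t"
      by (metis of_real_mult of_real_of_nat_eq)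
    have "N * y = S * T \<Longrightarrow> N * (\<i> * y * a) = S * \<i> * T * a" for N y S T :: complex
      by algebra
    from this[OF 1] have *: "of_nat n * (\<i> * of_real (t / sqrt (real n)) * a) = of_real (sqrt (real n)) * \<i> * of_real t * a" .
    show ?thesis unfolding D_def I_def right_diff_distrib * using t by (simp add: algebra_simps)
  qed
  have hb: "norm (h t * of_real (g t)) \<le> (\<bar>\<kappa>\<bar> / 6 * norm a * \<bar>t\<bar> ^ 4 + norm b / 2 * \<bar>t\<bar> ^ 2) * exp (- c' * t\<^sup>2)" for t
  proof -
    have "norm (h t) \<le> \<bar>\<kappa>\<bar> / 6 * norm a * \<bar>t\<bar> ^ 4 + norm b / 2 * \<bar>t\<bar> ^ 2"
      unfolding h_def by (rule norm_triangle_le_diff) (simp add: norm_mult norm_divide norm_power abs_mult power_abs mult_ac)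
    then show ?thesis unfolding norm_mult using g0[of t] gc'[of t] by (intro mult_mono) auto
  qed
  have Vb: "norm (of_nat n * (V (t / sqrt (real n)) - \<i> * of_real (t / sqrt (real n)) * a)) \<le> (K * \<delta> + norm b / 2) * t\<^sup>2"
    if n: "n \<ge> 1" and t: "\<bar>t / sqrt (real n)\<bar> \<le> \<delta>" for n t
  proof -
    let ?y = "t / sqrt (real n)"
    have "norm (V ?y - \<i> * of_real ?y * a) \<le> norm (V ?y - \<i> * of_real ?y * a + of_real (?y\<^sup>2 / 2) * b) + norm (of_real (?y\<^sup>2 / 2) * b)"
      using norm_triangle_ineq4[of "V ?y - \<i> * of_real ?y * a + of_real (?y\<^sup>2 / 2) * b" "of_real (?y\<^sup>2 / 2) * b"] by simp
    also have "\<dots> \<le> K * \<bar>?y\<bar> ^ 3 + \<bar>?y\<bar> ^ 2 / 2 * norm b"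
      by (intro add_mono V[OF t]) (simp add: norm_mult norm_divide norm_power power_divide)
    also have "K * \<bar>?y\<bar> ^ 3 \<le> K * (\<delta> * \<bar>?y\<bar> ^ 2)"
      using t pos mult_right_mono[OF t, of "\<bar>?y\<bar> ^ 2"] by (intro mult_left_mono) (auto simp: eval_nat_numeral)
    finally have "real n * norm (V ?y - \<i> * of_real ?y * a) \<le> real n * (K * (\<delta> * \<bar>?y\<bar> ^ 2) + \<bar>?y\<bar> ^ 2 / 2 * norm b)"
      by (intro mult_left_mono) auto
    also have "\<dots> = (K * \<delta> + norm b / 2) * (real n * \<bar>?y\<bar> ^ 2)" by (simp add: algebra_simps)
    finally show ?thesis unfolding eta2[OF n] by (simp add: norm_mult)
  qed
  \<comment> \<open>The factor sqrt n is compensated by \<open>x n t\<close>, which is of order 1 /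
    sqrt n.\<close>
  have gF: "norm (of_real (sqrt (real n)) * \<i> * of_real t * a * (F n t - of_real (g t)))
      \<le> norm a * (\<bar>\<kappa>\<bar> / 6 + K * \<delta>) * \<bar>t\<bar> ^ 4 * exp (- c' * t\<^sup>2)"
    if n: "n \<ge> 1" and t: "\<bar>t / sqrt (real n)\<bar> \<le> \<delta>" for n t
  proof -
    have g: "complex_of_real (g t) = exp (of_real (- (\<sigma>\<^sup>2 / 2) * t\<^sup>2))" by (simp only: g_def exp_of_real)
    have F: "F n t = exp (of_real (- (\<sigma>\<^sup>2 / 2) * t\<^sup>2) + x n t)" unfolding FX[OF n t] g exp_add ..
    have "exp (Re (of_real (- (\<sigma>\<^sup>2 / 2) * t\<^sup>2) + x n t)) \<le> exp (- c * t\<^sup>2)"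
      using Fb[OF n t] unfolding F norm_exp_eq_Re .
    then have r1: "Re (of_real (- (\<sigma>\<^sup>2 / 2) * t\<^sup>2) + x n t) \<le> - c' * t\<^sup>2"
      using mult_right_mono[OF c'(2), of "t\<^sup>2"] by simp
    have r2: "Re (of_real (- (\<sigma>\<^sup>2 / 2) * t\<^sup>2)) \<le> - c' * t\<^sup>2"
      using mult_right_mono[OF c'(3), of "t\<^sup>2"] by simp
    have "norm (F n t - of_real (g t)) \<le> norm (x n t) * exp (- c' * t\<^sup>2)"
      unfolding F g using norm_exp_diff_le[OF r1 r2] by simp
    also have "\<dots> \<le> \<bar>t\<bar> ^ 3 / sqrt (real n) * (\<bar>\<kappa>\<bar> / 6 + K * \<delta>) * exp (- c' * t\<^sup>2)"
      by (intro mult_right_mono xb[OF n t]) simp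
    finally have "sqrt (real n) * \<bar>t\<bar> * norm a * norm (F n t - of_real (g t))
      \<le> sqrt (real n) * \<bar>t\<bar> * norm a * (\<bar>t\<bar> ^ 3 / sqrt (real n) * (\<bar>\<kappa>\<bar> / 6 + K * \<delta>) * exp (- c' * t\<^sup>2))"
      by (intro mult_left_mono) auto
    also have "\<dots> = norm a * (\<bar>\<kappa>\<bar> / 6 + K * \<delta>) * \<bar>t\<bar> ^ 4 * exp (- c' * t\<^sup>2)"
    proof -
      have gen: "S * \<tau> * A * (\<tau> ^ 3 / S * Q * E) = A * Q * \<tau> ^ 4 * E" if "S \<noteq> 0" for S \<tau> A Q E :: real
        using that by (simp add: field_simps eval_nat_numeral)
      show ?thesis by (rule gen) (use sqn(1)[OF n] in simp)
    qed
    finally show ?thesis by (simp add: norm_mult)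
  qed
  have Dbound: "norm (D n t) \<le> dom t" if n: "n \<ge> 1" for n t
  proof (cases "\<bar>t / sqrt (real n)\<bar> \<le> \<delta>")
    case True
    have "norm (D n t) \<le> norm (F n t * (of_nat n * (V (t / sqrt (real n)) - \<i> * of_real (t / sqrt (real n)) * a)))
     + norm (of_real (sqrt (real n)) * \<i> * of_real t * a * (F n t - of_real (g t))) + norm (h t * of_real (g t))"
      unfolding Deq[OF n True] by (intro norm_triangle_le_diff add_right_mono norm_triangle_ineq)
    also have "norm (F n t * (of_nat n * (V (t / sqrt (real n)) - \<i> * of_real (t / sqrt (real n)) * a)))
       \<le> exp (- c' * t\<^sup>2) * ((K * \<delta> + norm b / 2) * t\<^sup>2)"
      unfolding norm_mult[of "F n t"]
    proof (intro mult_mono Vb n True)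
      show "norm (F n t) \<le> exp (- c' * t\<^sup>2)"
        using mult_right_mono[OF c'(2), of "t\<^sup>2"] by (intro order_trans[OF Fb[OF n True]]) simp
    qed auto
    also note gF[OF n True]
    also note hb[of t]
    finally have "norm (D n t) \<le> ((K * \<delta> + norm b / 2 + norm b / 2) * \<bar>t\<bar> ^ 2
      + (norm a * (\<bar>\<kappa>\<bar> / 6 + K * \<delta>) + \<bar>\<kappa>\<bar> / 6 * norm a) * \<bar>t\<bar> ^ 4) * exp (- c' * t\<^sup>2)"
      by (simp add: algebra_simps)
    also have "\<dots> \<le> dom t" unfolding dom_def using pos
      by (intro mult_right_mono add_right_mono) auto
    finally show ?thesis by simp
  next
    case False
    \<comment> \<open>Outside the interval sqrt n is at most |t| / \<delta>, which trades the
      growing factor for a power of t.\<close>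
    then have large: "\<delta> * sqrt (real n) \<le> \<bar>t\<bar>" using sqn[OF n] by (simp add: field_simps abs_divide)
    have "norm (D n t) \<le> norm (of_real (sqrt (real n)) * \<i> * of_real t * a * of_real (g t)) + norm (h t * of_real (g t))"
      unfolding D_def I_def using False by simp (metis (no_types) minus_diff_commute norm_minus_cancel norm_triangle_ineq4 add.commute norm_triangle_ineq uminus_add_conv_diff)
    also have "norm (of_real (sqrt (real n)) * \<i> * of_real t * a * of_real (g t)) = sqrt (real n) * \<bar>t\<bar> * norm a * g t"
      using g0[of t] by (simp add: norm_mult)
    also have "\<dots> \<le> (norm a / \<delta>) * \<bar>t\<bar> ^ 2 * exp (- c' * t\<^sup>2)"
    proof (rule mult_mono[OF _ gc'])
      have "sqrt (real n) \<le> \<bar>t\<bar> / \<delta>" using large pos by (simp add: field_simps)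
      then have "sqrt (real n) * (\<bar>t\<bar> * norm a) \<le> \<bar>t\<bar> / \<delta> * (\<bar>t\<bar> * norm a)" by (rule mult_right_mono) simp
      then show "sqrt (real n) * \<bar>t\<bar> * norm a \<le> (norm a / \<delta>) * \<bar>t\<bar> ^ 2" by (simp add: power2_eq_square mult_ac)
    qed (use pos g0[of t] in auto)
    also note hb[of t]
    finally have "norm (D n t) \<le> ((norm a / \<delta> + norm b / 2) * \<bar>t\<bar> ^ 2 + (\<bar>\<kappa>\<bar> / 6 * norm a) * \<bar>t\<bar> ^ 4) * exp (- c' * t\<^sup>2)"
      by (simp add: algebra_simps)
    also have "\<dots> \<le> dom t" unfolding dom_def using pos
      by (intro mult_right_mono add_mono) auto
    finally show ?thesis .
  qed
  have Dlim: "(\<lambda>n. D n t) \<longlonglongrightarrow> 0" for t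
  proof -
    obtain q :: "complex \<Rightarrow> complex" where q: "\<And>x. exp x - 1 = x * q x" "q \<midarrow>0\<rightarrow> 1"
      using exp_minus_one_quotient by blast
    have "filterlim (\<lambda>n. \<delta> * sqrt (real n)) at_top sequentially" using pos by real_asymp
    then have "eventually (\<lambda>n. \<bar>t\<bar> \<le> \<delta> * sqrt (real n)) sequentially" by (simp add: filterlim_at_top)
    then have ev: "eventually (\<lambda>n. n \<ge> 1 \<and> \<bar>t / sqrt (real n)\<bar> \<le> \<delta>) sequentially"
      using eventually_ge_at_top[of 1]
      by eventually_elim (use sqn in \<open>auto simp: abs_divide field_simps\<close>)
    have V0: "(\<lambda>n. of_nat n * (V (t / sqrt (real n)) - \<i> * of_real (t / sqrt (real n)) * a) + of_real (t\<^sup>2 / 2) * b) \<longlonglongrightarrow> 0"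
    proof (rule Lim_null_comparison)
      show "(\<lambda>n. K * (\<bar>t\<bar> ^ 3 / sqrt (real n))) \<longlonglongrightarrow> 0" by real_asymp
      show "\<forall>\<^sub>F n in sequentially. norm (of_nat n * (V (t / sqrt (real n)) - \<i> * of_real (t / sqrt (real n)) * a) + of_real (t\<^sup>2 / 2) * b)
         \<le> K * (\<bar>t\<bar> ^ 3 / sqrt (real n))"
        using ev
      proof eventually_elim
        case (elim n)
        let ?y = "t / sqrt (real n)"
        have "real n * (?y\<^sup>2 / 2) = t\<^sup>2 / 2" using elim by (simp add: power_divide)
        then have "of_nat n * of_real (?y\<^sup>2 / 2) = complex_of_real (t\<^sup>2 / 2)" by (metis of_real_mult of_real_of_nat_eq)
        then have "of_nat n * (V ?y - \<i> * of_real ?y * a) + of_real (t\<^sup>2 / 2) * b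
           = of_nat n * (V ?y - \<i> * of_real ?y * a + of_real (?y\<^sup>2 / 2) * b)"
          by (metis distrib_left mult.assoc)
        also have "norm \<dots> \<le> real n * (K * \<bar>?y\<bar> ^ 3)"
          unfolding norm_mult norm_of_nat using elim by (intro mult_left_mono V) auto
        also have "\<dots> = K * (real n * \<bar>?y\<bar> ^ 3)" by (simp only: mult.left_commute)
        finally show ?case using elim by (simp only: eta3)
      qed
    qed
    have V1: "(\<lambda>n. of_nat n * (V (t / sqrt (real n)) - \<i> * of_real (t / sqrt (real n)) * a)) \<longlonglongrightarrow> - (of_real (t\<^sup>2 / 2) * b)"
      using tendsto_diff[OF V0 tendsto_const[of "of_real (t\<^sup>2 / 2) * b"]] by simp
    have sx: "(\<lambda>n. of_real (sqrt (real n)) * x n t + \<i> * of_real (\<kappa> * t ^ 3 / 6)) \<longlonglongrightarrow> 0"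
    proof (rule Lim_null_comparison)
      show "(\<lambda>n. K * (t ^ 4 / sqrt (real n))) \<longlonglongrightarrow> 0" by real_asymp
      show "\<forall>\<^sub>F n in sequentially. norm (of_real (sqrt (real n)) * x n t + \<i> * of_real (\<kappa> * t ^ 3 / 6)) \<le> K * (t ^ 4 / sqrt (real n))"
        using ev
      proof eventually_elim
        case (elim n)
        let ?y = "t / sqrt (real n)"
        have n: "n \<ge> 1" and t: "\<bar>?y\<bar> \<le> \<delta>" using elim by auto
        have "sqrt (real n) * (real n * (\<kappa> * ?y ^ 3 / 6)) = \<kappa> * t ^ 3 / 6"
          using sqn[OF n] by (simp add: power_divide power3_eq_cube field_simps)
        then have 1: "of_real (sqrt (real n)) * (of_nat n * of_real (\<kappa> * ?y ^ 3 / 6)) = complex_of_real (\<kappa> * t ^ 3 / 6)"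
          by (metis of_real_mult of_real_of_nat_eq)
        have dist: "r * (m * (- \<i> * u + E)) + \<i> * (r * (m * u)) = r * (m * E)" for r m u E :: complex
          by (simp add: algebra_simps)
        have "of_real (sqrt (real n)) * x n t + \<i> * of_real (\<kappa> * t ^ 3 / 6) = of_real (sqrt (real n)) * (of_nat n * e ?y)"
          unfolding x_def 1[symmetric] by (rule dist)
        also have "norm \<dots> \<le> sqrt (real n) * (real n * (K * \<bar>?y\<bar> ^ 4))"
          unfolding norm_mult norm_of_nat norm_of_real using e[OF t] by (simp add: mult_left_mono)
        also have "\<dots> = K * (sqrt (real n) * (real n * \<bar>?y\<bar> ^ 4))" by (simp only: mult.left_commute)
        also have "\<dots> = K * (t ^ 4 / sqrt (real n))"
          unfolding eta4[OF n] using sqn[OF n] by (simp add: field_simps)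
        finally show ?case .
      qed
    qed
    have sx1: "(\<lambda>n. of_real (sqrt (real n)) * x n t) \<longlonglongrightarrow> - (\<i> * of_real (\<kappa> * t ^ 3 / 6))"
      using tendsto_diff[OF sx tendsto_const[of "\<i> * of_real (\<kappa> * t ^ 3 / 6)"]] by simp
    have x0: "(\<lambda>n. x n t) \<longlonglongrightarrow> 0"
    proof -
      have "(\<lambda>n. 1 / sqrt (real n)) \<longlonglongrightarrow> 0" by real_asymp
      then have "(\<lambda>n. complex_of_real (1 / sqrt (real n))) \<longlonglongrightarrow> of_real 0" by (rule tendsto_of_real)
      from tendsto_mult[OF this sx1]
      have "(\<lambda>n. complex_of_real (1 / sqrt (real n)) * (of_real (sqrt (real n)) * x n t)) \<longlonglongrightarrow> 0" by simp
      then show ?thesis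
      proof (rule Lim_transform_eventually)
        show "\<forall>\<^sub>F n in sequentially. complex_of_real (1 / sqrt (real n)) * (of_real (sqrt (real n)) * x n t) = x n t"
          using eventually_ge_at_top[of 1] by eventually_elim auto
      qed
    qed
    have qx: "(\<lambda>n. q (x n t) * (of_real (sqrt (real n)) * x n t)) \<longlonglongrightarrow> - (\<i> * of_real (\<kappa> * t ^ 3 / 6))"
    proof -
      \<comment> \<open>Only the limit of \<open>q\<close> at 0 is known, not its value. Redefining
        it there makes it continuous, and the product is unaffected because its other factor
        vanishes.\<close>
      define q' where "q' = q(0 := 1)"
      have "isCont q' 0" unfolding isCont_def q'_def
        using q(2) by (simp add: LIM_equal[of 0 "q(0 := 1)" q])
      then have "(\<lambda>n. q' (x n t)) \<longlonglongrightarrow> q' 0" using x0 by (rule isCont_tendsto_compose)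
      then have "(\<lambda>n. q' (x n t) * (of_real (sqrt (real n)) * x n t)) \<longlonglongrightarrow> 1 * - (\<i> * of_real (\<kappa> * t ^ 3 / 6))"
        by (intro tendsto_mult sx1) (simp add: q'_def)
      moreover have "q' y * (r * y) = q y * (r * y)" for y r by (simp add: q'_def)
      ultimately show ?thesis by simp
    qed
    have Flim: "(\<lambda>n. of_real (g t) * exp (x n t)) \<longlonglongrightarrow> of_real (g t) * exp 0"
      by (intro tendsto_intros x0)
    have "(\<lambda>n. of_real (g t) * exp (x n t) * (of_nat n * (V (t / sqrt (real n)) - \<i> * of_real (t / sqrt (real n)) * a))
       + \<i> * of_real t * a * of_real (g t) * (q (x n t) * (of_real (sqrt (real n)) * x n t)) - h t * of_real (g t)) \<longlonglongrightarrow>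
        of_real (g t) * exp 0 * - (of_real (t\<^sup>2 / 2) * b) + \<i> * of_real t * a * of_real (g t) * - (\<i> * of_real (\<kappa> * t ^ 3 / 6))
        - h t * of_real (g t)"
      by (intro tendsto_diff tendsto_add tendsto_mult[OF Flim V1] tendsto_mult_left[OF qx] tendsto_const)
    also have "of_real (g t) * exp 0 * - (of_real (t\<^sup>2 / 2) * b) + \<i> * of_real t * a * of_real (g t) * - (\<i> * of_real (\<kappa> * t ^ 3 / 6))
        - h t * of_real (g t) = 0"
      by (simp add: h_def algebra_simps eval_nat_numeral)
    finally show ?thesis
    proof (rule Lim_transform_eventually)
      show "\<forall>\<^sub>F n in sequentially. of_real (g t) * exp (x n t) * (of_nat n * (V (t / sqrt (real n)) - \<i> * of_real (t / sqrt (real n)) * a))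
       + \<i> * of_real t * a * of_real (g t) * (q (x n t) * (of_real (sqrt (real n)) * x n t)) - h t * of_real (g t) = D n t"
        using ev
      proof eventually_elim
        case (elim n)
        have "F n t - of_real (g t) = of_real (g t) * (x n t * q (x n t))"
          unfolding q(1)[symmetric] using FX elim by (simp add: algebra_simps)
        moreover have "F n t = of_real (g t) * exp (x n t)" using FX elim by simp
        ultimately show ?case using Deq elim by (simp add: mult_ac)
      qed
    qed
  qed
  define J where "J n = (LINT \<eta>|lborel. indicator {-\<delta>..\<delta>} \<eta> *\<^sub>R (f \<eta> ^ n * V \<eta> * exp (- \<i> * of_real (\<eta> * real_of_int (k n)))))" for n
  \<comment> \<open>\<open>f\<close> and \<open>V\<close> are continuous only on the interval, so
    measurability on the line is obtained for their product with the indicator.\<close>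
  define P where "P n \<eta> = indicator {-\<delta>..\<delta>} \<eta> *\<^sub>R (f \<eta> ^ n * V \<eta>)" for n \<eta>
  have Pint: "integrable lborel (P n)" for n
    unfolding P_def using borel_integrable_atLeastAtMost'[of "-\<delta>" \<delta> "\<lambda>\<eta>. f \<eta> ^ n * V \<eta>"]
      continuous_on_mult[OF continuous_on_power[OF cont(1)] cont(2)] by (simp add: set_integrable_def)
  have Pmeas [measurable]: "P n \<in> borel_measurable lborel" for n using Pint by auto
  have IP: "I n t * (of_nat n * F n t * V (t / sqrt (real n))) =
      of_nat n * (P n (t / sqrt (real n)) * exp (- \<i> * of_real (t * \<mu> * sqrt (real n))))" for n t
  proof -
    have "\<bar>t / sqrt (real n)\<bar> \<le> \<delta> \<longleftrightarrow> t / sqrt (real n) \<in> {-\<delta>..\<delta>}" by (simp only: abs_le_iff atLeastAtMost_iff) linarith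
    note I = this
    show ?thesis
    proof (cases "t / sqrt (real n) \<in> {-\<delta>..\<delta>}")
      case True
      then show ?thesis unfolding I_def P_def F_def I indicator_simps(1)[OF True] by simp
    next
      case False
      then show ?thesis unfolding I_def P_def F_def I indicator_simps(2)[OF False] by auto
    qed
  qed
  have Dmeas: "D n \<in> borel_measurable lborel" for n
  proof -
    have [measurable]: "(\<lambda>t. P n (t / sqrt (real n))) \<in> borel_measurable lborel"
      by (rule measurable_compose[of "\<lambda>t. t / sqrt (real n)" lborel borel]) (use Pmeas[of n] in auto)
    have [measurable]: "(\<lambda>t. exp (- \<i> * of_real (t * \<mu> * sqrt (real n)))) \<in> borel_measurable lborel"
      by (auto intro!: borel_measurable_continuous_onI continuous_intros)
    have [measurable]: "(\<lambda>t. of_real (sqrt (real n)) * \<i> * of_real t * a * of_real (g t) - h t * of_real (g t)) \<in> borel_measurable lborel"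
      "(\<lambda>t. of_real (sqrt (real n)) * \<i> * of_real t * a * of_real (g t)) \<in> borel_measurable lborel"
      "(\<lambda>t. h t * of_real (g t)) \<in> borel_measurable lborel"
      unfolding g_def h_def by (auto intro!: borel_measurable_continuous_onI continuous_intros)
    show ?thesis unfolding D_def[abs_def] IP by measurable
  qed
  have Dint: "integrable lborel (D n)" if "n \<ge> 1" for n
    by (rule Bochner_Integration.integrable_bound[OF dom_int Dmeas])
       (use Dbound[OF that] in \<open>auto intro: order_trans[OF _ abs_ge_self]\<close>)
  have normD: "(\<lambda>n. LINT t|lborel. norm (D n t)) \<longlonglongrightarrow> 0"
  proof -
    \<comment> \<open>Shifted by one because the majorant is established from n = 1 on; for n = 0
      the quotient t / sqrt 0 is 0 by convention.\<close>
    have "(\<lambda>n. LINT t|lborel. norm (D (Suc n) t)) \<longlonglongrightarrow> (LINT t|(lborel :: real measure). (0 :: real))"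
    proof (rule integral_dominated_convergence[where w = dom])
      show "AE t in lborel. (\<lambda>n. norm (D (Suc n) t)) \<longlonglongrightarrow> 0"
        using Dlim by (auto intro!: AE_I2 tendsto_norm_zero LIMSEQ_Suc)
      show "AE t in lborel. norm (norm (D (Suc n) t)) \<le> dom t" for n using Dbound by auto
    qed (use Dmeas dom_int in auto)
    then have "(\<lambda>n. LINT t|lborel. norm (D (Suc n) t)) \<longlonglongrightarrow> 0" by simp
    then show ?thesis by (rule LIMSEQ_imp_Suc)
  qed
  have main: "of_real (real n powr (3/2)) * J n
     - of_real (sqrt (real n)) * (\<i> * a * gaussint \<sigma> 1 (s n))
     - (of_real (\<kappa> / 6) * a * gaussint \<sigma> 4 (s n) - b / 2 * gaussint \<sigma> 2 (s n))
     = (LINT t|lborel. D n t * exp (- \<i> * of_real (t * s n)))" if n: "n \<ge> 1" for n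
  proof -
    let ?E = "\<lambda>t. exp (- \<i> * complex_of_real (t * s n))"
    let ?g = "\<lambda>j t. complex_of_real (t ^ j * exp (- (\<sigma>\<^sup>2 / 2) * t\<^sup>2)) * exp (- \<i> * of_real (t * s n))"
    have gi: "integrable lborel (?g j)" for j using pos by (intro integrable_cpower_gauss) simp
    have kn: "t / sqrt (real n) * real_of_int (k n) = t * \<mu> * sqrt (real n) + t * s n" for t
      using sqn[OF n] by (simp add: s_def field_simps)
    have "J n = (1 / sqrt (real n)) *\<^sub>R (LINT t|lborel. P n (t / sqrt (real n)) * exp (- \<i> * of_real (t / sqrt (real n) * real_of_int (k n))))"
      unfolding J_def P_def using sqn[OF n]
      by (subst lborel_integral_real_affine[where t = 0 and c = "1 / sqrt (real n)"]) auto
    moreover have "real n powr (3/2) = real n * sqrt (real n)"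
      using n by (simp add: powr_half_sqrt[symmetric] powr_add[symmetric] powr_mult_base)
    ultimately have J1: "of_real (real n powr (3/2)) * J n = of_nat n * (LINT t|lborel. P n (t / sqrt (real n)) * exp (- \<i> * of_real (t / sqrt (real n) * real_of_int (k n))))"
      using sqn[OF n] by (simp add: scaleR_conv_of_real)
    also have "\<dots> = (LINT t|lborel. I n t * (of_nat n * F n t * V (t / sqrt (real n))) * ?E t)"
      unfolding IP kn by (simp add: exp_add[symmetric] algebra_simps)
    finally have J2: "of_real (real n powr (3/2)) * J n = (LINT t|lborel. I n t * (of_nat n * F n t * V (t / sqrt (real n))) * ?E t)" .
    have split: "I n t * (of_nat n * F n t * V (t / sqrt (real n))) * ?E t = D n t * ?E t
       + of_real (sqrt (real n)) * (\<i> * a * ?g 1 t) + (of_real (\<kappa> / 6) * a * ?g 4 t - b / 2 * ?g 2 t)" for t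
      unfolding D_def h_def g_def by (simp add: algebra_simps)
    have DE: "integrable lborel (\<lambda>t. D n t * ?E t)"
    proof (rule Bochner_Integration.integrable_bound[OF Dint[OF n]])
      have [measurable]: "?E \<in> borel_measurable lborel"
        by (auto intro!: borel_measurable_continuous_onI continuous_intros)
      note Dmeas[measurable]
      show "(\<lambda>t. D n t * ?E t) \<in> borel_measurable lborel" by measurable
    qed (simp add: norm_mult)
    show ?thesis unfolding J2 split gaussint_def
      using DE gi[of 1] gi[of 4] gi[of 2] by simp
  qed
  show ?thesis unfolding J_def[symmetric]
  proof (rule Lim_null_comparison[OF _ normD])
    show "\<forall>\<^sub>F n in sequentially. norm (of_real (real n powr (3/2)) * J n
     - of_real (sqrt (real n)) * (\<i> * a * gaussint \<sigma> 1 (s n))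
     - (of_real (\<kappa> / 6) * a * gaussint \<sigma> 4 (s n) - b / 2 * gaussint \<sigma> 2 (s n))) \<le> (LINT t|lborel. norm (D n t))"
      using eventually_ge_at_top[of 1]
    proof eventually_elim
      case (elim n)
      have "norm (LINT t|lborel. D n t * exp (- \<i> * of_real (t * s n))) \<le> (LINT t|lborel. norm (D n t * exp (- \<i> * of_real (t * s n))))"
        by (rule integral_norm_bound)
      then show ?case unfolding main[OF elim] by (simp add: norm_mult)
    qed
  qed
qed

section \<open>The cumulant generating function\<close>

lemma lsumr_conv: "\<theta> \<in> {a..b} \<Longrightarrow> lsumr \<theta> l \<le> lsumr a l + lsumr b l"
proof (induction l)
  case (Cons x l)
  have "exp (\<theta> * real_of_int x) \<le> exp (a * real_of_int x) + exp (b * real_of_int x)"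
  proof (cases "x \<ge> 0")
    case True
    then have "exp (\<theta> * real_of_int x) \<le> exp (b * real_of_int x)" using Cons by (simp add: mult_right_mono)
    then show ?thesis by (smt (verit) exp_gt_zero)
  next
    case False
    then have "exp (\<theta> * real_of_int x) \<le> exp (a * real_of_int x)" using Cons by (simp add: mult_right_mono_neg)
    then show ?thesis by (smt (verit) exp_gt_zero)
  qed
  then show ?case using Cons by (simp add: lsumr_def)
qed (simp add: lsumr_def)

lemma lsum_split2:
  assumes "k1 \<noteq> k2"
  shows "lsum z l = of_nat (count_list l k1) * exp (z * of_int k1) + of_nat (count_list l k2) * exp (z * of_int k2)
     + lsum z (filter (\<lambda>x. x \<noteq> k1 \<and> x \<noteq> k2) l)"
  using assms by (induction l) (auto simp: lsum_def algebra_simps)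

lemma lsumr_split2:
  assumes "k1 \<noteq> k2"
  shows "lsumr \<theta> l = real (count_list l k1) * exp (\<theta> * of_int k1) + real (count_list l k2) * exp (\<theta> * of_int k2)
     + lsumr \<theta> (filter (\<lambda>x. x \<noteq> k1 \<and> x \<noteq> k2) l)"
  using assms by (induction l) (auto simp: lsumr_def algebra_simps)

lemma count_list_le_lsumr: "real (count_list l k) * exp (\<theta> * of_int k) \<le> lsumr \<theta> l"
  by (induction l) (auto simp: lsumr_def algebra_simps intro: add_increasing)

text \<open>With S = a1 + a2 the squared modulus is S^2 - 2 S d for the gap d = a1 a2 (1 - cos (x1 -
  x2)) / S, and this is at most (S - d)^2. The root may be taken because d \<le> S.\<close>

lemma two_atoms_norm_bound:
  fixes a1 a2 s :: real
  assumes a: "a1 > 0" "a2 > 0"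
  shows "norm (of_real a1 * exp (\<i> * of_real x1) + of_real a2 * exp (\<i> * of_real x2))
     \<le> a1 + a2 - a1 * a2 / (a1 + a2) * (1 - cos (x1 - x2))"
proof -
  define S where "S = a1 + a2"
  define d where "d = a1 * a2 / S * (1 - cos (x1 - x2))"
  have S: "S > 0" using a by (simp add: S_def)
  have "(norm (of_real a1 * exp (\<i> * of_real x1) + of_real a2 * exp (\<i> * of_real x2)))\<^sup>2
     = (a1 * cos x1 + a2 * cos x2)\<^sup>2 + (a1 * sin x1 + a2 * sin x2)\<^sup>2"
    by (simp add: cmod_power2 Re_exp Im_exp)
  also have "\<dots> = a1\<^sup>2 * ((sin x1)\<^sup>2 + (cos x1)\<^sup>2) + a2\<^sup>2 * ((sin x2)\<^sup>2 + (cos x2)\<^sup>2) + 2 * a1 * a2 * cos (x1 - x2)"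
    unfolding cos_diff by algebra
  also have "\<dots> = S\<^sup>2 - 2 * a1 * a2 * (1 - cos (x1 - x2))"
    unfolding sin_cos_squared_add S_def by algebra
  also have "2 * a1 * a2 * (1 - cos (x1 - x2)) = 2 * S * d" using S by (simp add: d_def)
  also have "S\<^sup>2 - 2 * S * d \<le> (S - d)\<^sup>2" by (simp add: power2_eq_square algebra_simps)
  finally have le: "(norm (of_real a1 * exp (\<i> * of_real x1) + of_real a2 * exp (\<i> * of_real x2)))\<^sup>2 \<le> (S - d)\<^sup>2" .
  have "0 \<le> S - d"
  proof -
    have "d \<le> a1 * a2 / S * 2"
      unfolding d_def using a S cos_ge_minus_one[of "x1 - x2"] by (intro mult_left_mono) auto
    also have "\<dots> \<le> S"
      using S zero_le_power2[of "a1 - a2"] zero_le_power2[of a1] zero_le_power2[of a2]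
      by (simp add: field_simps S_def power2_eq_square)
    finally show ?thesis by simp
  qed
  then show ?thesis using le power2_le_imp_le unfolding d_def S_def by blast
qed

lemma Lcount_1: "Lcount xi 1 k w = real (count_list (xi [] w) k)"
proof -
  have "{u. (u, k) \<in> particles xi 1 w} = (\<lambda>i. [i]) ` {i. i < length (xi [] w) \<and> xi [] w ! i = k}"
    by (auto simp: image_iff)
  moreover have "card ((\<lambda>i. [i]) ` {i. i < length (xi [] w) \<and> xi [] w ! i = k}) = card {i. i < length (xi [] w) \<and> xi [] w ! i = k}"
    by (rule card_image) (auto simp: inj_on_def)
  ultimately show ?thesis
    by (simp add: Lcount_def count_list_eq_length_filter length_filter_conv_card eq_commute)
qed

lemma psumr_1: "psumr \<theta> (particles xi 1 w) = lsumr \<theta> (xi [] w)"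
  using psumr_Suc[of \<theta> xi 0 w] by simp

lemma expsum_psumr: "expsum xi n \<theta> w = psumr \<theta> (particles xi n w)"
  by (simp add: expsum_def psumr_def case_prod_unfold)

context brw
begin

lemma fin_conv: "fin a \<Longrightarrow> fin b \<Longrightarrow> \<theta> \<in> {a..b} \<Longrightarrow> fin \<theta>"
  unfolding fin_def
  by (rule Bochner_Integration.integrable_bound[of M "\<lambda>w. lsumr a (xi [] w) + lsumr b (xi [] w)"])
     (auto simp: lsumr_nonneg lsumr_conv)

lemma mR_conv: "fin a \<Longrightarrow> fin b \<Longrightarrow> \<theta> \<in> {a..b} \<Longrightarrow> mR \<theta> \<le> mR a + mR b"
proof -
  assume f: "fin a" "fin b" and t: "\<theta> \<in> {a..b}"
  have "mR \<theta> \<le> (\<integral>w. lsumr a (xi [] w) + lsumr b (xi [] w) \<partial>M)"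
    unfolding mR_def using f fin_conv[OF f t] lsumr_conv[OF t]
    by (intro integral_mono) (auto simp: fin_def)
  then show ?thesis using f by (simp add: mR_def fin_def)
qed

lemma phi_finite_iff: "phi_finite M xi \<theta> \<longleftrightarrow> fin \<theta>"
proof
  assume "phi_finite M xi \<theta>"
  then show "fin \<theta>" unfolding fin_def phi_finite_def expsum_psumr psumr_1
    by (intro integrableI_nonneg) (auto simp: lsumr_nonneg)
next
  assume "fin \<theta>"
  then show "phi_finite M xi \<theta>" unfolding fin_def phi_finite_def expsum_psumr psumr_1
    by (subst nn_integral_eq_integral) (auto simp: lsumr_nonneg)
qed

lemma phi_eq: "fin \<theta> \<Longrightarrow> phi M xi \<theta> = ln (mR \<theta>)"
  unfolding fin_def phi_def expsum_psumr psumr_1 mR_def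
  by (subst nn_integral_eq_integral) (auto simp: lsumr_nonneg Bochner_Integration.integral_nonneg)

lemma open_Dphi: "open (Dphi M xi)"
  by (simp add: Dphi_def)

lemma fin_Dphi: "\<theta> \<in> Dphi M xi \<Longrightarrow> fin \<theta>"
  using interior_subset unfolding Dphi_def phi_finite_iff by blast

lemma Dphi_conv: "a \<in> Dphi M xi \<Longrightarrow> b \<in> Dphi M xi \<Longrightarrow> {a..b} \<subseteq> Dphi M xi"
proof -
  have "convex {\<theta>. fin \<theta>}"
    unfolding is_interval_convex_1[symmetric] is_interval_1 by (metis fin_conv atLeastAtMost_iff mem_Collect_eq)
  then have "convex (Dphi M xi)" unfolding Dphi_def phi_finite_iff by (rule convex_interior)
  then show "a \<in> Dphi M xi \<Longrightarrow> b \<in> Dphi M xi \<Longrightarrow> {a..b} \<subseteq> Dphi M xi"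
    unfolding is_interval_convex_1[symmetric] is_interval_1 by (meson atLeastAtMost_iff subsetI)
qed

lemma Dphi_nbhd:
  assumes "\<theta> \<in> Dphi M xi"
  obtains r where "r > 0" "\<And>x. \<bar>x - \<theta>\<bar> \<le> r \<Longrightarrow> fin x"
proof -
  obtain r where "r > 0" "cball \<theta> r \<subseteq> Dphi M xi" using assms open_Dphi open_contains_cball by blast
  moreover have "x \<in> cball \<theta> r" if "\<bar>x - \<theta>\<bar> \<le> r" for x
    using that by (simp add: dist_real_def abs_minus_commute)
  ultimately show ?thesis using that[of r] fin_Dphi by blast
qed

lemma holomorphic_mC:
  assumes "fin a" "fin b"
  shows "mC holomorphic_on {z. a < Re z \<and> Re z < b}"
  unfolding mC_def
proof (rule holomorphic_on_lebesgue_integral[where g = "\<lambda>w. lsumr a (xi [] w) + lsumr b (xi [] w)"])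
  have "{z. a < Re z \<and> Re z < b} = {z. a < Re z} \<inter> {z. Re z < b}" by auto
  then show "open {z. a < Re z \<and> Re z < b}" by (simp add: open_halfspace_Re_gt open_halfspace_Re_lt open_Int)
  show "(\<lambda>z. lsum z (xi [] w)) holomorphic_on {z. a < Re z \<and> Re z < b}" for w
    unfolding lsum_nth by (intro holomorphic_intros)
  show "norm (lsum z (xi [] w)) \<le> lsumr a (xi [] w) + lsumr b (xi [] w)"
    if "z \<in> {z. a < Re z \<and> Re z < b}" for z w
    using that by (intro order_trans[OF norm_lsum_le lsumr_conv]) auto
qed (use assms in \<open>auto simp: fin_def\<close>)

end

locale brw_nd = brw +
  fixes k1 k2 :: int
  assumes k12: "k1 \<noteq> k2" and atoms: "(\<integral>w. Lcount xi 1 k1 w \<partial>M) > 0" "(\<integral>w. Lcount xi 1 k2 w \<partial>M) > 0"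
begin

definition atom :: "int \<Rightarrow> real \<Rightarrow> real" where
  "atom k \<theta> = (\<integral>w. Lcount xi 1 k w \<partial>M) * exp (\<theta> * of_int k)"

lemma Lcount_1_int: 
  assumes "fin \<theta>"
  shows "integrable M (\<lambda>w. real (count_list (xi u w) k))"
proof -
  have "integrable M (\<lambda>w. real (count_list (xi [] w) k))"
  proof (rule Bochner_Integration.integrable_bound[of M "\<lambda>w. exp (- \<theta> * of_int k) * lsumr \<theta> (xi [] w)"])
    show "integrable M (\<lambda>w. exp (- \<theta> * of_int k) * lsumr \<theta> (xi [] w))"
      using assms by (auto simp: fin_def)
    show "AE w in M. norm (real (count_list (xi [] w) k)) \<le> norm (exp (- \<theta> * of_int k) * lsumr \<theta> (xi [] w))"
    proof (rule AE_I2)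
      fix w
      have "exp (- \<theta> * of_int k) * (real (count_list (xi [] w) k) * exp (\<theta> * of_int k)) \<le> exp (- \<theta> * of_int k) * lsumr \<theta> (xi [] w)"
        by (intro mult_left_mono count_list_le_lsumr) simp
      also have "exp (- \<theta> * of_int k) * (real (count_list (xi [] w) k) * exp (\<theta> * of_int k)) = real (count_list (xi [] w) k)"
        by (simp add: exp_minus)
      finally show "norm (real (count_list (xi [] w) k)) \<le> norm (exp (- \<theta> * of_int k) * lsumr \<theta> (xi [] w))"
        by (simp add: lsumr_nonneg)
    qed
  qed simp
  then show ?thesis using xi_integrable[of "\<lambda>l. real (count_list l k)" u] by simp
qed

text \<open>The contributions of two sites cancel partially; all others are estimated by their
  modulus. The sites are arbitrary because the lemma serves twice: \<open>k1\<close> and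
  \<open>k2\<close> give positivity of the second derivative of \<open>phi\<close>, and the pairs
  containing \<open>k1\<close> give the strict inequality under aperiodicity.\<close>

lemma mC_two_atoms:
  assumes fin: "fin \<theta>" and j: "j1 \<noteq> j2" and at: "(\<integral>w. Lcount xi 1 j1 w \<partial>M) > 0" "(\<integral>w. Lcount xi 1 j2 w \<partial>M) > 0"
  shows "norm (mC (Complex \<theta> \<eta>)) \<le> mR \<theta> - atom j1 \<theta> * atom j2 \<theta> / (atom j1 \<theta> + atom j2 \<theta>) * (1 - cos (\<eta> * (of_int j1 - of_int j2)))"
proof -
  let ?z = "Complex \<theta> \<eta>"
  let ?fl = "filter (\<lambda>x. x \<noteq> j1 \<and> x \<noteq> j2)"
  define c where "c k w = real (count_list (xi [] w) k)" for k w
  have ci: "integrable M (c k)" for k unfolding c_def[abs_def] by (rule Lcount_1_int[OF fin])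
  have atom_c: "atom k \<theta> = expectation (c k) * exp (\<theta> * of_int k)" for k
    unfolding atom_def Lcount_1 c_def[abs_def] by simp
  have a0: "atom j1 \<theta> > 0" "atom j2 \<theta> > 0" using at by (auto simp: atom_def)
  have rest_le: "lsumr \<theta> (?fl l) \<le> lsumr \<theta> l" for l
    using lsumr_split2[OF j, of \<theta> l] by (simp add: lsumr_nonneg)
  have ri: "integrable M (\<lambda>w. lsumr \<theta> (?fl (xi [] w)))"
    by (rule Bochner_Integration.integrable_bound[of M "\<lambda>w. lsumr \<theta> (xi [] w)"])
       (use fin in \<open>auto simp: fin_def lsumr_nonneg rest_le\<close>)
  have rci: "integrable M (\<lambda>w. lsum ?z (?fl (xi [] w)))"
    by (rule Bochner_Integration.integrable_bound[OF ri])
       (auto simp: lsumr_nonneg intro!: order_trans[OF norm_lsum_le])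
  have ez: "exp (?z * of_int k) = of_real (exp (\<theta> * of_int k)) * exp (\<i> * of_real (\<eta> * of_int k))" for k
    by (simp add: Complex_eq exp_add[symmetric] exp_of_real[symmetric] algebra_simps)
  have "mC ?z = (\<integral>w. of_real (c j1 w) * exp (?z * of_int j1) + of_real (c j2 w) * exp (?z * of_int j2)
      + lsum ?z (?fl (xi [] w)) \<partial>M)"
    unfolding mC_def c_def by (subst lsum_split2[OF j]) simp
  also have "\<dots> = of_real (expectation (c j1)) * exp (?z * of_int j1) + of_real (expectation (c j2)) * exp (?z * of_int j2)
      + (\<integral>w. lsum ?z (?fl (xi [] w)) \<partial>M)"
    using ci rci by simp
  finally have eq: "mC ?z = (of_real (atom j1 \<theta>) * exp (\<i> * of_real (\<eta> * of_int j1)) 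
      + of_real (atom j2 \<theta>) * exp (\<i> * of_real (\<eta> * of_int j2))) + (\<integral>w. lsum ?z (?fl (xi [] w)) \<partial>M)"
    unfolding ez atom_c by simp
  have "mR \<theta> = (\<integral>w. c j1 w * exp (\<theta> * of_int j1) + c j2 w * exp (\<theta> * of_int j2) + lsumr \<theta> (?fl (xi [] w)) \<partial>M)"
    unfolding mR_def c_def by (subst lsumr_split2[OF j]) simp
  also have "\<dots> = atom j1 \<theta> + atom j2 \<theta> + (\<integral>w. lsumr \<theta> (?fl (xi [] w)) \<partial>M)"
    unfolding atom_c using ci ri by simp
  finally have mR: "mR \<theta> = atom j1 \<theta> + atom j2 \<theta> + (\<integral>w. lsumr \<theta> (?fl (xi [] w)) \<partial>M)" .
  have "norm (\<integral>w. lsum ?z (?fl (xi [] w)) \<partial>M) \<le> (\<integral>w. lsumr \<theta> (?fl (xi [] w)) \<partial>M)"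
    by (rule order_trans[OF integral_norm_bound integral_mono])
       (use ri rci in \<open>auto intro: order_trans[OF norm_lsum_le]\<close>)
  then have "norm (mC ?z) \<le> norm (of_real (atom j1 \<theta>) * exp (\<i> * of_real (\<eta> * of_int j1)) 
      + of_real (atom j2 \<theta>) * exp (\<i> * of_real (\<eta> * of_int j2))) + (\<integral>w. lsumr \<theta> (?fl (xi [] w)) \<partial>M)"
    unfolding eq by (intro order_trans[OF norm_triangle_ineq]) simp
  also have "\<dots> \<le> (atom j1 \<theta> + atom j2 \<theta> - atom j1 \<theta> * atom j2 \<theta> / (atom j1 \<theta> + atom j2 \<theta>) * (1 - cos (\<eta> * of_int j1 - \<eta> * of_int j2)))
      + (\<integral>w. lsumr \<theta> (?fl (xi [] w)) \<partial>M)"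
    by (intro add_right_mono two_atoms_norm_bound a0)
  finally show ?thesis unfolding mR by (simp add: algebra_simps)
qed

lemma mR_pos:
  assumes "fin \<theta>" shows "mR \<theta> > 0"
proof -
  have "0 < atom k1 \<theta>" using atoms by (simp add: atom_def)
  also have "\<dots> = (\<integral>w. real (count_list (xi [] w) k1) * exp (\<theta> * of_int k1) \<partial>M)"
    unfolding atom_def Lcount_1 by simp
  also have "\<dots> \<le> mR \<theta>" unfolding mR_def
    using assms by (intro integral_mono integrable_mult_left Lcount_1_int count_list_le_lsumr) (auto simp: fin_def)
  finally show ?thesis .
qed

text \<open>Near a real point m has positive real part, so its principal logarithm is holomorphic
  and extends \<open>phi\<close>. The conclusion bundles what is needed later on one common
  disc.\<close>

lemma log_mC:
  assumes "\<theta> \<in> Dphi M xi"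
  shows "\<exists>r F. r > 0 \<and> F holomorphic_on ball (of_real \<theta>) r \<and>
    (\<forall>x. \<bar>x - \<theta>\<bar> < r \<longrightarrow> fin x) \<and> (\<forall>z \<in> ball (of_real \<theta>) r. exp (F z) = mC z) \<and>
    (\<forall>x. \<bar>x - \<theta>\<bar> < r \<longrightarrow> F (of_real x) = of_real (phi M xi x)) \<and>
    mC holomorphic_on ball (of_real \<theta>) r"
proof -
  obtain r0 where r0: "r0 > 0" "\<And>x. \<bar>x - \<theta>\<bar> \<le> r0 \<Longrightarrow> fin x" using Dphi_nbhd[OF assms] by blast
  let ?S = "{z. \<theta> - r0 < Re z \<and> Re z < \<theta> + r0}"
  have hol: "mC holomorphic_on ?S" by (rule holomorphic_mC) (use r0 in auto)
  have sub: "ball (of_real \<theta>) r0 \<subseteq> ?S"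
  proof
    fix z assume "z \<in> ball (complex_of_real \<theta>) r0"
    then have "\<bar>Re (z - of_real \<theta>)\<bar> < r0"
      using abs_Re_le_cmod[of "z - of_real \<theta>"] by (simp add: dist_norm norm_minus_commute)
    then show "z \<in> ?S" by auto
  qed
  have "isCont mC (of_real \<theta>)"
    using holomorphic_on_imp_continuous_on[OF holomorphic_on_subset[OF hol sub]] r0
    by (simp add: continuous_on_eq_continuous_at)
  then have "isCont (\<lambda>z. Re (mC z)) (of_real \<theta>)" by (rule isCont_Re)
  moreover have "Re (mC (of_real \<theta>)) > 0" using mR_pos[OF r0(2)[of \<theta>]] r0 by (simp add: mC_of_real)
  ultimately have "\<forall>\<^sub>F z in at (of_real \<theta>). Re (mC z) > 0"
    unfolding isCont_def by (rule order_tendstoD)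
  then obtain d where d: "d > 0" "\<And>z. z \<noteq> of_real \<theta> \<Longrightarrow> dist z (of_real \<theta>) < d \<Longrightarrow> Re (mC z) > 0"
    unfolding eventually_at by auto
  define r where "r = min r0 d"
  have r: "r > 0" "r \<le> r0" "r \<le> d" using r0 d by (auto simp: r_def)
  have rpos: "Re (mC z) > 0" if "z \<in> ball (of_real \<theta>) r" for z
    using that d(2)[of z] \<open>Re (mC (of_real \<theta>)) > 0\<close> r by (cases "z = of_real \<theta>") (auto simp: dist_commute)
  have holr: "mC holomorphic_on ball (of_real \<theta>) r"
    by (rule holomorphic_on_subset[OF hol]) (use subset_ball[OF r(2)] sub in blast)
  show ?thesis
  proof (intro exI[of _ r] exI[of _ "\<lambda>z. Ln (mC z)"] conjI allI impI ballI)
    show "(\<lambda>z. Ln (mC z)) holomorphic_on ball (of_real \<theta>) r"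
    proof (rule holomorphic_on_Ln'[OF _ holr])
      show "\<And>z. z \<in> ball (of_real \<theta>) r \<Longrightarrow> mC z \<notin> \<real>\<^sub>\<le>\<^sub>0"
        using rpos by (force simp: complex_nonpos_Reals_iff)
    qed
    show "exp (Ln (mC z)) = mC z" if "z \<in> ball (of_real \<theta>) r" for z
      using rpos[OF that] by (intro exp_Ln) auto
    show fx: "fin x" if "\<bar>x - \<theta>\<bar> < r" for x using r0 r that by auto
    show "Ln (mC (of_real x)) = of_real (phi M xi x)" if "\<bar>x - \<theta>\<bar> < r" for x
      using mR_pos[OF fx[OF that]] phi_eq[OF fx[OF that]] by (simp add: mC_of_real Ln_of_real)
  qed (use r holr in auto)
qed

text \<open>If the second derivative were not positive, the Taylor expansion of \<open>log |m|\<close> in the imaginary direction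
  would contradict the quadratic gap provided by the two atoms.\<close>
lemma phi_second_deriv_pos:
  assumes \<theta>: "\<theta> \<in> Dphi M xi"
  shows "(deriv ^^ 2) (phi M xi) \<theta> > 0"
proof (rule ccontr)
  assume neg: "\<not> (deriv ^^ 2) (phi M xi) \<theta> > 0"
  obtain r F where r: "r > 0" and F: "F holomorphic_on ball (of_real \<theta>) r"
    and finx: "\<And>x. \<bar>x - \<theta>\<bar> < r \<Longrightarrow> fin x" and eF: "\<And>z. z \<in> ball (of_real \<theta>) r \<Longrightarrow> exp (F z) = mC z"
    and Fx: "\<And>x. \<bar>x - \<theta>\<bar> < r \<Longrightarrow> F (of_real x) = of_real (phi M xi x)"
    using log_mC[OF \<theta>] by blast
  define K3 where "K3 = (deriv ^^ 3) (phi M xi) \<theta>"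
  have dF: "(deriv ^^ j) F (of_real \<theta>) = of_real ((deriv ^^ j) (phi M xi) \<theta>)" for j
    by (rule deriv_of_real_part[OF F Fx]) (use r in auto)
  obtain K where K: "K \<ge> 0" "\<And>z. norm (z - of_real \<theta>) \<le> r / 2 \<Longrightarrow>
      norm (F z - (\<Sum>i\<le>3. (deriv ^^ i) F (of_real \<theta>) * (z - of_real \<theta>) ^ i / fact i)) \<le> K * norm (z - of_real \<theta>) ^ Suc 3"
    using holomorphic_taylor_bound[OF F, of "r / 2" 3] r by auto
  define c0 where "c0 = atom k1 \<theta> * atom k2 \<theta> / (atom k1 \<theta> + atom k2 \<theta>) / mR \<theta>"
  define d where "d = real_of_int k1 - real_of_int k2"
  have fin: "fin \<theta>" using fin_Dphi[OF \<theta>] .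
  have c0: "c0 > 0" using atoms mR_pos[OF fin] by (simp add: c0_def atom_def add_pos_pos)
  have d: "d \<noteq> 0" using k12 by (simp add: d_def)
  have main: "c0 * (1 - cos (d * \<eta>)) \<le> K * \<eta> ^ 4" if \<eta>: "0 < \<eta>" "\<eta> < r / 2" for \<eta>
  proof -
    let ?z = "Complex \<theta> \<eta>"
    have zd: "?z - of_real \<theta> = \<i> * of_real \<eta>" by (simp add: complex_eq_iff)
    have nz: "norm (?z - of_real \<theta>) = \<eta>" using \<eta> by (simp add: zd norm_mult)
    have zin: "?z \<in> ball (of_real \<theta>) r" using nz \<eta> by (simp add: dist_norm norm_minus_commute)
    let ?T = "\<Sum>i\<le>3. (deriv ^^ i) F (of_real \<theta>) * (?z - of_real \<theta>) ^ i / fact i"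
    \<comment> \<open>In the imaginary direction the odd Taylor terms are purely imaginary, so the
      real part sees only \<open>phi\<close> and its second derivative.\<close>
    have T: "Re ?T = phi M xi \<theta> - (deriv ^^ 2) (phi M xi) \<theta> * \<eta>\<^sup>2 / 2"
      unfolding zd dF by (simp add: eval_nat_numeral fact_numeral)
    have "phi M xi \<theta> - K * \<eta> ^ 4 \<le> Re ?T - K * \<eta> ^ 4"
      unfolding T using neg by (simp add: mult_nonpos_nonneg)
    also have "\<dots> \<le> Re (F ?z)"
      using K(2)[of ?z] nz \<eta> abs_Re_le_cmod[of "F ?z - ?T"] by simp
    finally have "exp (phi M xi \<theta> - K * \<eta> ^ 4) \<le> norm (mC ?z)"
      unfolding eF[OF zin, symmetric] norm_exp_eq_Re by simp
    also have "\<dots> \<le> mR \<theta> * (1 - c0 * (1 - cos (d * \<eta>)))"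
    proof -
      have "mR \<theta> * c0 = atom k1 \<theta> * atom k2 \<theta> / (atom k1 \<theta> + atom k2 \<theta>)"
        using mR_pos[OF fin] by (simp add: c0_def)
      then show ?thesis
        using mC_two_atoms[OF fin k12 atoms, of \<eta>]
        unfolding d_def[symmetric] right_diff_distrib[of "mR \<theta>"] mult.assoc[symmetric]
        by (simp add: mult.commute[of \<eta>])
    qed
    also have "exp (phi M xi \<theta> - K * \<eta> ^ 4) = mR \<theta> * exp (- (K * \<eta> ^ 4))"
      using mR_pos[OF fin] phi_eq[OF fin] by (simp add: exp_diff exp_minus field_simps)
    finally have "exp (- (K * \<eta> ^ 4)) \<le> 1 - c0 * (1 - cos (d * \<eta>))"
      using mR_pos[OF fin] by simp
    moreover have "1 - K * \<eta> ^ 4 \<le> exp (- (K * \<eta> ^ 4))" using exp_ge_add_one_self[of "- (K * \<eta> ^ 4)"] by simp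
    ultimately show ?thesis by simp
  qed
  \<comment> \<open>The gap is of exact order \<eta>^2, the Taylor error of order \<eta>^4; dividing
    by \<eta>^2 and letting \<eta> tend to 0 gives the contradiction.\<close>
  have "((\<lambda>\<eta>. (1 - cos (d * \<eta>)) / \<eta>\<^sup>2) \<longlongrightarrow> d * d / 2) (at_right 0)"
    using d by real_asymp
  then have l1: "((\<lambda>\<eta>. c0 * ((1 - cos (d * \<eta>)) / \<eta>\<^sup>2)) \<longlongrightarrow> c0 * (d\<^sup>2 / 2)) (at_right 0)"
    unfolding power2_eq_square by (rule tendsto_mult_left)
  have l2: "((\<lambda>\<eta>. K * \<eta>\<^sup>2) \<longlongrightarrow> 0) (at_right 0)" by real_asymp
  have "c0 * (d\<^sup>2 / 2) \<le> 0"
  proof (rule tendsto_le[OF _ l2 l1])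
    have "\<forall>\<^sub>F \<eta> in at_right 0. \<eta> \<in> {0<..<r / 2}" using r by (intro eventually_at_right_real) auto
    then show "\<forall>\<^sub>F \<eta> in at_right 0. c0 * ((1 - cos (d * \<eta>)) / \<eta>\<^sup>2) \<le> K * \<eta>\<^sup>2"
    proof eventually_elim
      case (elim \<eta>)
      then have "c0 * (1 - cos (d * \<eta>)) / \<eta>\<^sup>2 \<le> K * \<eta> ^ 4 / \<eta>\<^sup>2" using main by (intro divide_right_mono) auto
      also have "K * \<eta> ^ 4 / \<eta>\<^sup>2 = K * \<eta>\<^sup>2" using elim by (simp add: power4_eq_xxxx power2_eq_square)
      finally show ?case by simp
    qed
  qed simp
  moreover have "c0 * (d\<^sup>2 / 2) > 0" using c0 d by simp
  ultimately show False by simp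
qed

lemma phi_deriv:
  assumes "\<theta> \<in> Dphi M xi"
  shows "(phi M xi has_field_derivative deriv (phi M xi) \<theta>) (at \<theta>)"
    and "(deriv (phi M xi) has_field_derivative (deriv ^^ 2) (phi M xi) \<theta>) (at \<theta>)"
proof -
  obtain r F where r: "r > 0" and F: "F holomorphic_on ball (of_real \<theta>) r"
    and Fx: "\<And>x. \<bar>x - \<theta>\<bar> < r \<Longrightarrow> F (of_real x) = of_real (phi M xi x)"
    using log_mC[OF assms] by blast
  show "(phi M xi has_field_derivative deriv (phi M xi) \<theta>) (at \<theta>)"
    using deriv_of_real_part(2)[OF F Fx, of \<theta> 0] r by simp
  show "(deriv (phi M xi) has_field_derivative (deriv ^^ 2) (phi M xi) \<theta>) (at \<theta>)"
    using deriv_of_real_part(2)[OF F Fx, of \<theta> 1] r by (simp add: eval_nat_numeral)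
qed

text \<open>\<open>beta_minus\<close> and \<open>beta_plus\<close> are only an infimum and a
  supremum, so a point between them is not known beforehand to lie in \<open>beta_set\<close>; but
  it has members of that set on both sides.\<close>

lemma Ibeta_bracket:
  assumes "\<beta> \<in> Ibeta M xi"
  obtains b1 b2 where "b1 < \<beta>" "\<beta> < b2" "b1 \<in> beta_set M xi" "b2 \<in> beta_set M xi" "{b1<..<b2} \<subseteq> Ibeta M xi"
proof -
  have 1: "Inf (ereal ` beta_set M xi) < ereal \<beta>" and 2: "ereal \<beta> < Sup (ereal ` beta_set M xi)"
    using assms by (auto simp: Ibeta_def beta_minus_def beta_plus_def)
  obtain b1 where b1: "b1 \<in> beta_set M xi" "b1 < \<beta>" using 1 by (auto simp: Inf_less_iff)
  obtain b2 where b2: "b2 \<in> beta_set M xi" "\<beta> < b2" using 2 by (auto simp: less_Sup_iff)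
  have "{b1<..<b2} \<subseteq> Ibeta M xi"
  proof
    fix x assume x: "x \<in> {b1<..<b2}"
    have "beta_minus M xi \<le> ereal b1" "ereal b2 \<le> beta_plus M xi"
      using b1 b2 by (auto simp: beta_minus_def beta_plus_def intro!: Inf_lower Sup_upper)
    then show "x \<in> Ibeta M xi" using x unfolding Ibeta_def
      by (auto intro: le_less_trans[of _ "ereal b1"] less_le_trans[of _ "ereal b2"])
  qed
  then show ?thesis using that b1 b2 by blast
qed

text \<open>The function \<open>\<phi>(x) - x \<phi>'(x)\<close> has derivative \<open>- x \<phi>''(x)\<close>, so it is monotone on either side of 0.\<close>
lemma Ibeta_beta_set:
  assumes "\<beta> \<in> Ibeta M xi"
  shows "\<beta> \<in> Dphi M xi" "deriv (phi M xi) \<beta> * \<beta> < phi M xi \<beta>"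
proof -
  obtain b1 b2 where b: "b1 < \<beta>" "\<beta> < b2" "b1 \<in> beta_set M xi" "b2 \<in> beta_set M xi"
    using Ibeta_bracket[OF assms] by blast
  have D: "{b1..b2} \<subseteq> Dphi M xi" using b by (intro Dphi_conv) (auto simp: beta_set_def)
  then show "\<beta> \<in> Dphi M xi" using b by auto
  define g where "g x = phi M xi x - deriv (phi M xi) x * x" for x
  have g': "(g has_field_derivative - x * (deriv ^^ 2) (phi M xi) x) (at x)" if "x \<in> {b1..b2}" for x
    unfolding g_def using phi_deriv[of x] D that by (auto intro!: derivative_eq_intros)
  have "g \<beta> > 0"
  proof (cases "\<beta> \<ge> 0")
    case True
    have "g b2 \<le> g \<beta>"
    proof (rule DERIV_nonpos_imp_nonincreasing[of \<beta> b2])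
      fix x assume x: "\<beta> \<le> x" "x \<le> b2"
      then have "x \<in> {b1..b2}" using b by auto
      moreover have "- x * (deriv ^^ 2) (phi M xi) x \<le> 0"
        using phi_second_deriv_pos[of x] D \<open>x \<in> {b1..b2}\<close> x True
        by (intro mult_nonpos_nonneg) (auto intro: less_imp_le)
      ultimately show "\<exists>y. (g has_real_derivative y) (at x) \<and> y \<le> 0" using g' by blast
    qed (use b in auto)
    moreover have "g b2 > 0" using b by (simp add: beta_set_def g_def)
    ultimately show ?thesis by simp
  next
    case False
    have "g b1 \<le> g \<beta>"
    proof (rule DERIV_nonneg_imp_nondecreasing[of b1 \<beta>])
      fix x assume x: "b1 \<le> x" "x \<le> \<beta>"
      then have "x \<in> {b1..b2}" using b by auto
      moreover have "- x * (deriv ^^ 2) (phi M xi) x \<ge> 0"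
        using phi_second_deriv_pos[of x] D \<open>x \<in> {b1..b2}\<close> x False
        by (intro mult_nonneg_nonneg) (auto intro: less_imp_le)
      ultimately show "\<exists>y. (g has_real_derivative y) (at x) \<and> 0 \<le> y" using g' by blast
    qed (use b in auto)
    moreover have "g b1 > 0" using b by (simp add: beta_set_def g_def)
    ultimately show ?thesis by simp
  qed
  then show "deriv (phi M xi) \<beta> * \<beta> < phi M xi \<beta>" by (simp add: g_def)
qed

end

section \<open>Geometric convergence\<close>

context brw
begin

text \<open>Needed to exchange expectation with integrals over the circle and over the line. It
  suffices to treat each of the countably many configurations separately.\<close>

lemma psum_joint_measurable:
  assumes \<gamma>: "\<gamma> \<in> borel_measurable lborel"
  shows "(\<lambda>x. psum (\<gamma> (snd x)) (particles xi n (fst x))) \<in> borel_measurable (M \<Otimes>\<^sub>M lborel)"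
proof (rule measurable_compose_countable'[where f = "\<lambda>P x. psum (\<gamma> (snd x)) P" and I = "gens n" and g = "\<lambda>x. particles xi n (fst x)"])
  fix P
  have "(\<lambda>t. psum (\<gamma> t) P) \<in> borel_measurable lborel"
    unfolding psum_def using \<gamma> by measurable
  then show "(\<lambda>x. psum (\<gamma> (snd x)) P) \<in> borel_measurable (M \<Otimes>\<^sub>M lborel)"
    by (rule measurable_compose[OF measurable_snd])
  show "(\<lambda>x. particles xi n (fst x)) \<in> M \<Otimes>\<^sub>M lborel \<rightarrow>\<^sub>M count_space (gens n)"
    by (rule measurable_compose[OF measurable_fst particles_meas])
qed (rule countable_gens)

lemma psum_increment_measurable:
  "(\<lambda>w. ennreal (norm (psum z (particles xi (Suc n) w) - c * psum z (particles xi n w)))) \<in> borel_measurable M"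
proof -
  have 1: "(\<lambda>w. psum z (particles xi n w)) \<in> borel_measurable M" for n by (rule psum_meas)
  have "(\<lambda>w. psum z (particles xi (Suc n) w) - c * psum z (particles xi n w)) \<in> borel_measurable M"
    by (intro borel_measurable_diff borel_measurable_times 1 borel_measurable_const)
  then show ?thesis by (rule measurable_compose[where g = "\<lambda>x. ennreal (norm x)"]) simp
qed

lemma nn_integral_swap_lborel:
  fixes f :: "'a \<Rightarrow> real \<Rightarrow> ennreal"
  assumes "(\<lambda>x. f (fst x) (snd x)) \<in> borel_measurable (M \<Otimes>\<^sub>M lborel)"
  shows "(\<integral>\<^sup>+w. (\<integral>\<^sup>+t. f w t \<partial>lborel) \<partial>M) = (\<integral>\<^sup>+t. (\<integral>\<^sup>+w. f w t \<partial>M) \<partial>lborel)"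
proof -
  interpret L: pair_sigma_finite M "lborel :: real measure" ..
  show ?thesis using L.Fubini'[of f] assms by (simp add: case_prod_unfold)
qed

end

text \<open>Estimates are required up to distance \<open>r\<close> from \<beta> and holomorphy up to
  \<open>2 * r\<close>, so that Cauchy's formula is available on the circle of radius
  \<open>r\<close>. In \<open>ratio\<close> the modulus |m(z)| appears rather than m(Re z), because
  the martingale at complex z is normalised by m(z).\<close>

locale brw_local = brw_nd +
  fixes \<beta> r p q C :: real
  assumes r: "0 < r" and p: "1 < p" "p \<le> 2" and q: "0 < q" "q < 1"
    and fin: "\<And>x. \<bar>x - \<beta>\<bar> \<le> r \<Longrightarrow> fin x" and finp: "\<And>x. \<bar>x - \<beta>\<bar> \<le> r \<Longrightarrow> fin (p * x)"
    and moment: "\<And>x. \<bar>x - \<beta>\<bar> \<le> r \<Longrightarrow> integrable M (\<lambda>w. lsumr x (xi [] w) powr p)"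
      "\<And>x. \<bar>x - \<beta>\<bar> \<le> r \<Longrightarrow> (\<integral>w. lsumr x (xi [] w) powr p \<partial>M) \<le> C"
    and mC0: "\<And>z. z \<in> ball (of_real \<beta>) (2 * r) \<Longrightarrow> mC z \<noteq> 0"
    and mC_hol: "mC holomorphic_on ball (of_real \<beta>) (2 * r)"
    and ratio: "\<And>z. z \<in> cball (of_real \<beta>) r \<Longrightarrow> mR (p * Re z) \<le> norm (mC z) powr p * q\<^sup>2"
begin

lemma C0: "C \<ge> 0"
  using moment(2)[of \<beta>] r by (intro order_trans[OF _ moment(2)[of \<beta>]]) (auto simp: Bochner_Integration.integral_nonneg)

lemma Re_cball: "z \<in> cball (of_real \<beta>) r \<Longrightarrow> \<bar>Re z - \<beta>\<bar> \<le> r"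
  using abs_Re_le_cmod[of "z - of_real \<beta>"] by (simp add: dist_norm norm_minus_commute)

definition Wz :: "nat \<Rightarrow> complex \<Rightarrow> 'a \<Rightarrow> complex" where
  "Wz n z w = psum z (particles xi n w) / mC z ^ n"

lemma Wz_hol: "(\<lambda>z. Wz n z w) holomorphic_on ball (of_real \<beta>) (2 * r)"
  unfolding Wz_def psum_def using mC0 by (intro holomorphic_intros mC_hol) auto

text \<open>One null set has to serve all z. The L^1 increments are therefore averaged over the
  circle of radius \<open>r\<close>, which gives a single sequence of random variables with
  geometrically small means. Almost surely it decays geometrically, and Cauchy's formula turns this
  into a uniform bound on the disc of radius \<open>r / 2\<close>.\<close>

lemma AE_uniform_convergence:
  "\<exists>\<rho>. 0 < \<rho> \<and> \<rho> < 1 \<and> (AE w in M. \<exists>W K. W holomorphic_on ball (of_real \<beta>) (r / 2) \<and>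
     (\<forall>n. \<forall>z\<in>ball (of_real \<beta>) (r / 2). norm (Wz n z w - W z) \<le> K * \<rho> ^ n))"
proof -
  let ?\<gamma> = "circlepath (of_real \<beta>) r"
  \<comment> \<open>Any rate strictly between \<open>q\<close> and 1: passing from expectations to
    almost sure bounds costs a little of the rate.\<close>
  define \<rho> where "\<rho> = (1 + q) / 2"
  have \<rho>: "q < \<rho>" "0 < \<rho>" "\<rho> < 1" using q by (auto simp: \<rho>_def)
  have \<gamma>in: "norm (?\<gamma> t - of_real \<beta>) = r" for t
    using r by (simp add: circlepath norm_mult)
  have \<gamma>c: "?\<gamma> t \<in> cball (of_real \<beta>) r" for t using \<gamma>in[of t] by (simp add: dist_norm norm_minus_commute)
  have \<gamma>b: "?\<gamma> t \<in> ball (of_real \<beta>) (2 * r)" for t using \<gamma>in[of t] r by (simp add: dist_norm norm_minus_commute)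
  have \<gamma>cont: "continuous_on UNIV ?\<gamma>"
    unfolding circlepath by (intro continuous_intros)
  have \<gamma>m: "?\<gamma> \<in> borel_measurable lborel" using borel_measurable_continuous_onI[OF \<gamma>cont] by simp
  have "continuous_on UNIV (\<lambda>t. mC (?\<gamma> t))"
    by (rule continuous_on_compose2[OF holomorphic_on_imp_continuous_on[OF mC_hol] \<gamma>cont]) (use \<gamma>b in auto)
  then have mCm: "(\<lambda>t. mC (?\<gamma> t)) \<in> borel_measurable lborel" using borel_measurable_continuous_onI by simp
  \<comment> \<open>The normalisation m(z)^(n+1) leaves one factor 1 / |m(z)| beyond the bound
    |m(z)|^n of the increment; the minimum modulus controls it uniformly.\<close>
  obtain m0 where m0: "m0 > 0" "\<And>z. z \<in> cball (of_real \<beta>) r \<Longrightarrow> m0 \<le> norm (mC z)"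
  proof -
    have sub: "cball (complex_of_real \<beta>) r \<subseteq> ball (of_real \<beta>) (2 * r)" using r by auto
    have "continuous_on (cball (of_real \<beta>) r) (\<lambda>z. norm (mC z))"
      using holomorphic_on_imp_continuous_on[OF mC_hol] continuous_on_subset[OF _ sub] by (intro continuous_on_norm) blast
    moreover have "compact (cball (complex_of_real \<beta>) r)" "cball (complex_of_real \<beta>) r \<noteq> {}" using r by auto
    ultimately obtain y where y: "y \<in> cball (of_real \<beta>) r" "\<And>z. z \<in> cball (of_real \<beta>) r \<Longrightarrow> norm (mC y) \<le> norm (mC z)"
      using continuous_attains_inf[of "cball (complex_of_real \<beta>) r" "\<lambda>z. norm (mC z)"] by blast
    have "norm (mC y) > 0" using mC0[of y] y sub by auto
    then show ?thesis using that[of "norm (mC y)"] y by blast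
  qed
  define D where "D n t w = ennreal (norm (Wz (Suc n) (?\<gamma> t) w - Wz n (?\<gamma> t) w) * indicator {0..1} t)" for n t w
  define X where "X n w = (\<integral>\<^sup>+t. D n t w \<partial>lborel)" for n w
  have Dm: "(\<lambda>x. D n (snd x) (fst x)) \<in> borel_measurable (M \<Otimes>\<^sub>M lborel)" for n
  proof -
    note psum_joint_measurable[OF \<gamma>m, measurable]
    have [measurable]: "(\<lambda>x. mC (?\<gamma> (snd x))) \<in> borel_measurable (M \<Otimes>\<^sub>M lborel)"
      by (rule measurable_compose[OF measurable_snd mCm])
    show ?thesis unfolding D_def Wz_def by measurable
  qed
  have Xm: "X n \<in> borel_measurable M" for n
  proof -
    have "(\<lambda>w. \<integral>\<^sup>+t. (\<lambda>x. D n (snd x) (fst x)) (w, t) \<partial>lborel) \<in> borel_measurable M"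
      by (rule lborel.borel_measurable_nn_integral_fst[OF Dm])
    then show ?thesis by (simp add: X_def[abs_def])
  qed
  have XE: "(\<integral>\<^sup>+w. X n w \<partial>M) \<le> ennreal ((3 * C + 1) / m0 * q ^ n)" for n
  proof -
    have "(\<integral>\<^sup>+w. X n w \<partial>M) = (\<integral>\<^sup>+t. (\<integral>\<^sup>+w. D n t w \<partial>M) \<partial>lborel)"
      unfolding X_def by (rule nn_integral_swap_lborel[OF Dm])
    also have "\<dots> \<le> (\<integral>\<^sup>+t. ennreal ((3 * C + 1) / m0 * q ^ n) * indicator {0..1::real} t \<partial>lborel)"
    proof (rule nn_integral_mono)
      fix t
      let ?z = "?\<gamma> t"
      let ?m = "norm (mC ?z)"
      have m: "?m > 0" "m0 \<le> ?m" using order.strict_trans2[OF m0(1) m0(2)[OF \<gamma>c[of t]]] m0(2)[OF \<gamma>c[of t]] by auto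
      have zb: "\<bar>Re ?z - \<beta>\<bar> \<le> r" by (rule Re_cball[OF \<gamma>c])
      have eq: "Wz (Suc n) ?z w - Wz n ?z w = (psum ?z (particles xi (Suc n) w) - mC ?z * psum ?z (particles xi n w)) / mC ?z ^ Suc n" for w
        unfolding Wz_def using m by (simp add: diff_divide_distrib del: particles.simps)
      have D: "D n t w = ennreal (norm (psum ?z (particles xi (Suc n) w) - mC ?z * psum ?z (particles xi n w))) * ennreal (indicator {0..1} t / ?m ^ Suc n)" for w
        unfolding D_def eq norm_divide norm_power by (subst ennreal_mult[symmetric]) (auto simp del: particles.simps)
      have "(\<integral>\<^sup>+w. D n t w \<partial>M) = (\<integral>\<^sup>+w. ennreal (norm (psum ?z (particles xi (Suc n) w) - mC ?z * psum ?z (particles xi n w))) \<partial>M) * ennreal (indicator {0..1} t / ?m ^ Suc n)"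
        unfolding D by (rule nn_integral_multc[OF psum_increment_measurable])
      also have "\<dots> \<le> ennreal (?m ^ n * (3 * C + 1) * q ^ n) * ennreal (indicator {0..1} t / ?m ^ Suc n)"
        by (intro mult_right_mono increment_bound[OF fin[OF zb] finp[OF zb] p moment[OF zb]] ratio \<gamma>c)
           (use m q in auto)
      also have "\<dots> = ennreal ((3 * C + 1) / ?m * q ^ n * indicator {0..1} t)"
        using m q C0 by (subst ennreal_mult[symmetric]) (auto simp: field_simps)
      also have "\<dots> \<le> ennreal ((3 * C + 1) / m0 * q ^ n * indicator {0..1} t)"
        using m m0 q C0 by (intro ennreal_leI mult_right_mono divide_left_mono mult_pos_pos) auto
      also have "\<dots> = ennreal ((3 * C + 1) / m0 * q ^ n) * indicator {0..1} t"
        by (simp split: split_indicator)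
      finally show "(\<integral>\<^sup>+w. D n t w \<partial>M) \<le> ennreal ((3 * C + 1) / m0 * q ^ n) * indicator {0..1} t" .
    qed
    also have "\<dots> = ennreal ((3 * C + 1) / m0 * q ^ n)"
      by (subst nn_integral_cmult) auto
    finally show ?thesis .
  qed
  have "AE w in M. \<exists>K\<ge>0. \<forall>n. X n w \<le> ennreal (K * \<rho> ^ n)"
    by (rule AE_geometric_bound[OF Xm XE]) (use q \<rho> C0 m0 in auto)
  then have "AE w in M. \<exists>W K. W holomorphic_on ball (of_real \<beta>) (r / 2) \<and>
     (\<forall>n. \<forall>z\<in>ball (of_real \<beta>) (r / 2). norm (Wz n z w - W z) \<le> K * \<rho> ^ n)"
  proof eventually_elim
    case (elim w)
    then obtain K where K: "K \<ge> 0" "\<And>n. X n w \<le> ennreal (K * \<rho> ^ n)" by blast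
    let ?B = "ball (complex_of_real \<beta>) (r / 2)"
    have step: "norm (Wz (Suc n) z w - Wz n z w) \<le> 2 * K * \<rho> ^ n" if z: "z \<in> ?B" for n z
    proof -
      have "norm (Wz (Suc n) z w - Wz n z w) \<le> 2 * (K * \<rho> ^ n)"
      proof (rule holomorphic_bound_circle[where f = "\<lambda>z. Wz (Suc n) z w - Wz n z w" and S = "ball (of_real \<beta>) (2 * r)" and ?z0.0 = "of_real \<beta>" and r = r])
        show "(\<lambda>z. Wz (Suc n) z w - Wz n z w) holomorphic_on ball (of_real \<beta>) (2 * r)"
          by (intro holomorphic_on_diff Wz_hol)
        show "(\<integral>\<^sup>+t. ennreal (norm (Wz (Suc n) (?\<gamma> t) w - Wz n (?\<gamma> t) w) * indicator {0..1} t) \<partial>lborel) \<le> ennreal (K * \<rho> ^ n)"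
          using K(2)[of n] unfolding X_def D_def .
        show "norm (z - of_real \<beta>) \<le> r / 2" using z by (simp add: dist_norm norm_minus_commute)
      qed (use r K \<rho> in auto)
      then show ?thesis by simp
    qed
    define W where "W z = 1 + (\<Sum>n. Wz (Suc n) z w - Wz n z w)" for z
    have W0: "Wz 0 z w = 1" for z by (simp add: Wz_def psum_def)
    have tel: "Wz n z w = 1 + (\<Sum>i<n. Wz (Suc i) z w - Wz i z w)" for n z
      using sum_lessThan_telescope[of "\<lambda>i. Wz i z w" n] W0[of z] by (simp add: algebra_simps)
    have sg: "summable (\<lambda>n. 2 * K * \<rho> ^ n)" using \<rho> by (intro summable_mult summable_geometric) auto
    have bound: "norm (Wz n z w - W z) \<le> 2 * K / (1 - \<rho>) * \<rho> ^ n" if z: "z \<in> ?B" for n z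
    proof -
      let ?d = "\<lambda>i. Wz (Suc i) z w - Wz i z w"
      have sd: "summable (\<lambda>i. norm (?d i))"
        by (rule summable_comparison_test'[OF sg, of 0]) (use step[OF z] in auto)
      have sd': "summable (\<lambda>i. norm (?d (i + n)))" using sd by (rule summable_ignore_initial_segment)
      have sg': "summable (\<lambda>i. 2 * K * \<rho> ^ n * \<rho> ^ i)" using \<rho> by (intro summable_mult summable_geometric) auto
      have "(\<Sum>i. ?d i) = (\<Sum>i. ?d (i + n)) + (\<Sum>i<n. ?d i)"
        by (rule suminf_split_initial_segment[OF summable_norm_cancel[OF sd]])
      then have "norm (Wz n z w - W z) = norm (\<Sum>i. ?d (i + n))"
        unfolding W_def tel[of n z] by (simp add: norm_minus_commute)
      also have "\<dots> \<le> (\<Sum>i. norm (?d (i + n)))" by (rule summable_norm[OF sd'])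
      also have "\<dots> \<le> (\<Sum>i. 2 * K * \<rho> ^ n * \<rho> ^ i)"
      proof (rule suminf_le[OF _ sd' sg'])
        show "norm (?d (i + n)) \<le> 2 * K * \<rho> ^ n * \<rho> ^ i" for i
          using step[OF z, of "i + n"] by (simp add: power_add mult_ac)
      qed
      also have "\<dots> = 2 * K * \<rho> ^ n * (1 / (1 - \<rho>))"
        using \<rho> by (subst suminf_mult) (auto simp: suminf_geometric summable_geometric)
      finally show ?thesis by simp
    qed
    have "W holomorphic_on ?B"
    proof (rule holomorphic_uniform_sequence[OF open_ball, where f = "\<lambda>n z. Wz n z w"])
      fix x assume x: "x \<in> ?B"
      then obtain d where d: "d > 0" "cball x d \<subseteq> ?B" using open_contains_cball open_ball by blast
      have "uniform_limit (cball x d) (\<lambda>n z. Wz n z w) W sequentially"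
      proof (rule uniform_limitI)
        fix e :: real assume e: "e > 0"
        have "(\<lambda>n. 2 * K / (1 - \<rho>) * \<rho> ^ n) \<longlonglongrightarrow> 2 * K / (1 - \<rho>) * 0"
          using \<rho> by (intro tendsto_mult_left LIMSEQ_realpow_zero) auto
        then have "\<forall>\<^sub>F n in sequentially. 2 * K / (1 - \<rho>) * \<rho> ^ n < e" using e by (simp add: order_tendstoD)
        then show "\<forall>\<^sub>F n in sequentially. \<forall>z\<in>cball x d. dist (Wz n z w) (W z) < e"
        proof eventually_elim
          case (elim n)
          show ?case
          proof
            fix z assume "z \<in> cball x d"
            then have "z \<in> ?B" using d by blast
            then show "dist (Wz n z w) (W z) < e" using bound[of z n] elim unfolding dist_norm by linarith
          qed
        qed
      qed
      then show "\<exists>d>0. cball x d \<subseteq> ?B \<and> uniform_limit (cball x d) (\<lambda>n z. Wz n z w) W sequentially" using d by blast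
    next
      show "(\<lambda>z. Wz n z w) holomorphic_on ?B" for n
        by (rule holomorphic_on_subset[OF Wz_hol]) (use r in auto)
    qed
    then show ?case using bound by blast
  qed
  then show ?thesis using \<rho> by blast
qed

section \<open>Decay along the vertical line, away from the real axis\<close>

text \<open>On the line |m(\<beta> + i\<eta>)| may be small or even 0, so normalising by it is not
  possible. Measured against m(\<beta>)^n the increments are geometrically small uniformly in
  \<eta>, by the ratio condition at \<beta> alone.\<close>

lemma increment_beta_line:
  "(\<integral>\<^sup>+w. ennreal (norm (psum (Complex \<beta> \<eta>) (particles xi (Suc n) w) - mC (Complex \<beta> \<eta>) * psum (Complex \<beta> \<eta>) (particles xi n w))) \<partial>M)
     \<le> ennreal (mR \<beta> ^ n * (3 * C + 1) * q ^ n)"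
proof (rule increment_bound[where p = p])
  have b: "\<bar>\<beta> - \<beta>\<bar> \<le> r" using r by simp
  have m: "mR \<beta> > 0" using mR_pos fin[OF b] by blast
  show "fin (Re (Complex \<beta> \<eta>))" "fin (p * Re (Complex \<beta> \<eta>))" using fin[OF b] finp[OF b] by auto
  show "integrable M (\<lambda>w. lsumr (Re (Complex \<beta> \<eta>)) (xi [] w) powr p)" "(\<integral>w. lsumr (Re (Complex \<beta> \<eta>)) (xi [] w) powr p \<partial>M) \<le> C"
    using moment[OF b] by auto
  show "mR (p * Re (Complex \<beta> \<eta>)) \<le> mR \<beta> powr p * q\<^sup>2"
    using ratio[of "of_real \<beta>"] r m by (simp add: mC_of_real)
qed (use p q mR_pos fin r in auto)

text \<open>Induction along E|Z_(n+1)| \<le> E|Z_(n+1) - m Z_n| + |m| E|Z_n|. The rate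
  \<open>s\<close> exceeds \<rho>, and \<open>L\<close> is so large that the surplus
  \<open>L * (mR \<beta> * (s - \<rho>))\<close> absorbs the constant 3 C + 1 of the increments; the
  summand 1 in \<open>L\<close> serves n = 0.\<close>

lemma tail_expectation:
  assumes \<rho>: "0 \<le> \<rho>" "\<rho> < s" "q \<le> s" "s < 1" and le: "norm (mC (Complex \<beta> \<eta>)) \<le> \<rho> * mR \<beta>"
    and L: "L = 1 + (3 * C + 1) / (mR \<beta> * (s - \<rho>))"
  shows "(\<integral>\<^sup>+w. ennreal (norm (psum (Complex \<beta> \<eta>) (particles xi n w))) \<partial>M) \<le> ennreal (L * mR \<beta> ^ n * s ^ n)"
proof (induction n)
  have m: "mR \<beta> > 0" using mR_pos fin[of \<beta>] r by simp
  have L1: "L \<ge> 1" using L m C0 \<rho> by simp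
  case 0
  show ?case using L1 by (simp add: psum_0 emeasure_space_1 del: particles.simps)
next
  case (Suc n)
  let ?z = "Complex \<beta> \<eta>"
  have m: "mR \<beta> > 0" using mR_pos fin[of \<beta>] r by simp
  have L1: "L \<ge> 1" using L m C0 \<rho> by simp
  have "(\<integral>\<^sup>+w. ennreal (norm (psum ?z (particles xi (Suc n) w))) \<partial>M) \<le>
    (\<integral>\<^sup>+w. ennreal (norm (psum ?z (particles xi (Suc n) w) - mC ?z * psum ?z (particles xi n w)))
       + ennreal (norm (mC ?z)) * ennreal (norm (psum ?z (particles xi n w))) \<partial>M)"
  proof (rule nn_integral_mono)
    fix w
    have "norm (psum ?z (particles xi (Suc n) w)) \<le> norm (psum ?z (particles xi (Suc n) w) - mC ?z * psum ?z (particles xi n w))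
       + norm (mC ?z) * norm (psum ?z (particles xi n w))"
      using norm_triangle_sub[of "psum ?z (particles xi (Suc n) w)" "mC ?z * psum ?z (particles xi n w)"]
      by (simp add: norm_mult del: particles.simps)
    then have "ennreal (norm (psum ?z (particles xi (Suc n) w))) \<le> ennreal (norm (psum ?z (particles xi (Suc n) w) - mC ?z * psum ?z (particles xi n w))
       + norm (mC ?z) * norm (psum ?z (particles xi n w)))" by (rule ennreal_leI)
    then show "ennreal (norm (psum ?z (particles xi (Suc n) w))) \<le> ennreal (norm (psum ?z (particles xi (Suc n) w) - mC ?z * psum ?z (particles xi n w)))
       + ennreal (norm (mC ?z)) * ennreal (norm (psum ?z (particles xi n w)))"
      by (simp add: ennreal_mult del: particles.simps)
  qed
  also have "\<dots> = (\<integral>\<^sup>+w. ennreal (norm (psum ?z (particles xi (Suc n) w) - mC ?z * psum ?z (particles xi n w))) \<partial>M)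
       + ennreal (norm (mC ?z)) * (\<integral>\<^sup>+w. ennreal (norm (psum ?z (particles xi n w))) \<partial>M)"
  proof -
    have 1: "(\<lambda>w. ennreal (norm (psum ?z (particles xi (Suc n) w) - mC ?z * psum ?z (particles xi n w)))) \<in> borel_measurable M"
      by (rule psum_increment_measurable)
    have 2: "(\<lambda>w. ennreal (norm (psum ?z (particles xi n w)))) \<in> borel_measurable M"
      by (rule psum_meas)
    have 3: "(\<lambda>w. ennreal (norm (mC ?z)) * ennreal (norm (psum ?z (particles xi n w)))) \<in> borel_measurable M"
      by (intro borel_measurable_times_ennreal borel_measurable_const 2)
    show ?thesis unfolding nn_integral_add[OF 1 3] nn_integral_cmult[OF 2] ..
  qed
  also have "\<dots> \<le> ennreal (mR \<beta> ^ n * (3 * C + 1) * q ^ n) + ennreal (\<rho> * mR \<beta>) * ennreal (L * mR \<beta> ^ n * s ^ n)"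
    by (intro add_mono mult_mono increment_beta_line Suc ennreal_leI le) auto
  also have "\<dots> = ennreal (mR \<beta> ^ n * (3 * C + 1) * q ^ n + \<rho> * mR \<beta> * (L * mR \<beta> ^ n * s ^ n))"
    using m q \<rho> L1 C0 by (simp add: ennreal_mult ennreal_plus)
  also have "\<dots> \<le> ennreal (L * mR \<beta> ^ Suc n * s ^ Suc n)"
  proof (rule ennreal_leI)
    have "(3 * C + 1) * q ^ n \<le> (3 * C + 1) * s ^ n"
      using q \<rho> C0 by (intro mult_left_mono power_mono) auto
    also have "\<dots> \<le> L * (mR \<beta> * (s - \<rho>)) * s ^ n"
    proof (rule mult_right_mono)
      have pos: "mR \<beta> * (s - \<rho>) > 0" using m \<rho> by simp
      then have "(3 * C + 1) / (mR \<beta> * (s - \<rho>)) * (mR \<beta> * (s - \<rho>)) = 3 * C + 1"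
        by (intro nonzero_divide_eq_eq[THEN iffD1, symmetric]) auto
      then have "L * (mR \<beta> * (s - \<rho>)) = mR \<beta> * (s - \<rho>) + (3 * C + 1)"
        unfolding L distrib_right by simp
      then show "3 * C + 1 \<le> L * (mR \<beta> * (s - \<rho>))" using pos by simp
    qed (use \<rho> in auto)
    finally have "mR \<beta> ^ n * ((3 * C + 1) * q ^ n) \<le> mR \<beta> ^ n * (L * (mR \<beta> * (s - \<rho>)) * s ^ n)"
      using m by (intro mult_left_mono) auto
    then show "mR \<beta> ^ n * (3 * C + 1) * q ^ n + \<rho> * mR \<beta> * (L * mR \<beta> ^ n * s ^ n) \<le> L * mR \<beta> ^ Suc n * s ^ Suc n"
      by (simp add: algebra_simps)
  qed
  finally show ?case .
qed

lemma line_continuous: "continuous_on UNIV (\<lambda>\<eta>. mC (Complex \<beta> \<eta>))"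
proof (rule continuous_on_compose2[of "{z. \<beta> - r < Re z \<and> Re z < \<beta> + r}" mC])
  show "continuous_on {z. \<beta> - r < Re z \<and> Re z < \<beta> + r} mC"
    by (intro holomorphic_on_imp_continuous_on holomorphic_mC fin) (use r in auto)
  show "continuous_on UNIV (Complex \<beta>)" unfolding Complex_eq by (intro continuous_intros)
qed (use r in auto)

lemma Complex_line_measurable: "Complex \<beta> \<in> borel_measurable lborel"
proof -
  have "continuous_on UNIV (Complex \<beta>)" unfolding Complex_eq by (intro continuous_intros)
  then show ?thesis using borel_measurable_continuous_onI by simp
qed

text \<open>The set \<delta> \<le> |\<eta>| \<le> \<pi> is compact, so the strict inequality
  improves to a single factor \<rho> < 1. Integrating over \<eta> before passing to almost sure
  statements makes one null set suffice.\<close>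

lemma AE_tail_bound:
  assumes \<delta>: "0 < \<delta>" "\<delta> \<le> pi"
    and strict: "\<And>\<eta>. \<delta> \<le> \<bar>\<eta>\<bar> \<Longrightarrow> \<bar>\<eta>\<bar> \<le> pi \<Longrightarrow> norm (mC (Complex \<beta> \<eta>)) < mR \<beta>"
  shows "\<exists>s \<rho>. 0 < s \<and> s < 1 \<and> 0 \<le> \<rho> \<and> \<rho> < 1 \<and> (\<forall>\<eta>. \<delta> \<le> \<bar>\<eta>\<bar> \<and> \<bar>\<eta>\<bar> \<le> pi \<longrightarrow> norm (mC (Complex \<beta> \<eta>)) \<le> \<rho> * mR \<beta>) \<and>
    (AE w in M. \<exists>K\<ge>0. \<forall>n. (\<integral>\<^sup>+\<eta>. ennreal (norm (psum (Complex \<beta> \<eta>) (particles xi n w)) * indicator {\<eta>. \<delta> \<le> \<bar>\<eta>\<bar> \<and> \<bar>\<eta>\<bar> \<le> pi} \<eta>) \<partial>lborel)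
       \<le> ennreal (K * (mR \<beta> * s) ^ n))"
proof -
  let ?A = "{\<eta>. \<delta> \<le> \<bar>\<eta>\<bar> \<and> \<bar>\<eta>\<bar> \<le> pi}"
  have m: "mR \<beta> > 0" using mR_pos fin[of \<beta>] r by simp
  have A: "?A = {-pi..-\<delta>} \<union> {\<delta>..pi}" using \<delta> by auto
  have "compact ?A" "?A \<noteq> {}" unfolding A using \<delta> by auto
  moreover have "continuous_on ?A (\<lambda>\<eta>. norm (mC (Complex \<beta> \<eta>)))"
    using line_continuous continuous_on_subset by (intro continuous_on_norm) blast
  ultimately obtain \<eta>0 where \<eta>0: "\<eta>0 \<in> ?A" "\<And>\<eta>. \<eta> \<in> ?A \<Longrightarrow> norm (mC (Complex \<beta> \<eta>)) \<le> norm (mC (Complex \<beta> \<eta>0))"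
    using continuous_attains_sup[of ?A "\<lambda>\<eta>. norm (mC (Complex \<beta> \<eta>))"] by blast
  define \<rho> where "\<rho> = norm (mC (Complex \<beta> \<eta>0)) / mR \<beta>"
  have \<rho>: "0 \<le> \<rho>" "\<rho> < 1" using m strict[of \<eta>0] \<eta>0 by (auto simp: \<rho>_def)
  have \<rho>le: "norm (mC (Complex \<beta> \<eta>)) \<le> \<rho> * mR \<beta>" if "\<eta> \<in> ?A" for \<eta>
    using \<eta>0(2)[OF that] m by (simp add: \<rho>_def)
  \<comment> \<open>\<open>s\<close> lies above both \<open>q\<close> and \<rho>, as the recursion
    requires; \<open>s'\<close> leaves room for the almost sure bound.\<close>
  define s where "s = (1 + max q \<rho>) / 2"
  define s' where "s' = (1 + s) / 2"
  have s: "q \<le> s" "\<rho> < s" "s < 1" "0 < s" "s < s'" "s' < 1" "0 < s'"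
    using q \<rho> by (auto simp: s_def s'_def max_def field_simps add_pos_pos)
  define L where "L = 1 + (3 * C + 1) / (mR \<beta> * (s - \<rho>))"
  have L0: "L \<ge> 0" unfolding L_def using m s C0 by simp
  define D where "D n \<eta> w = ennreal (norm (psum (Complex \<beta> \<eta>) (particles xi n w)) * indicator ?A \<eta>)" for n \<eta> w
  define X where "X n w = (\<integral>\<^sup>+\<eta>. D n \<eta> w \<partial>lborel)" for n w
  have Am: "?A \<in> sets borel" unfolding A by auto
  have Dm: "(\<lambda>x. D n (snd x) (fst x)) \<in> borel_measurable (M \<Otimes>\<^sub>M lborel)" for n
  proof -
    note psum_joint_measurable[OF Complex_line_measurable, measurable] Am[measurable]
    show ?thesis unfolding D_def by measurable
  qed
  have Xm: "X n \<in> borel_measurable M" for n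
  proof -
    have "(\<lambda>w. \<integral>\<^sup>+t. (\<lambda>x. D n (snd x) (fst x)) (w, t) \<partial>lborel) \<in> borel_measurable M"
      by (rule lborel.borel_measurable_nn_integral_fst[OF Dm])
    then show ?thesis by (simp add: X_def[abs_def])
  qed
  have XE: "(\<integral>\<^sup>+w. X n w \<partial>M) \<le> ennreal (L * (2 * pi) * (mR \<beta> * s) ^ n)" for n
  proof -
    have "(\<integral>\<^sup>+w. X n w \<partial>M) = (\<integral>\<^sup>+\<eta>. (\<integral>\<^sup>+w. D n \<eta> w \<partial>M) \<partial>lborel)"
      unfolding X_def by (rule nn_integral_swap_lborel[OF Dm])
    also have "\<dots> \<le> (\<integral>\<^sup>+\<eta>. ennreal (L * mR \<beta> ^ n * s ^ n) * indicator {-pi..pi} \<eta> \<partial>lborel)"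
    proof (rule nn_integral_mono)
      fix \<eta> :: real
      show "(\<integral>\<^sup>+w. D n \<eta> w \<partial>M) \<le> ennreal (L * mR \<beta> ^ n * s ^ n) * indicator {-pi..pi} \<eta>"
      proof (cases "\<eta> \<in> ?A")
        case True
        then have i: "indicator ?A \<eta> = (1 :: real)" "indicator {-pi..pi} \<eta> = (1 :: ennreal)"
          by (auto simp: indicator_def abs_le_iff)
        show ?thesis unfolding D_def i mult_1_right
          by (rule tail_expectation[OF \<rho>(1) s(2) s(1) s(3) \<rho>le[OF True] L_def])
      next
        case False
        then have i: "indicator ?A \<eta> = (0 :: real)" by simp
        show ?thesis unfolding D_def i by simp
      qed
    qed
    also have "\<dots> = ennreal (L * mR \<beta> ^ n * s ^ n) * ennreal (2 * pi)"
      by (subst nn_integral_cmult) auto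
    also have "\<dots> = ennreal (L * (2 * pi) * (mR \<beta> * s) ^ n)"
      using L0 m s by (subst ennreal_mult[symmetric]) (auto simp: power_mult_distrib mult_ac)
    finally show ?thesis .
  qed
  have "AE w in M. \<exists>K\<ge>0. \<forall>n. X n w \<le> ennreal (K * (mR \<beta> * s') ^ n)"
    by (rule AE_geometric_bound[OF Xm XE]) (use s m L0 in auto)
  then show ?thesis unfolding X_def D_def using s \<rho> \<rho>le by blast
qed

end

section \<open>Fourier inversion and choice of parameters\<close>

lemma integral_exp_int:
  fixes j :: int
  shows "(LINT \<eta>|lborel. indicator {-pi..pi} \<eta> *\<^sub>R exp (\<i> * of_real (\<eta> * of_int j))) = (if j = 0 then 2 * pi else 0)"
proof (cases "j = 0")
  case True
  have "(LINT \<eta>|lborel. indicator {-pi..pi} \<eta> *\<^sub>R (1 :: complex)) = 2 * pi"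
    using lebesgue_integral_const[of lborel] by (simp add: scaleR_conv_of_real)
  then show ?thesis using True by simp
next
  case False
  let ?G = "\<lambda>z. exp (\<i> * z * of_int j) / (\<i> * of_int j)"
  have d': "(?G has_field_derivative exp (\<i> * z * of_int j)) (at z)" for z
    using False by (auto intro!: derivative_eq_intros)
  have d: "((\<lambda>t. ?G (of_real t)) has_vector_derivative exp (\<i> * of_real t * of_int j)) (at t within {-pi..pi})" for t
    by (rule has_vector_derivative_at_within, rule has_vector_derivative_real_field, rule d')
  have e: "exp (\<i> * of_real t * of_int j) = exp (\<i> * of_real (t * of_int j))" for t by (simp add: mult_ac)
  have "(LINT \<eta>|lborel. indicator {-pi..pi} \<eta> *\<^sub>R exp (\<i> * of_real \<eta> * of_int j)) = ?G (of_real pi) - ?G (of_real (-pi))"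
    by (rule integral_FTC_Icc[OF _ d]) (auto intro!: continuous_intros)
  also have "?G (of_real pi) - ?G (of_real (-pi)) = 0"
  proof -
    have "exp (\<i> * of_real pi * of_int j) = exp (\<i> * of_real (-pi) * of_int j)"
      unfolding exp_eq by (intro exI[of _ j]) (simp add: algebra_simps)
    then show ?thesis by simp
  qed
  finally show ?thesis using False unfolding e by simp
qed

lemma psum_fourier:
  assumes "finite P" "inj_on fst P"
  shows "(LINT \<eta>|lborel. indicator {-pi..pi} \<eta> *\<^sub>R (psum (Complex \<beta> \<eta>) P * exp (- \<i> * of_real (\<eta> * of_int k))))
     = of_real (2 * pi * exp (\<beta> * of_int k) * real (card {u. (u, k) \<in> P}))"
proof -
  have I: "integrable lborel (\<lambda>\<eta>. indicator {-pi..pi} \<eta> *\<^sub>R exp (\<i> * of_real (\<eta> * of_int j)))" for j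
    using borel_integrable_atLeastAtMost'[of "-pi" pi "\<lambda>\<eta>. exp (\<i> * of_real (\<eta> * of_int j))"]
    by (simp add: set_integrable_def continuous_intros)
  have eq: "indicator {-pi..pi} \<eta> *\<^sub>R (psum (Complex \<beta> \<eta>) P * exp (- \<i> * of_real (\<eta> * of_int k)))
     = (\<Sum>p\<in>P. of_real (exp (\<beta> * of_int (snd p))) * (indicator {-pi..pi} \<eta> *\<^sub>R exp (\<i> * of_real (\<eta> * of_int (snd p - k)))))" for \<eta>
    unfolding psum_def sum_distrib_right scaleR_sum_right
  proof (rule sum.cong[OF refl])
    fix p
    have "exp (Complex \<beta> \<eta> * of_int (snd p)) * exp (- \<i> * of_real (\<eta> * of_int k))
      = of_real (exp (\<beta> * of_int (snd p))) * exp (\<i> * of_real (\<eta> * of_int (snd p - k)))"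
      by (simp add: Complex_eq exp_add[symmetric] exp_of_real[symmetric] algebra_simps)
    then show "indicator {-pi..pi} \<eta> *\<^sub>R (exp (Complex \<beta> \<eta> * of_int (snd p)) * exp (- \<i> * of_real (\<eta> * of_int k)))
      = of_real (exp (\<beta> * of_int (snd p))) * (indicator {-pi..pi} \<eta> *\<^sub>R exp (\<i> * of_real (\<eta> * of_int (snd p - k))))"
      by simp
  qed
  have "(LINT \<eta>|lborel. indicator {-pi..pi} \<eta> *\<^sub>R (psum (Complex \<beta> \<eta>) P * exp (- \<i> * of_real (\<eta> * of_int k))))
     = (\<Sum>p\<in>P. of_real (exp (\<beta> * of_int (snd p))) * of_real (if snd p - k = 0 then 2 * pi else 0))"
    unfolding eq by (subst Bochner_Integration.integral_sum) (auto simp only: integral_mult_right_zero integral_exp_int intro!: integrable_mult_right I)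
  also have "\<dots> = (\<Sum>p\<in>{p\<in>P. snd p = k}. of_real (2 * pi * exp (\<beta> * of_int k)))"
    unfolding sum.inter_filter[OF assms(1)] by (intro sum.cong refl) (simp add: mult_ac)
  also have "\<dots> = of_real (2 * pi * exp (\<beta> * of_int k) * real (card {p\<in>P. snd p = k}))" by simp
  also have "card {p\<in>P. snd p = k} = card {u. (u, k) \<in> P}"
  proof -
    have "{p\<in>P. snd p = k} = (\<lambda>u. (u, k)) ` {u. (u, k) \<in> P}" by force
    then show ?thesis by (simp add: card_image inj_on_def)
  qed
  finally show ?thesis .
qed

context brw_local
begin

lemma fin\<beta>: "fin \<beta>" using fin[of \<beta>] r by simp

lemma m_pos: "mR \<beta> > 0" using mR_pos[OF fin\<beta>] .

lemma Lcount_fourier: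
  "(LINT \<eta>|lborel. indicator {-pi..pi} \<eta> *\<^sub>R (psum (Complex \<beta> \<eta>) (particles xi n w) * exp (- \<i> * of_real (\<eta> * of_int k))))
     = of_real (2 * pi * exp (\<beta> * of_int k) * Lcount xi n k w)"
  unfolding Lcount_def
  by (rule psum_fourier) (use particles_gens[of xi n w] in \<open>auto simp: gens_def\<close>)

text \<open>The mean of the inversion formula. Fubini is justified by |Z_n(\<beta> + i\<eta>)| \<le>
  Z_n(\<beta>), whose mean m(\<beta>)^n is finite.\<close>

lemma Lcount_mean_fourier:
  "(LINT \<eta>|lborel. indicator {-pi..pi} \<eta> *\<^sub>R (mC (Complex \<beta> \<eta>) ^ n * exp (- \<i> * of_real (\<eta> * of_int k))))
     = of_real (2 * pi * exp (\<beta> * of_int k) * (\<integral>w. Lcount xi n k w \<partial>M))"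
proof -
  interpret L: pair_sigma_finite M "lborel :: real measure" ..
  let ?f = "\<lambda>w \<eta>. indicator {-pi..pi} \<eta> *\<^sub>R (psum (Complex \<beta> \<eta>) (particles xi n w) * exp (- \<i> * of_real (\<eta> * of_int k)))"
  have em: "(\<lambda>\<eta>. exp (- \<i> * of_real (\<eta> * of_int k)) :: complex) \<in> borel_measurable lborel"
    by (auto intro!: borel_measurable_continuous_onI continuous_intros)
  have fm: "(\<lambda>x. ?f (fst x) (snd x)) \<in> borel_measurable (M \<Otimes>\<^sub>M lborel)"
  proof -
    note psum_joint_measurable[OF Complex_line_measurable, measurable]
    have [measurable]: "(\<lambda>x. exp (- \<i> * of_real (snd x * of_int k)) :: complex) \<in> borel_measurable (M \<Otimes>\<^sub>M lborel)"
      by (rule measurable_compose[OF measurable_snd em])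
    show ?thesis by measurable
  qed
  have fi: "integrable (M \<Otimes>\<^sub>M lborel) (\<lambda>x. ?f (fst x) (snd x))"
  proof (rule integrableI_bounded[OF fm])
    have "(\<integral>\<^sup>+x. ennreal (norm (?f (fst x) (snd x))) \<partial>(M \<Otimes>\<^sub>M lborel)) = (\<integral>\<^sup>+w. (\<integral>\<^sup>+\<eta>. ennreal (norm (?f w \<eta>)) \<partial>lborel) \<partial>M)"
    proof -
      have "(\<lambda>x. ennreal (norm (?f (fst x) (snd x)))) \<in> borel_measurable (M \<Otimes>\<^sub>M lborel)"
        using fm by (rule measurable_compose[where g = "\<lambda>x. ennreal (norm x)"]) simp
      from lborel.nn_integral_fst[OF this] show ?thesis by simp
    qed
    also have "\<dots> \<le> (\<integral>\<^sup>+w. (\<integral>\<^sup>+\<eta>. ennreal (psumr \<beta> (particles xi n w)) * indicator {-pi..pi} \<eta> \<partial>lborel) \<partial>M)"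
    proof (intro nn_integral_mono)
      fix w and \<eta> :: real
      show "ennreal (norm (?f w \<eta>)) \<le> ennreal (psumr \<beta> (particles xi n w)) * indicator {-pi..pi} \<eta>"
        using norm_psum_le[of "Complex \<beta> \<eta>" "particles xi n w"]
        by (auto simp: norm_mult split: split_indicator intro!: ennreal_leI)
    qed
    also have "\<dots> = (\<integral>\<^sup>+w. ennreal (psumr \<beta> (particles xi n w)) * ennreal (2 * pi) \<partial>M)"
      by (intro nn_integral_cong) (subst nn_integral_cmult; simp)
    also have "\<dots> = ennreal (mR \<beta> ^ n) * ennreal (2 * pi)"
      by (subst nn_integral_multc) (simp_all add: nn_integral_psumr fin\<beta>)
    also have "\<dots> < \<infinity>" by (simp add: ennreal_mult_less_top)
    finally show "(\<integral>\<^sup>+x. ennreal (norm (?f (fst x) (snd x))) \<partial>(M \<Otimes>\<^sub>M lborel)) < \<infinity>" .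
  qed
  have "(LINT \<eta>|lborel. indicator {-pi..pi} \<eta> *\<^sub>R (mC (Complex \<beta> \<eta>) ^ n * exp (- \<i> * of_real (\<eta> * of_int k))))
    = (LINT \<eta>|lborel. (\<integral>w. ?f w \<eta> \<partial>M))"
  proof (rule Bochner_Integration.integral_cong[OF refl])
    fix \<eta> :: real
    have "(\<integral>w. psum (Complex \<beta> \<eta>) (particles xi n w) \<partial>M) = mC (Complex \<beta> \<eta>) ^ n"
      by (rule integral_psum) (simp add: fin\<beta>)
    then show "indicator {-pi..pi} \<eta> *\<^sub>R (mC (Complex \<beta> \<eta>) ^ n * exp (- \<i> * of_real (\<eta> * of_int k))) = (\<integral>w. ?f w \<eta> \<partial>M)"
      by simp
  qed
  also have "\<dots> = (\<integral>w. (LINT \<eta>|lborel. ?f w \<eta>) \<partial>M)"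
    by (rule L.Fubini_integral) (use fi in \<open>simp add: case_prod_unfold\<close>)
  also have "\<dots> = (\<integral>w. of_real (2 * pi * exp (\<beta> * of_int k) * Lcount xi n k w) \<partial>M)"
    unfolding Lcount_fourier ..
  also have "\<dots> = of_real (2 * pi * exp (\<beta> * of_int k) * (\<integral>w. Lcount xi n k w \<partial>M))"
    by (subst integral_complex_of_real) simp
  finally show ?thesis .
qed

end

section \<open>Choice of the parameters, and aperiodicity\<close>

context brw_nd
begin

text \<open>The slope condition says that t \<mapsto> \<phi>(t\<beta>) - t \<phi>(\<beta>) decreases
  at t = 1, where it vanishes; so m(p\<beta>) < m(\<beta>)^p for p slightly above 1, and continuity
  extends this strict inequality from \<beta> to a disc. Assumption \<open>D\<close> supplies the
  moments on a compact interval inside \<open>Ibeta\<close>.\<close>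

lemma local_setup_exists:
  assumes \<beta>: "\<beta> \<in> Ibeta M xi"
    and D: "\<exists>p>1. \<forall>K. compact K \<and> K \<subseteq> Ibeta M xi \<longrightarrow>
              (SUP b\<in>K. \<integral>\<^sup>+ w. ennreal (Wn M xi 1 b w powr p) \<partial>M) < \<infinity>"
  shows "\<exists>r p q C F. brw_local M xi k1 k2 \<beta> r p q C \<and> F holomorphic_on ball (of_real \<beta>) (2 * r) \<and>
    (\<forall>z\<in>ball (of_real \<beta>) (2 * r). exp (F z) = mC z) \<and>
    (\<forall>x. \<bar>x - \<beta>\<bar> < 2 * r \<longrightarrow> F (of_real x) = of_real (phi M xi x)) \<and> {\<beta> - r..\<beta> + r} \<subseteq> Ibeta M xi"
proof -
  have \<beta>D: "\<beta> \<in> Dphi M xi" and slope: "deriv (phi M xi) \<beta> * \<beta> < phi M xi \<beta>"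
    using Ibeta_beta_set[OF \<beta>] by auto
  obtain b1 b2 where b: "b1 < \<beta>" "\<beta> < b2" "b1 \<in> beta_set M xi" "b2 \<in> beta_set M xi" "{b1<..<b2} \<subseteq> Ibeta M xi"
    by (rule Ibeta_bracket[OF \<beta>])
  obtain p0 where p0: "p0 > 1" "\<And>K. compact K \<Longrightarrow> K \<subseteq> Ibeta M xi \<Longrightarrow>
      (SUP b\<in>K. \<integral>\<^sup>+ w. ennreal (Wn M xi 1 b w powr p0) \<partial>M) < \<infinity>" using D by blast
  obtain r1 F where r1: "r1 > 0" and F: "F holomorphic_on ball (of_real \<beta>) r1"
    and finx: "\<And>x. \<bar>x - \<beta>\<bar> < r1 \<Longrightarrow> fin x" and eF: "\<And>z. z \<in> ball (of_real \<beta>) r1 \<Longrightarrow> exp (F z) = mC z"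
    and Fx: "\<And>x. \<bar>x - \<beta>\<bar> < r1 \<Longrightarrow> F (of_real x) = of_real (phi M xi x)"
    and mCh: "mC holomorphic_on ball (of_real \<beta>) r1"
    using log_mC[OF \<beta>D] by blast
  have fin\<beta>: "fin \<beta>" using finx r1 by simp
  have "((\<lambda>t. phi M xi (t * \<beta>) - t * phi M xi \<beta>) has_field_derivative deriv (phi M xi) \<beta> * \<beta> - phi M xi \<beta>) (at 1)"
  proof -
    have "((\<lambda>t. phi M xi (t * \<beta>)) has_field_derivative deriv (phi M xi) \<beta> * \<beta>) (at 1)"
      by (rule DERIV_chain2[of "phi M xi"]) (use phi_deriv(1)[OF \<beta>D] in \<open>auto intro!: derivative_eq_intros\<close>)
    then show ?thesis by (auto intro!: derivative_eq_intros)
  qed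
  from DERIV_neg_dec_right[OF this] slope obtain d1 where d1: "d1 > 0"
    "\<And>h. 0 < h \<Longrightarrow> h < d1 \<Longrightarrow> phi M xi ((1 + h) * \<beta>) - (1 + h) * phi M xi \<beta> < 0" by auto
  \<comment> \<open>The four bounds ensure, in turn, the decrease at t = 1, that
    \<open>p * \<beta>\<close> is within r1 / 4 of \<beta>, that \<open>p \<le> 2\<close>, and that
    \<open>p \<le> p0\<close>.\<close>
  define h where "h = min (min (d1 / 2) (r1 / (4 * (1 + \<bar>\<beta>\<bar>)))) (min 1 (p0 - 1))"
  have h: "0 < h" "h < d1" "h \<le> 1" "h \<le> p0 - 1" "h \<le> r1 / (4 * (1 + \<bar>\<beta>\<bar>))"
    using d1 r1 p0 by (auto simp: h_def min_less_iff_disj)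
  define p where "p = 1 + h"
  have p: "1 < p" "p \<le> 2" "p \<le> p0" using h by (auto simp: p_def)
  have p\<beta>: "\<bar>p * \<beta> - \<beta>\<bar> \<le> r1 / 4"
  proof -
    have "\<bar>p * \<beta> - \<beta>\<bar> = h * \<bar>\<beta>\<bar>" using h by (simp add: p_def algebra_simps abs_mult)
    also have "\<dots> \<le> h * (1 + \<bar>\<beta>\<bar>)" using h by (intro mult_left_mono) auto
    also have "\<dots> \<le> r1 / (4 * (1 + \<bar>\<beta>\<bar>)) * (1 + \<bar>\<beta>\<bar>)" using h by (intro mult_right_mono) auto
    also have "\<dots> = r1 / 4" by (simp add: field_simps add_nonneg_eq_0_iff)
    finally show ?thesis .
  qed
  have finp\<beta>: "fin (p * \<beta>)" using finx[of "p * \<beta>"] p\<beta> r1 by simp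
  have mRp: "mR (p * \<beta>) < mR \<beta> powr p"
  proof -
    have "ln (mR (p * \<beta>)) < p * ln (mR \<beta>)"
      using d1(2)[OF h(1) h(2)] phi_eq[OF fin\<beta>] phi_eq[OF finp\<beta>] by (simp add: p_def)
    then have "exp (ln (mR (p * \<beta>))) < exp (p * ln (mR \<beta>))" by simp
    then show ?thesis using mR_pos[OF fin\<beta>] mR_pos[OF finp\<beta>] by (simp add: powr_def)
  qed
  \<comment> \<open>This is \<open>mR (p * Re z)\<close> divided by |m(z)|^p; written through
    \<open>mC\<close>, its continuity follows from holomorphy.\<close>
  define R where "R z = Re (mC (of_real (p * Re z))) / norm (mC z) powr p" for z
  have R0: "0 \<le> R (of_real \<beta>)" "R (of_real \<beta>) < 1"
    using mRp mR_nonneg[of "p * \<beta>"] mR_pos[OF fin\<beta>]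
    unfolding R_def by (simp_all add: mC_of_real norm_of_real del: of_real_mult)
  have Rcont: "isCont R (of_real \<beta>)"
  proof -
    have i1: "isCont mC (of_real x)" if "\<bar>x - \<beta>\<bar> < r1" for x
    proof -
      have "of_real x \<in> ball (complex_of_real \<beta>) r1" using that by (simp add: dist_of_real dist_real_def abs_minus_commute)
      then show ?thesis using holomorphic_on_imp_continuous_on[OF mCh] by (simp add: continuous_on_eq_continuous_at)
    qed
    have i2: "isCont (\<lambda>z. complex_of_real (p * Re z)) (of_real \<beta>)"
      by (intro continuous_of_real continuous_mult continuous_const isCont_Re continuous_ident)
    have "isCont mC (complex_of_real (p * Re (of_real \<beta>)))" using i1[of "p * \<beta>"] p\<beta> r1 by simp
    then have i3: "isCont (\<lambda>z. mC (of_real (p * Re z))) (of_real \<beta>)" by (rule isCont_o2[OF i2])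
    have i4: "isCont (\<lambda>z. norm (mC z)) (of_real \<beta>)" using i1[of \<beta>] r1 by (intro continuous_norm) simp
    have n0: "norm (mC (of_real \<beta>)) > 0" using mR_pos[OF fin\<beta>] by (simp add: mC_of_real)
    have i5: "isCont (\<lambda>z. Re (mC (of_real (p * Re z)))) (of_real \<beta>)" by (rule isCont_Re[OF i3])
    show ?thesis unfolding R_def
      using i5[unfolded isCont_def] i4[unfolded isCont_def] n0 unfolding isCont_def
      by (intro tendsto_divide tendsto_powr tendsto_const) auto
  qed
  define q2 where "q2 = (1 + R (of_real \<beta>)) / 2"
  have q2: "0 < q2" "q2 < 1" "R (of_real \<beta>) < q2" using R0 by (auto simp: q2_def)
  have "\<forall>\<^sub>F z in at (of_real \<beta>). R z < q2" using Rcont q2 unfolding isCont_def by (intro order_tendstoD)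
  then obtain d where d: "d > 0" "\<And>z. z \<noteq> of_real \<beta> \<Longrightarrow> dist z (of_real \<beta>) < d \<Longrightarrow> R z < q2"
    unfolding eventually_at by auto
  \<comment> \<open>With r \<le> r1 / 8 one has |p x - \<beta>| \<le> 2 r + r1 / 4 < r1, so
    \<open>p * x\<close> stays where m is finite. The other bounds keep the disc inside the region R
    < q2 and the interval inside \<open>Ibeta\<close>.\<close>
  define r where "r = min (min (r1 / 8) (d / 2)) (min ((\<beta> - b1) / 2) ((b2 - \<beta>) / 2))"
  have r: "0 < r" "r \<le> r1 / 8" "r < d" "r < \<beta> - b1" "r < b2 - \<beta>" using r1 d b by (auto simp: r_def min_less_iff_disj)
  define K where "K = {\<beta> - r..\<beta> + r}"
  have KI: "K \<subseteq> Ibeta M xi" using b r by (auto simp: K_def intro!: subsetD[OF b(5)])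
  have Kx: "x \<in> K" if "\<bar>x - \<beta>\<bar> \<le> r" for x using that by (auto simp: K_def)
  obtain S where S: "S \<ge> 0" "\<And>x. x \<in> K \<Longrightarrow> (\<integral>\<^sup>+ w. ennreal (Wn M xi 1 x w powr p0) \<partial>M) \<le> ennreal S"
  proof -
    have "(SUP b\<in>K. \<integral>\<^sup>+ w. ennreal (Wn M xi 1 b w powr p0) \<partial>M) < \<infinity>" using p0(2)[OF _ KI] by (simp add: K_def)
    then obtain S where S: "(SUP b\<in>K. \<integral>\<^sup>+ w. ennreal (Wn M xi 1 b w powr p0) \<partial>M) = ennreal S" "S \<ge> 0"
      unfolding infinity_ennreal_def less_top_ennreal by blast
    show ?thesis
    proof (rule that[OF S(2)])
      fix x assume "x \<in> K"
      then show "(\<integral>\<^sup>+ w. ennreal (Wn M xi 1 x w powr p0) \<partial>M) \<le> ennreal S"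
        unfolding S(1)[symmetric] by (rule SUP_upper)
    qed
  qed
  define m0 where "m0 = mR (\<beta> - r) + mR (\<beta> + r)"
  have fr: "fin (\<beta> - r)" "fin (\<beta> + r)" using finx r r1 by auto
  have m0: "m0 \<ge> 0" using mR_nonneg by (simp add: m0_def)
  define C where "C = (1 + m0) powr p * (1 + S)"
  have mom: "integrable M (\<lambda>w. lsumr x (xi [] w) powr p) \<and> (\<integral>w. lsumr x (xi [] w) powr p \<partial>M) \<le> C"
    if x: "\<bar>x - \<beta>\<bar> \<le> r" for x
  proof -
    have fx: "fin x" using finx x r r1 by auto
    have mx: "mR x > 0" by (rule mR_pos[OF fx])
    have "x \<in> {\<beta> - r..\<beta> + r}" using x by (auto simp: abs_le_iff)
    from mR_conv[OF fr this] have mx0: "mR x \<le> 1 + m0" unfolding m0_def by linarith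
    have W: "Wn M xi 1 x w = lsumr x (xi [] w) / mR x" for w
    proof -
      have "Wn M xi 1 x w = psumr x (particles xi 1 w) * exp (- phi M xi x)"
        unfolding Wn_def psumr_def by (simp add: case_prod_unfold exp_diff exp_minus sum_divide_distrib field_simps)
      also have "exp (- phi M xi x) = 1 / mR x" using mx by (simp add: phi_eq[OF fx] exp_minus field_simps)
      finally show ?thesis unfolding psumr_1 by simp
    qed
    \<comment> \<open>The assumed moments are normalised and have exponent p0 \<ge> p; they are
      brought to exponent p through y^p \<le> 1 + y^p0.\<close>
    have le: "ennreal (lsumr x (xi [] w) powr p) \<le> ennreal ((1 + m0) powr p) * (1 + ennreal (Wn M xi 1 x w powr p0))" for w
    proof -
      define y where "y = lsumr x (xi [] w) / mR x"
      have y0: "y \<ge> 0" using mx by (simp add: y_def lsumr_nonneg)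
      have "lsumr x (xi [] w) powr p = mR x powr p * y powr p"
        using mx y0 by (simp add: powr_mult[symmetric] y_def)
      also have "\<dots> \<le> (1 + m0) powr p * (1 + y powr p0)"
      proof (rule mult_mono)
        show "mR x powr p \<le> (1 + m0) powr p" using mx mx0 p by (intro powr_mono2) auto
        show "y powr p \<le> 1 + y powr p0"
        proof (cases "y \<le> 1")
          case True
          then have "y powr p \<le> 1" using y0 p by (intro powr_le1) auto
          then show ?thesis by (simp add: add_increasing2)
        next
          case False
          then have "y powr p \<le> y powr p0" using p by (intro powr_mono) auto
          then show ?thesis by simp
        qed
      qed auto
      finally show ?thesis unfolding W y_def[symmetric]
        by (simp add: ennreal_mult[symmetric] ennreal_plus[symmetric] ennreal_1[symmetric] ennreal_leI del: ennreal_plus ennreal_1)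
    qed
    have Wm: "(\<lambda>w. ennreal (Wn M xi 1 x w powr p0)) \<in> borel_measurable M"
      unfolding W by (rule measurable_compose[OF xi_meas, of "\<lambda>l. ennreal ((lsumr x l / mR x) powr p0)"]) simp
    have "(\<integral>\<^sup>+w. ennreal (lsumr x (xi [] w) powr p) \<partial>M) \<le> (\<integral>\<^sup>+w. ennreal ((1 + m0) powr p) * (1 + ennreal (Wn M xi 1 x w powr p0)) \<partial>M)"
      by (intro nn_integral_mono le)
    also have "\<dots> = ennreal ((1 + m0) powr p) * (1 + (\<integral>\<^sup>+w. ennreal (Wn M xi 1 x w powr p0) \<partial>M))"
    proof -
      have c1: "(\<lambda>w. 1 :: ennreal) \<in> borel_measurable M" by simp
      have "(\<integral>\<^sup>+w. 1 \<partial>M) = (1 :: ennreal)" by (simp only: nn_integral_const emeasure_space_1 mult_1)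
      then show ?thesis
        unfolding nn_integral_cmult[OF borel_measurable_add[OF c1 Wm]] nn_integral_add[OF c1 Wm] by (simp only:)
    qed
    also have "\<dots> \<le> ennreal ((1 + m0) powr p) * (1 + ennreal S)"
      by (intro mult_left_mono add_left_mono S Kx x) simp
    also have "\<dots> = ennreal C" unfolding C_def using S
      by (simp add: ennreal_mult[symmetric] ennreal_plus[symmetric] ennreal_1[symmetric] del: ennreal_plus ennreal_1)
    finally have *: "(\<integral>\<^sup>+w. ennreal (lsumr x (xi [] w) powr p) \<partial>M) \<le> ennreal C" .
    have i: "integrable M (\<lambda>w. lsumr x (xi [] w) powr p)"
      by (rule integrableI_nonneg) (use * in \<open>auto simp: le_less_trans\<close>)
    have "ennreal (\<integral>w. lsumr x (xi [] w) powr p \<partial>M) \<le> ennreal C"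
      using * by (subst nn_integral_eq_integral[OF i, symmetric]) auto
    moreover have "C \<ge> 0" using S m0 by (simp add: C_def)
    ultimately show ?thesis using i by simp
  qed
  have sub: "ball (complex_of_real \<beta>) (2 * r) \<subseteq> ball (of_real \<beta>) r1" using r by (intro subset_ball) auto
  \<comment> \<open>The locale uses the square of its parameter, hence
    \<open>sqrt q2\<close>.\<close>
  have "brw_local M xi k1 k2 \<beta> r p (sqrt q2) C"
  proof unfold_locales
    show "0 < r" "1 < p" "p \<le> 2" "0 < sqrt q2" "sqrt q2 < 1" using r p q2 by auto
    show "fin x" if "\<bar>x - \<beta>\<bar> \<le> r" for x using that finx r r1 by auto
    show "fin (p * x)" if x: "\<bar>x - \<beta>\<bar> \<le> r" for x
    proof -
      have "\<bar>p * x - \<beta>\<bar> \<le> \<bar>p * (x - \<beta>)\<bar> + \<bar>p * \<beta> - \<beta>\<bar>" by (simp add: right_diff_distrib)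
      also have "\<bar>p * (x - \<beta>)\<bar> \<le> 2 * r" using x p unfolding abs_mult by (intro mult_mono) auto
      finally show ?thesis using p\<beta> r r1 by (intro finx) auto
    qed
    show "integrable M (\<lambda>w. lsumr x (xi [] w) powr p)" "(\<integral>w. lsumr x (xi [] w) powr p \<partial>M) \<le> C"
      if "\<bar>x - \<beta>\<bar> \<le> r" for x using mom[OF that] by auto
    show "mC z \<noteq> 0" if "z \<in> ball (of_real \<beta>) (2 * r)" for z
      using eF[of z] sub that exp_not_eq_zero[of "F z"] by fastforce
    show "mC holomorphic_on ball (of_real \<beta>) (2 * r)" using mCh sub by (rule holomorphic_on_subset)
    show "mR (p * Re z) \<le> norm (mC z) powr p * (sqrt q2)\<^sup>2" if z: "z \<in> cball (of_real \<beta>) r" for z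
    proof -
      have "z \<in> ball (of_real \<beta>) r1" using z r r1 by auto
      then have n0: "norm (mC z) > 0" using eF[of z] exp_not_eq_zero[of "F z"] by fastforce
      have "R z < q2" using d(2)[of z] z r q2 by (cases "z = of_real \<beta>") (auto simp: dist_commute)
      moreover have "R z = mR (p * Re z) / norm (mC z) powr p" unfolding R_def mC_of_real by simp
      ultimately show ?thesis using n0 q2 by (simp add: field_simps)
    qed
  qed
  moreover have "F holomorphic_on ball (of_real \<beta>) (2 * r)" using F sub by (rule holomorphic_on_subset)
  moreover have "\<bar>x - \<beta>\<bar> < 2 * r \<Longrightarrow> F (of_real x) = of_real (phi M xi x)" for x using Fx r r1 by auto
  ultimately show ?thesis using eF sub KI unfolding K_def by blast
qed

text \<open>Equality would make \<open>\<eta>d / 2\<pi>\<close> an integer for all differences \<open>d\<close> of atoms.  The integers \<open>d\<close> with that property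
  form a subgroup, which aperiodicity forces to contain 1.\<close>
lemma norm_mC_less:
  assumes fin: "fin \<theta>"
    and E: "\<forall>h a :: int. h \<ge> 2 \<longrightarrow> \<not> (\<forall>j. (\<integral>w. Lcount xi 1 j w \<partial>M) > 0 \<longrightarrow> h dvd (j - a))"
    and \<eta>: "0 < \<bar>\<eta>\<bar>" "\<bar>\<eta>\<bar> \<le> pi"
  shows "norm (mC (Complex \<theta> \<eta>)) < mR \<theta>"
proof (rule ccontr)
  assume neg: "\<not> norm (mC (Complex \<theta> \<eta>)) < mR \<theta>"
  have cos1: "cos (\<eta> * (of_int j - of_int k1)) = 1" if j: "(\<integral>w. Lcount xi 1 j w \<partial>M) > 0" for j
  proof (cases "j = k1")
    case False
    let ?c = "atom j \<theta> * atom k1 \<theta> / (atom j \<theta> + atom k1 \<theta>)"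
    have "atom j \<theta> > 0" "atom k1 \<theta> > 0" using j atoms by (auto simp: atom_def)
    then have c: "?c > 0" by (intro divide_pos_pos mult_pos_pos add_pos_pos)
    have "norm (mC (Complex \<theta> \<eta>)) \<le> mR \<theta> - ?c * (1 - cos (\<eta> * (of_int j - of_int k1)))"
      by (rule mC_two_atoms[OF fin False j atoms(1)])
    then have "?c * (1 - cos (\<eta> * (of_int j - of_int k1))) \<le> 0" using neg by linarith
    then have "1 - cos (\<eta> * (of_int j - of_int k1)) \<le> 0"
      using mult_pos_pos[OF c, of "1 - cos (\<eta> * (of_int j - of_int k1))"] by linarith
    then show ?thesis using cos_le_one[of "\<eta> * (of_int j - of_int k1)"] by simp
  qed simp
  define \<rho> where "\<rho> = \<eta> / (2 * pi)"
  define H where "H = {d :: int. \<rho> * of_int d \<in> \<int>}"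
  have atomH: "j - k1 \<in> H" if "(\<integral>w. Lcount xi 1 j w \<partial>M) > 0" for j
  proof -
    from cos1[OF that] obtain m :: int where "\<eta> * (of_int j - of_int k1) = of_int m * 2 * pi"
      unfolding cos_one_2pi_int by blast
    then have "\<rho> * of_int (j - k1) = of_int m" by (simp add: \<rho>_def field_simps)
    then show ?thesis unfolding H_def by simp
  qed
  \<comment> \<open>One closure property for both uses: negation, and remainders after
    division.\<close>
  have Hdiff: "a - c * b \<in> H" if "a \<in> H" "b \<in> H" for a b c
  proof -
    have "\<rho> * of_int (a - c * b) = \<rho> * of_int a - of_int c * (\<rho> * of_int b)" by (simp add: algebra_simps)
    also have "\<dots> \<in> \<int>" using that unfolding H_def by (blast intro: Ints_diff Ints_mult[OF Ints_of_int])
    finally show ?thesis unfolding H_def by simp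
  qed
  have H0: "k2 - k1 \<in> H" "k2 - k1 \<noteq> 0" using atomH[OF atoms(2)] k12 by auto
  have zero: "0 \<in> H" by (simp add: H_def)
  have pos: "\<exists>n>0. int n \<in> H"
  proof (cases "k2 - k1 > 0")
    case True
    then show ?thesis using H0 by (intro exI[of _ "nat (k2 - k1)"]) auto
  next
    case False
    then have "0 - 1 * (k2 - k1) \<in> H" by (intro Hdiff zero H0)
    then show ?thesis using H0 False by (intro exI[of _ "nat (k1 - k2)"]) auto
  qed
  define h where "h = (LEAST n. n > 0 \<and> int n \<in> H)"
  have h: "h > 0" "int h \<in> H" using LeastI_ex[of "\<lambda>n. n > 0 \<and> int n \<in> H"] pos unfolding h_def by auto
  have least: "h \<le> n" if "n > 0" "int n \<in> H" for n unfolding h_def using that by (intro Least_le) auto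
  have dvd: "int h dvd d" if d: "d \<in> H" for d
  proof -
    have "d - (d div int h) * int h \<in> H" using Hdiff[OF d h(2)] .
    then have m: "d mod int h \<in> H" by (simp add: minus_div_mult_eq_mod)
    have "d mod int h = 0"
    proof (rule ccontr)
      assume "d mod int h \<noteq> 0"
      then have g: "nat (d mod int h) > 0" using h pos_mod_sign[of "int h" d] by linarith
      then have "h \<le> nat (d mod int h)" using m by (intro least) auto
      moreover have "d mod int h < int h" using h by simp
      ultimately show False using g by linarith
    qed
    then show ?thesis by (simp add: dvd_eq_mod_eq_0)
  qed
  have "\<not> int h \<ge> 2" using E[rule_format, of "int h" k1] dvd atomH by blast
  then have "h = 1" using h by linarith
  then have "\<rho> * of_int 1 \<in> \<int>" using h unfolding H_def by simp
  then have "\<rho> \<in> \<int>" by simp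
  then obtain m :: int where m: "\<rho> = of_int m" by (auto elim: Ints_cases)
  \<comment> \<open>Here |\<eta>| \<le> \<pi> enters: a nonzero integer cannot have modulus at most
    1 / 2.\<close>
  have "\<bar>\<rho>\<bar> \<le> 1 / 2" "\<bar>\<rho>\<bar> > 0" using \<eta> by (auto simp: \<rho>_def field_simps abs_mult)
  then have "real_of_int \<bar>m\<bar> < 1" "real_of_int \<bar>m\<bar> > 0" unfolding m by auto
  then have "\<bar>m\<bar> < 1" "\<bar>m\<bar> > 0" by linarith+
  then show False by linarith
qed

end

section \<open>The three regimes\<close>

text \<open>With T = n^(3/2) A and s = c / sqrt n the expansion reads T = a c e^(-s^2 / (2
  \<sigma>^2)) / (\<sigma>^3 sqrt (2 \<pi>)) + H(s) + o(1). Dividing by sqrt n, by c, or not at all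
  gives the three cases; only in the last does \<open>H\<close> survive.\<close>

lemma three_regimes:
  fixes A c :: "nat \<Rightarrow> real"
  assumes \<sigma>: "\<sigma> > 0"
    and star: "(\<lambda>n. of_real (2 * pi * (real n powr (3/2) * A n)) - of_real (sqrt (real n)) * (\<i> * of_real a * gaussint \<sigma> 1 (c n / sqrt (real n)))
       - (of_real (\<kappa> / 6) * of_real a * gaussint \<sigma> 4 (c n / sqrt (real n)) - of_real b / 2 * gaussint \<sigma> 2 (c n / sqrt (real n)))) \<longlonglongrightarrow> 0"
  shows "(\<lambda>n. c n - \<alpha> * \<sigma> * sqrt (real n)) \<in> o(\<lambda>n. sqrt (real n)) \<Longrightarrow>
      (\<lambda>n. real n * A n) \<longlonglongrightarrow> 1 / (sqrt (2 * pi) * \<sigma>\<^sup>2) * \<alpha> * exp (- \<alpha>\<^sup>2 / 2) * a"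
    and "filterlim c at_top sequentially \<Longrightarrow> c \<in> o(\<lambda>n. sqrt (real n)) \<Longrightarrow>
      (\<lambda>n. real n powr (3/2) / c n * A n) \<longlonglongrightarrow> 1 / (sqrt (2 * pi) * \<sigma> ^ 3) * a"
    and "Bseq c \<Longrightarrow> (\<lambda>n. real n powr (3/2) * A n
      - 1 / (sqrt (2 * pi) * \<sigma> ^ 3) * (a * (c n + \<kappa> / (2 * \<sigma>\<^sup>2)) - 1/2 * b)) \<longlonglongrightarrow> 0"
proof -
  define s where "s n = c n / sqrt (real n)" for n
  define T where "T n = real n powr (3/2) * A n" for n
  define S where "S = sqrt (2 * pi)"
  have S: "S > 0" "S * S = 2 * pi" by (auto simp: S_def)
  define E where "E x = exp (- x\<^sup>2 / (2 * \<sigma>\<^sup>2))" for x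
  define H where "H x = Re (of_real (\<kappa> / 6) * of_real a * gaussint \<sigma> 4 x - of_real b / 2 * gaussint \<sigma> 2 x) / (2 * pi)" for x
  have sq: "sqrt (real n) > 0" "sqrt (real n) * sqrt (real n) = real n" "c n = sqrt (real n) * s n" 
    "real n powr (3/2) = real n * sqrt (real n)" if "n \<ge> 1" for n
    using that by (auto simp: s_def powr_half_sqrt[symmetric] powr_add[symmetric] powr_mult_base)
  \<comment> \<open>The first Gaussian integral is purely imaginary, so the leading term is
    real.\<close>
  have g1: "\<i> * of_real a * gaussint \<sigma> 1 x = of_real (2 * pi * (a * (x * E x / (\<sigma> ^ 3 * S))))" for x
  proof -
    have "\<i> * of_real a * gaussint \<sigma> 1 x = of_real (a * (x / \<sigma>\<^sup>2) * (S / \<sigma> * E x))"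
      unfolding gaussint_1[OF \<sigma>] gaussint_0[OF \<sigma>] S_def E_def by (simp add: algebra_simps)
    also have "a * (x / \<sigma>\<^sup>2) * (S / \<sigma> * E x) = 2 * pi * (a * (x * E x / (\<sigma> ^ 3 * S)))"
      unfolding S(2)[symmetric] using S \<sigma> by (simp add: field_simps power2_eq_square power3_eq_cube)
    finally show ?thesis .
  qed
  have star1: "(\<lambda>n. T n - sqrt (real n) * (a * (s n * E (s n) / (\<sigma> ^ 3 * S))) - H (s n)) \<longlonglongrightarrow> 0"
  proof -
    have "(\<lambda>n. Re (of_real (2 * pi * (real n powr (3/2) * A n)) - of_real (sqrt (real n)) * (\<i> * of_real a * gaussint \<sigma> 1 (c n / sqrt (real n)))
       - (of_real (\<kappa> / 6) * of_real a * gaussint \<sigma> 4 (c n / sqrt (real n)) - of_real b / 2 * gaussint \<sigma> 2 (c n / sqrt (real n)))) / (2 * pi)) \<longlonglongrightarrow> Re 0 / (2 * pi)"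
      by (intro tendsto_divide tendsto_Re star tendsto_const) simp
    moreover have "Re (of_real (2 * pi * (real n powr (3/2) * A n)) - of_real (sqrt (real n)) * (\<i> * of_real a * gaussint \<sigma> 1 (c n / sqrt (real n)))
       - (of_real (\<kappa> / 6) * of_real a * gaussint \<sigma> 4 (c n / sqrt (real n)) - of_real b / 2 * gaussint \<sigma> 2 (c n / sqrt (real n)))) / (2 * pi)
       = T n - sqrt (real n) * (a * (s n * E (s n) / (\<sigma> ^ 3 * S))) - H (s n)" for n
    proof -
      have lin: "(2 * pi * X - y * (2 * pi * Z) - U) / (2 * pi) = X - y * Z - U / (2 * pi)" for X y Z U :: real
        by (simp add: field_simps)
      show ?thesis
        unfolding g1 s_def[symmetric] H_def T_def lin[symmetric] of_real_mult[symmetric] minus_complex.simps(1) Re_complex_of_real by simp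
    qed
    ultimately show ?thesis by (simp only: complex.sel zero_complex.sel div_0)
  qed
  \<comment> \<open>In the first two cases \<open>H\<close> is multiplied by a null sequence, so
    boundedness is enough.\<close>
  have Hb: "\<exists>B. \<forall>x. \<bar>H x\<bar> \<le> B"
  proof -
    define G where "G j = (LINT t|lborel. \<bar>t\<bar> ^ j * exp (- (\<sigma>\<^sup>2 / 2) * t\<^sup>2))" for j
    have "\<bar>H x\<bar> \<le> (\<bar>\<kappa>\<bar> / 6 * \<bar>a\<bar> * G 4 + \<bar>b\<bar> / 2 * G 2) / (2 * pi)" for x
    proof -
      have "\<bar>Re (of_real (\<kappa> / 6) * of_real a * gaussint \<sigma> 4 x - of_real b / 2 * gaussint \<sigma> 2 x)\<bar> 
        \<le> norm (of_real (\<kappa> / 6) * of_real a * gaussint \<sigma> 4 x) + norm (of_real b / 2 * gaussint \<sigma> 2 x)"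
        by (rule order_trans[OF abs_Re_le_cmod norm_triangle_ineq4])
      also have "\<dots> = \<bar>\<kappa>\<bar> / 6 * \<bar>a\<bar> * norm (gaussint \<sigma> 4 x) + \<bar>b\<bar> / 2 * norm (gaussint \<sigma> 2 x)"
        by (simp add: norm_mult norm_divide)
      also have "\<dots> \<le> \<bar>\<kappa>\<bar> / 6 * \<bar>a\<bar> * G 4 + \<bar>b\<bar> / 2 * G 2"
        unfolding G_def by (intro add_mono mult_left_mono norm_gaussint_le \<sigma>) auto
      finally show ?thesis unfolding H_def abs_divide by (simp add: divide_right_mono)
    qed
    then show ?thesis by blast
  qed
  then obtain B where B: "\<And>x. \<bar>H x\<bar> \<le> B" by blast
  have Hlim: "(\<lambda>n. H (s n) * y n) \<longlonglongrightarrow> 0" if "y \<longlonglongrightarrow> 0" for y :: "nat \<Rightarrow> real"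
  proof (rule Lim_null_comparison)
    have "(\<lambda>n. B * \<bar>y n\<bar>) \<longlonglongrightarrow> B * 0" by (intro tendsto_mult_left tendsto_rabs_zero that)
    then show "(\<lambda>n. B * \<bar>y n\<bar>) \<longlonglongrightarrow> 0" by simp
    show "\<forall>\<^sub>F n in sequentially. norm (H (s n) * y n) \<le> B * \<bar>y n\<bar>"
      using B by (auto simp: abs_mult intro!: always_eventually mult_right_mono)
  qed
  have inv: "(\<lambda>n. 1 / sqrt (real n)) \<longlonglongrightarrow> 0" by real_asymp
  have slim0: "s \<longlonglongrightarrow> 0" if "c \<in> o(\<lambda>n. sqrt (real n))"
    using smalloD_tendsto[OF that] by (simp add: s_def[abs_def])
  have Elim: "(\<lambda>n. E (s n)) \<longlonglongrightarrow> E l" if "s \<longlonglongrightarrow> l" for l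
    unfolding E_def by (intro tendsto_intros that) (use \<sigma> in auto)
  show "(\<lambda>n. real n * A n) \<longlonglongrightarrow> 1 / (sqrt (2 * pi) * \<sigma>\<^sup>2) * \<alpha> * exp (- \<alpha>\<^sup>2 / 2) * a"
    if o: "(\<lambda>n. c n - \<alpha> * \<sigma> * sqrt (real n)) \<in> o(\<lambda>n. sqrt (real n))"
  proof -
    have "(\<lambda>n. (c n - \<alpha> * \<sigma> * sqrt (real n)) / sqrt (real n) + \<alpha> * \<sigma>) \<longlonglongrightarrow> 0 + \<alpha> * \<sigma>"
      by (intro tendsto_add tendsto_const smalloD_tendsto[OF o])
    then have "(\<lambda>n. (c n - \<alpha> * \<sigma> * sqrt (real n)) / sqrt (real n) + \<alpha> * \<sigma>) \<longlonglongrightarrow> \<alpha> * \<sigma>" by simp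
    then have sl: "s \<longlonglongrightarrow> \<alpha> * \<sigma>"
    proof (rule Lim_transform_eventually)
      show "\<forall>\<^sub>F n in sequentially. (c n - \<alpha> * \<sigma> * sqrt (real n)) / sqrt (real n) + \<alpha> * \<sigma> = s n"
        using eventually_ge_at_top[of 1] by eventually_elim (auto simp: s_def diff_divide_distrib)
    qed
    have "(\<lambda>n. (T n - sqrt (real n) * (a * (s n * E (s n) / (\<sigma> ^ 3 * S))) - H (s n)) * (1 / sqrt (real n))
        + H (s n) * (1 / sqrt (real n)) + a * (s n * E (s n) / (\<sigma> ^ 3 * S)))
      \<longlonglongrightarrow> 0 * 0 + 0 + a * (\<alpha> * \<sigma> * E (\<alpha> * \<sigma>) / (\<sigma> ^ 3 * S))"
      using \<sigma> S by (intro tendsto_add tendsto_mult star1 inv Hlim tendsto_divide sl Elim tendsto_const) auto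
    also have "0 * 0 + 0 + a * (\<alpha> * \<sigma> * E (\<alpha> * \<sigma>) / (\<sigma> ^ 3 * S)) = 1 / (S * \<sigma>\<^sup>2) * \<alpha> * exp (- \<alpha>\<^sup>2 / 2) * a"
    proof -
      have "E (\<alpha> * \<sigma>) = exp (- \<alpha>\<^sup>2 / 2)" unfolding E_def using \<sigma> by (simp add: power_mult_distrib)
      then show ?thesis using \<sigma> S by (simp add: field_simps power2_eq_square power3_eq_cube)
    qed
    finally show ?thesis unfolding S_def[symmetric]
    proof (rule Lim_transform_eventually)
      show "\<forall>\<^sub>F n in sequentially. (T n - sqrt (real n) * (a * (s n * E (s n) / (\<sigma> ^ 3 * S))) - H (s n)) * (1 / sqrt (real n))
        + H (s n) * (1 / sqrt (real n)) + a * (s n * E (s n) / (\<sigma> ^ 3 * S)) = real n * A n"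
        using eventually_ge_at_top[of 1]
      proof eventually_elim
        case (elim n)
        have dist: "(t - q * u - h) * (1 / q) + h * (1 / q) + u = t / q" if "q > 0" for t q u h :: real
          using that by (simp add: field_simps)
        show ?case unfolding dist[OF sq(1)[OF elim]]
          unfolding T_def sq(4)[OF elim] using sq(1)[OF elim] by simp
      qed
    qed
  qed
  show "(\<lambda>n. real n powr (3/2) / c n * A n) \<longlonglongrightarrow> 1 / (sqrt (2 * pi) * \<sigma> ^ 3) * a"
    if c: "filterlim c at_top sequentially" "c \<in> o(\<lambda>n. sqrt (real n))"
  proof -
    have ic: "(\<lambda>n. 1 / c n) \<longlonglongrightarrow> 0" using tendsto_inverse_0_at_top[OF c(1)] by (simp add: inverse_eq_divide)
    have "(\<lambda>n. (T n - sqrt (real n) * (a * (s n * E (s n) / (\<sigma> ^ 3 * S))) - H (s n)) * (1 / c n)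
        + H (s n) * (1 / c n) + a * (E (s n) / (\<sigma> ^ 3 * S)))
      \<longlonglongrightarrow> 0 * 0 + 0 + a * (E 0 / (\<sigma> ^ 3 * S))"
      using \<sigma> S by (intro tendsto_add tendsto_mult star1 ic Hlim tendsto_divide Elim slim0 c tendsto_const) auto
    also have "0 * 0 + 0 + a * (E 0 / (\<sigma> ^ 3 * S)) = 1 / (S * \<sigma> ^ 3) * a"
      by (simp add: E_def mult_ac)
    finally show ?thesis unfolding S_def[symmetric]
    proof (rule Lim_transform_eventually)
      have "\<forall>\<^sub>F n in sequentially. c n > 0" using c(1) by (simp add: filterlim_at_top_dense)
      then show "\<forall>\<^sub>F n in sequentially. (T n - sqrt (real n) * (a * (s n * E (s n) / (\<sigma> ^ 3 * S))) - H (s n)) * (1 / c n)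
        + H (s n) * (1 / c n) + a * (E (s n) / (\<sigma> ^ 3 * S)) = real n powr (3/2) / c n * A n"
        using eventually_ge_at_top[of 1]
      proof eventually_elim
        case (elim n)
        have dist: "(t - q * (a * (y * e / d)) - h) * (1 / (q * y)) + h * (1 / (q * y)) + a * (e / d) = t / (q * y)"
          if "q * y > 0" "d > 0" for t q y e d h :: real
        proof -
          have "q \<noteq> 0" "y \<noteq> 0" using that by auto
          then show ?thesis using that by (simp add: field_simps)
        qed
        have cq: "c n = sqrt (real n) * s n" using sq(3) elim by simp
        have "sqrt (real n) * s n > 0" using elim cq by simp
        moreover have "\<sigma> ^ 3 * S > 0" using \<sigma> S by simp
        ultimately show ?case unfolding cq by (subst dist) (simp_all add: T_def)
      qed
    qed
  qed
  show "(\<lambda>n. real n powr (3/2) * A n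
      - 1 / (sqrt (2 * pi) * \<sigma> ^ 3) * (a * (c n + \<kappa> / (2 * \<sigma>\<^sup>2)) - 1/2 * b)) \<longlonglongrightarrow> 0"
    if c: "Bseq c"
  proof -
    obtain D where D: "\<And>n. \<bar>c n\<bar> \<le> D" using c unfolding Bseq_def by auto
    have cnull: "(\<lambda>n. c n * y n) \<longlonglongrightarrow> 0" if "y \<longlonglongrightarrow> 0" for y :: "nat \<Rightarrow> real"
    proof (rule Lim_null_comparison)
      have "(\<lambda>n. D * \<bar>y n\<bar>) \<longlonglongrightarrow> D * 0" by (intro tendsto_mult_left tendsto_rabs_zero that)
      then show "(\<lambda>n. D * \<bar>y n\<bar>) \<longlonglongrightarrow> 0" by simp
      show "\<forall>\<^sub>F n in sequentially. norm (c n * y n) \<le> D * \<bar>y n\<bar>"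
        using D by (auto simp: abs_mult intro!: always_eventually mult_right_mono)
    qed
    have s0: "s \<longlonglongrightarrow> 0" using cnull[OF inv] by (simp add: s_def[abs_def])
    have E1: "(\<lambda>n. E (s n) - 1) \<longlonglongrightarrow> 0" using tendsto_diff[OF Elim[OF s0] tendsto_const[of 1]] by (simp add: E_def)
    have H0: "(\<lambda>n. H (s n)) \<longlonglongrightarrow> H 0"
      unfolding H_def using \<sigma> by (intro tendsto_intros tendsto_gaussint s0) auto
    \<comment> \<open>The fourth Gaussian moment brings a factor 3, and 3 / 6 = 1 / 2 is the origin
      of the correction \<kappa> / (2 \<sigma>^2).\<close>
    have "H 0 = (\<kappa> / 6 * a * (3 * S / \<sigma> ^ 5) - b / 2 * (S / \<sigma> ^ 3)) / (S * S)"
      unfolding H_def gaussint_moments[OF \<sigma>] S(2) S_def[symmetric] by simp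
    also have "\<dots> = 1 / (S * \<sigma> ^ 3) * (a * (\<kappa> / (2 * \<sigma>\<^sup>2)) - 1/2 * b)"
      using \<sigma> S(1) by (simp add: field_simps eval_nat_numeral)
    finally have H0v: "H 0 = 1 / (S * \<sigma> ^ 3) * (a * (\<kappa> / (2 * \<sigma>\<^sup>2)) - 1/2 * b)" .
    have "(\<lambda>n. (T n - sqrt (real n) * (a * (s n * E (s n) / (\<sigma> ^ 3 * S))) - H (s n)) + (H (s n) - H 0)
        + a / (\<sigma> ^ 3 * S) * (c n * (E (s n) - 1))) \<longlonglongrightarrow> 0 + (H 0 - H 0) + a / (\<sigma> ^ 3 * S) * 0"
      by (intro tendsto_add tendsto_mult_left tendsto_diff star1 H0 cnull E1 tendsto_const)
    then have "(\<lambda>n. (T n - sqrt (real n) * (a * (s n * E (s n) / (\<sigma> ^ 3 * S))) - H (s n)) + (H (s n) - H 0)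
        + a / (\<sigma> ^ 3 * S) * (c n * (E (s n) - 1))) \<longlonglongrightarrow> 0" by simp
    then show ?thesis unfolding S_def[symmetric]
    proof (rule Lim_transform_eventually)
      show "\<forall>\<^sub>F n in sequentially. (T n - sqrt (real n) * (a * (s n * E (s n) / (\<sigma> ^ 3 * S))) - H (s n)) + (H (s n) - H 0)
        + a / (\<sigma> ^ 3 * S) * (c n * (E (s n) - 1)) = real n powr (3/2) * A n
      - 1 / (S * \<sigma> ^ 3) * (a * (c n + \<kappa> / (2 * \<sigma>\<^sup>2)) - 1/2 * b)"
        using eventually_ge_at_top[of 1]
      proof eventually_elim
        case (elim n)
        have dist: "(t - q * (a * (y * e / d)) - h) + (h - 1 / d * (a * k - l)) + a / d * (q * y * (e - 1)) = t - 1 / d * (a * (q * y + k) - l)"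
          if "d > 0" for t q y e d h k l :: real
          using that by (simp add: field_simps)
        have "\<sigma> ^ 3 * S > 0" using \<sigma> S by simp
        then show ?case unfolding H0v T_def[symmetric] sq(3)[OF elim] mult.commute[of S "\<sigma> ^ 3"] by (rule dist)
      qed
    qed
  qed
qed

section \<open>The expansion along a fixed realisation\<close>

context brw_local
begin

abbreviation "line \<eta> \<equiv> Complex \<beta> \<eta>"

lemma line_sub: "line \<eta> - of_real \<beta> = \<i> * of_real \<eta>"
  by (simp add: complex_eq_iff)

lemma line_norm: "norm (line \<eta> - of_real \<beta>) = \<bar>\<eta>\<bar>"
  unfolding line_sub by (simp add: norm_mult)

text \<open>The quartic Taylor error must not destroy the Gaussian decay. \<delta> is chosen such
  that K \<delta>^2 \<le> \<sigma>^2 / 4, which leaves half of the exponent \<sigma>^2 \<eta>^2 / 2;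
  \<open>K + 1\<close> in its definition avoids division by 0.\<close>

lemma char_expansion:
  assumes F: "F holomorphic_on ball (of_real \<beta>) (2 * r)"
    and eF: "\<And>z. z \<in> ball (of_real \<beta>) (2 * r) \<Longrightarrow> exp (F z) = mC z"
    and Fx: "\<And>x. \<bar>x - \<beta>\<bar> < 2 * r \<Longrightarrow> F (of_real x) = of_real (phi M xi x)"
    and \<sigma>: "\<sigma> > 0" "\<sigma>\<^sup>2 = (deriv ^^ 2) (phi M xi) \<beta>"
  shows "\<exists>\<delta> K e. 0 < \<delta> \<and> \<delta> \<le> r / 4 \<and> \<delta> \<le> pi \<and> K \<ge> 0 \<and> (\<forall>\<eta>. \<bar>\<eta>\<bar> \<le> \<delta> \<longrightarrow>
     mC (line \<eta>) / of_real (mR \<beta>) = exp (\<i> * of_real (deriv (phi M xi) \<beta> * \<eta>) - of_real (\<sigma>\<^sup>2 * \<eta>\<^sup>2 / 2)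
       - \<i> * of_real ((deriv ^^ 3) (phi M xi) \<beta> * \<eta> ^ 3 / 6) + e \<eta>) \<and>
     norm (e \<eta>) \<le> K * \<bar>\<eta>\<bar> ^ 4 \<and> norm (mC (line \<eta>) / of_real (mR \<beta>)) \<le> exp (- (\<sigma>\<^sup>2 / 4) * \<eta>\<^sup>2))"
proof -
  have dF: "(deriv ^^ j) F (of_real \<beta>) = of_real ((deriv ^^ j) (phi M xi) \<beta>)" for j
    by (rule deriv_of_real_part[OF F Fx]) (use r in auto)
  obtain K where K: "K \<ge> 0" "\<And>z. norm (z - of_real \<beta>) \<le> r \<Longrightarrow>
      norm (F z - (\<Sum>i\<le>3. (deriv ^^ i) F (of_real \<beta>) * (z - of_real \<beta>) ^ i / fact i)) \<le> K * norm (z - of_real \<beta>) ^ Suc 3"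
    using holomorphic_taylor_bound[OF F, of r 3] r by auto
  define T where "T \<eta> = (\<Sum>i\<le>3. (deriv ^^ i) F (of_real \<beta>) * (line \<eta> - of_real \<beta>) ^ i / fact i)" for \<eta>
  define e where "e \<eta> = F (line \<eta>) - T \<eta>" for \<eta>
  define \<delta> where "\<delta> = min (min (r / 4) pi) (sqrt (\<sigma>\<^sup>2 / (4 * (K + 1))))"
  have "sqrt (\<sigma>\<^sup>2 / (4 * (K + 1))) > 0" using \<sigma>(1) K(1) by simp
  then have \<delta>: "0 < \<delta>" "\<delta> \<le> r / 4" "\<delta> \<le> pi" "\<delta> \<le> sqrt (\<sigma>\<^sup>2 / (4 * (K + 1)))" using r by (auto simp: \<delta>_def)
  have K\<delta>: "K * \<delta>\<^sup>2 \<le> \<sigma>\<^sup>2 / 4"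
  proof -
    have "\<delta>\<^sup>2 \<le> (sqrt (\<sigma>\<^sup>2 / (4 * (K + 1))))\<^sup>2" using \<delta> by (intro power_mono) auto
    also have "\<dots> = \<sigma>\<^sup>2 / (4 * (K + 1))" using K(1) by simp
    finally have "(K + 1) * \<delta>\<^sup>2 \<le> \<sigma>\<^sup>2 / 4" using K(1) by (simp add: field_simps)
    moreover have "K * \<delta>\<^sup>2 \<le> (K + 1) * \<delta>\<^sup>2" by (intro mult_right_mono) auto
    ultimately show ?thesis by linarith
  qed
  have T: "T \<eta> = of_real (phi M xi \<beta>) + (\<i> * of_real (deriv (phi M xi) \<beta> * \<eta>) - of_real (\<sigma>\<^sup>2 * \<eta>\<^sup>2 / 2)
       - \<i> * of_real ((deriv ^^ 3) (phi M xi) \<beta> * \<eta> ^ 3 / 6))" for \<eta>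
    unfolding T_def dF line_sub \<sigma> by (simp add: eval_nat_numeral fact_numeral algebra_simps)
  have main: "mC (line \<eta>) / of_real (mR \<beta>) = exp (\<i> * of_real (deriv (phi M xi) \<beta> * \<eta>) - of_real (\<sigma>\<^sup>2 * \<eta>\<^sup>2 / 2)
       - \<i> * of_real ((deriv ^^ 3) (phi M xi) \<beta> * \<eta> ^ 3 / 6) + e \<eta>) \<and>
     norm (e \<eta>) \<le> K * \<bar>\<eta>\<bar> ^ 4 \<and> norm (mC (line \<eta>) / of_real (mR \<beta>)) \<le> exp (- (\<sigma>\<^sup>2 / 4) * \<eta>\<^sup>2)" if \<eta>: "\<bar>\<eta>\<bar> \<le> \<delta>" for \<eta>
  proof (intro conjI)
    have zb: "line \<eta> \<in> ball (of_real \<beta>) (2 * r)"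
      using line_norm[of \<eta>] \<eta> \<delta> r by (simp add: dist_norm norm_minus_commute)
    have "complex_of_real (mR \<beta>) = exp (of_real (phi M xi \<beta>))"
      using m_pos by (simp add: phi_eq[OF fin\<beta>] exp_of_real)
    then have "mC (line \<eta>) / of_real (mR \<beta>) = exp (F (line \<eta>) - of_real (phi M xi \<beta>))"
      by (simp add: eF[OF zb, symmetric] exp_diff)
    also have "F (line \<eta>) - of_real (phi M xi \<beta>) = \<i> * of_real (deriv (phi M xi) \<beta> * \<eta>) - of_real (\<sigma>\<^sup>2 * \<eta>\<^sup>2 / 2)
       - \<i> * of_real ((deriv ^^ 3) (phi M xi) \<beta> * \<eta> ^ 3 / 6) + e \<eta>"
      unfolding e_def T by simp
    finally show eq: "mC (line \<eta>) / of_real (mR \<beta>) = exp (\<i> * of_real (deriv (phi M xi) \<beta> * \<eta>) - of_real (\<sigma>\<^sup>2 * \<eta>\<^sup>2 / 2)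
       - \<i> * of_real ((deriv ^^ 3) (phi M xi) \<beta> * \<eta> ^ 3 / 6) + e \<eta>)" .
    show e: "norm (e \<eta>) \<le> K * \<bar>\<eta>\<bar> ^ 4"
      using K(2)[of "line \<eta>"] line_norm[of \<eta>] \<eta> \<delta> r unfolding e_def T_def by simp
    have "norm (mC (line \<eta>) / of_real (mR \<beta>)) = exp (- (\<sigma>\<^sup>2 * \<eta>\<^sup>2 / 2) + Re (e \<eta>))"
      unfolding eq norm_exp_eq_Re by simp
    also have "\<dots> \<le> exp (- (\<sigma>\<^sup>2 / 4) * \<eta>\<^sup>2)"
    proof -
      have "Re (e \<eta>) \<le> K * \<bar>\<eta>\<bar> ^ 4" using complex_Re_le_cmod[of "e \<eta>"] e by linarith
      also have "\<dots> = K * \<bar>\<eta>\<bar>\<^sup>2 * \<eta>\<^sup>2" by (simp add: power4_eq_xxxx power2_eq_square)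
      also have "\<dots> \<le> K * \<delta>\<^sup>2 * \<eta>\<^sup>2" using \<eta> K(1) by (intro mult_right_mono mult_left_mono power_mono) auto
      also have "\<dots> \<le> \<sigma>\<^sup>2 / 4 * \<eta>\<^sup>2" by (intro mult_right_mono K\<delta>) simp
      finally have "Re (e \<eta>) \<le> \<sigma>\<^sup>2 / 4 * \<eta>\<^sup>2" .
      then show ?thesis by simp
    qed
    finally show "norm (mC (line \<eta>) / of_real (mR \<beta>)) \<le> exp (- (\<sigma>\<^sup>2 / 4) * \<eta>\<^sup>2)" .
  qed
  then show ?thesis using \<delta>(1-3) K(1) by blast
qed

lemma Wz_real: "\<bar>x - \<beta>\<bar> \<le> r \<Longrightarrow> Wz n (of_real x) w = of_real (Wn M xi n x w)"
proof -
  assume x: "\<bar>x - \<beta>\<bar> \<le> r"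
  have "Wn M xi n x w = psumr x (particles xi n w) * exp (- (phi M xi x * real n))"
    unfolding Wn_def psumr_def by (simp add: case_prod_unfold exp_diff exp_minus sum_divide_distrib field_simps)
  also have "exp (- (phi M xi x * real n)) = 1 / mR x ^ n"
    using mR_pos[OF fin[OF x]] by (simp add: phi_eq[OF fin[OF x]] exp_minus mult.commute exp_of_nat_mult inverse_eq_divide)
  finally show ?thesis unfolding Wz_def by (simp add: psum_of_real mC_of_real)
qed

text \<open>Everything random is evaluated at one \<open>w\<close>, with the almost sure estimates
  as hypotheses. Both error integrals decay geometrically, which outweighs the factor n^(3/2); the
  remaining integral is the one treated by \<open>laplace_expansion\<close>.\<close>

lemma pathwise_expansion:
  fixes k :: "nat \<Rightarrow> int"
  assumes \<sigma>: "\<sigma> > 0"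
    and \<delta>: "0 < \<delta>" "\<delta> \<le> r / 4" "\<delta> \<le> pi" and K: "K \<ge> 0"
    and f: "\<And>\<eta>. \<bar>\<eta>\<bar> \<le> \<delta> \<Longrightarrow> mC (line \<eta>) / of_real (mR \<beta>) = exp (\<i> * of_real (\<mu> * \<eta>) - of_real (\<sigma>\<^sup>2 * \<eta>\<^sup>2 / 2)
       - \<i> * of_real (\<kappa> * \<eta> ^ 3 / 6) + e \<eta>)"
    and e: "\<And>\<eta>. \<bar>\<eta>\<bar> \<le> \<delta> \<Longrightarrow> norm (e \<eta>) \<le> K * \<bar>\<eta>\<bar> ^ 4"
    and fb: "\<And>\<eta>. \<bar>\<eta>\<bar> \<le> \<delta> \<Longrightarrow> norm (mC (line \<eta>) / of_real (mR \<beta>)) \<le> exp (- (\<sigma>\<^sup>2 / 4) * \<eta>\<^sup>2)"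
    and \<rho>: "0 \<le> \<rho>" "\<rho> < 1" "\<And>\<eta>. \<delta> \<le> \<bar>\<eta>\<bar> \<Longrightarrow> \<bar>\<eta>\<bar> \<le> pi \<Longrightarrow> norm (mC (line \<eta>)) \<le> \<rho> * mR \<beta>"
    and W: "W holomorphic_on ball (of_real \<beta>) (r / 2)" "0 < \<rho>1" "\<rho>1 < 1"
      "\<And>n z. z \<in> ball (of_real \<beta>) (r / 2) \<Longrightarrow> norm (Wz n z w - W z) \<le> K1 * \<rho>1 ^ n"
    and tail: "0 < s" "s < 1" "K2 \<ge> 0" "\<And>n. (\<integral>\<^sup>+\<eta>. ennreal (norm (psum (line \<eta>) (particles xi n w)) * indicator {\<eta>. \<delta> \<le> \<bar>\<eta>\<bar> \<and> \<bar>\<eta>\<bar> \<le> pi} \<eta>) \<partial>lborel)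
       \<le> ennreal (K2 * (mR \<beta> * s) ^ n)"
    and Wi: "\<And>x. \<bar>x - \<beta>\<bar> < r / 2 \<Longrightarrow> (\<lambda>n. Wn M xi n x w) \<longlonglongrightarrow> Wi x"
  shows "(\<lambda>n. of_real (2 * pi * (real n powr (3/2) * (exp (\<beta> * real_of_int (k n) - phi M xi \<beta> * real n)
          * (Lcount xi n (k n) w - Wi \<beta> * (\<integral>v. Lcount xi n (k n) v \<partial>M)))))
     - of_real (sqrt (real n)) * (\<i> * of_real (deriv Wi \<beta>) * gaussint \<sigma> 1 ((real_of_int (k n) - \<mu> * real n) / sqrt (real n)))
     - (of_real (\<kappa> / 6) * of_real (deriv Wi \<beta>) * gaussint \<sigma> 4 ((real_of_int (k n) - \<mu> * real n) / sqrt (real n)) 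
       - of_real (deriv (deriv Wi) \<beta>) / 2 * gaussint \<sigma> 2 ((real_of_int (k n) - \<mu> * real n) / sqrt (real n)))) \<longlonglongrightarrow> 0"
proof -
  define m where "m = mR \<beta>"
  have m: "m > 0" using m_pos by (simp add: m_def)
  define g where "g \<eta> = mC (line \<eta>) / of_real m" for \<eta>
  define V where "V \<eta> = W (line \<eta>) - W (of_real \<beta>)" for \<eta>
  define X where "X n \<eta> = exp (- \<i> * of_real (\<eta> * real_of_int (k n)))" for n \<eta>
  define Z where "Z n \<eta> = psum (line \<eta>) (particles xi n w) / of_real m ^ n" for n \<eta>
  have nX: "norm (X n \<eta>) = 1" for n \<eta> by (simp add: X_def)
  have lb: "line \<eta> \<in> ball (of_real \<beta>) (r / 2)" if "\<bar>\<eta>\<bar> \<le> \<delta>" for \<eta>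
    using line_norm[of \<eta>] that \<delta> r by (simp add: dist_norm norm_minus_commute)
  \<comment> \<open>The holomorphic limit and the given pointwise limit agree on a real interval;
    therefore the real derivatives of \<open>Wi\<close> at \<beta> are the complex derivatives of
    \<open>W\<close>.\<close>
  have WWi: "W (of_real x) = of_real (Wi x)" if x: "\<bar>x - \<beta>\<bar> < r / 2" for x
  proof (rule LIMSEQ_unique)
    have xb: "of_real x \<in> ball (complex_of_real \<beta>) (r / 2)" using x by (simp add: dist_of_real dist_real_def abs_minus_commute)
    have "(\<lambda>n. Wz n (of_real x) w - W (of_real x)) \<longlonglongrightarrow> 0"
    proof (rule Lim_null_comparison)
      show "\<forall>\<^sub>F n in sequentially. norm (Wz n (of_real x) w - W (of_real x)) \<le> K1 * \<rho>1 ^ n" using W(4)[OF xb] by simp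
      have "(\<lambda>n. K1 * \<rho>1 ^ n) \<longlonglongrightarrow> K1 * 0" using W by (intro tendsto_mult_left LIMSEQ_realpow_zero) auto
      then show "(\<lambda>n. K1 * \<rho>1 ^ n) \<longlonglongrightarrow> 0" by simp
    qed
    then show "(\<lambda>n. Wz n (of_real x) w) \<longlonglongrightarrow> W (of_real x)" by (simp add: LIM_zero_iff)
    show "(\<lambda>n. Wz n (of_real x) w) \<longlonglongrightarrow> of_real (Wi x)"
    proof -
      have "\<bar>x - \<beta>\<bar> \<le> r" using x r by simp
      from Wz_real[OF this] show ?thesis using Wi[OF x] by (simp add: tendsto_of_real)
    qed
  qed
  have dW: "(deriv ^^ j) W (of_real \<beta>) = of_real ((deriv ^^ j) Wi \<beta>)" for j
    by (rule deriv_of_real_part[OF W(1) WWi]) (use r in auto)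
  define a b where "a = deriv Wi \<beta>" and "b = deriv (deriv Wi) \<beta>"
  obtain K' where K': "K' \<ge> 0" "\<And>z. norm (z - of_real \<beta>) \<le> r / 4 \<Longrightarrow>
      norm (W z - (\<Sum>i\<le>2. (deriv ^^ i) W (of_real \<beta>) * (z - of_real \<beta>) ^ i / fact i)) \<le> K' * norm (z - of_real \<beta>) ^ Suc 2"
    using holomorphic_taylor_bound[OF W(1), of "r / 4" 2] r by auto
  have Vb: "norm (V \<eta> - \<i> * of_real \<eta> * of_real a + of_real (\<eta>\<^sup>2 / 2) * of_real b) \<le> max K K' * \<bar>\<eta>\<bar> ^ 3" if \<eta>: "\<bar>\<eta>\<bar> \<le> \<delta>" for \<eta>
  proof -
    have "(\<Sum>i\<le>2. (deriv ^^ i) W (of_real \<beta>) * (line \<eta> - of_real \<beta>) ^ i / fact i) 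
      = W (of_real \<beta>) + \<i> * of_real \<eta> * of_real a - of_real (\<eta>\<^sup>2 / 2) * of_real b"
      unfolding dW line_sub by (simp add: eval_nat_numeral a_def b_def WWi r algebra_simps)
    then have "V \<eta> - \<i> * of_real \<eta> * of_real a + of_real (\<eta>\<^sup>2 / 2) * of_real b 
      = W (line \<eta>) - (\<Sum>i\<le>2. (deriv ^^ i) W (of_real \<beta>) * (line \<eta> - of_real \<beta>) ^ i / fact i)" by (simp add: V_def)
    also have "norm \<dots> \<le> K' * \<bar>\<eta>\<bar> ^ Suc 2" using K'(2)[of "line \<eta>"] \<eta> \<delta> unfolding line_norm by simp
    also have "\<dots> \<le> max K K' * \<bar>\<eta>\<bar> ^ Suc 2" by (intro mult_right_mono) auto
    finally show ?thesis by (simp add: eval_nat_numeral)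
  qed
  have lc: "continuous_on A (Complex \<beta>)" for A unfolding Complex_eq by (intro continuous_intros)
  have gc: "continuous_on A g" for A
    unfolding g_def using m by (intro continuous_intros continuous_on_subset[OF line_continuous]) auto
  have Zc: "continuous_on A (Z n)" for A n
    unfolding Z_def psum_def using m by (intro continuous_intros lc) auto
  have Xc: "continuous_on A (X n)" for A n unfolding X_def by (intro continuous_intros)
  have Vc: "continuous_on {-\<delta>..\<delta>} V"
    unfolding V_def
    by (intro continuous_intros continuous_on_compose2[OF holomorphic_on_imp_continuous_on[OF W(1)] lc]) (use lb in auto)
  have J: "(\<lambda>n. of_real (real n powr (3/2)) * 
       (LINT \<eta>|lborel. indicator {-\<delta>..\<delta>} \<eta> *\<^sub>R (g \<eta> ^ n * V \<eta> * exp (- \<i> * of_real (\<eta> * real_of_int (k n)))))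
     - of_real (sqrt (real n)) * (\<i> * of_real a * gaussint \<sigma> 1 ((real_of_int (k n) - \<mu> * real n) / sqrt (real n)))
     - (of_real (\<kappa> / 6) * of_real a * gaussint \<sigma> 4 ((real_of_int (k n) - \<mu> * real n) / sqrt (real n)) 
      - of_real b / 2 * gaussint \<sigma> 2 ((real_of_int (k n) - \<mu> * real n) / sqrt (real n)))) \<longlonglongrightarrow> 0"
  proof (rule laplace_expansion[where c = "\<sigma>\<^sup>2 / 4" and K = "max K K'" and e = e])
    show "norm (e \<eta>) \<le> max K K' * \<bar>\<eta>\<bar> ^ 4" if "\<bar>\<eta>\<bar> \<le> \<delta>" for \<eta>
      using e[OF that] by (rule order_trans) (intro mult_right_mono, auto)
    show "norm (V \<eta> - \<i> * of_real \<eta> * of_real a + of_real (\<eta>\<^sup>2 / 2) * of_real b) \<le> max K K' * \<bar>\<eta>\<bar> ^ 3" if "\<bar>\<eta>\<bar> \<le> \<delta>" for \<eta>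
      by (rule Vb[OF that])
    show "g \<eta> = exp (\<i> * of_real (\<mu> * \<eta>) - of_real (\<sigma>\<^sup>2 * \<eta>\<^sup>2 / 2) - \<i> * of_real (\<kappa> * \<eta> ^ 3 / 6) + e \<eta>)" if "\<bar>\<eta>\<bar> \<le> \<delta>" for \<eta>
      unfolding g_def m_def by (rule f[OF that])
    show "norm (g \<eta>) \<le> exp (- (\<sigma>\<^sup>2 / 4) * \<eta>\<^sup>2)" if "\<bar>\<eta>\<bar> \<le> \<delta>" for \<eta>
      unfolding g_def m_def by (rule fb[OF that])
    show "continuous_on {- \<delta>..\<delta>} g" by (rule gc)
    show "continuous_on {- \<delta>..\<delta>} V" by (rule Vc)
    show "0 < \<delta>" "0 < \<sigma>" "0 < \<sigma>\<^sup>2 / 4" "0 \<le> max K K'" using \<delta> \<sigma> K by auto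
  qed
  define J where "J n = (LINT \<eta>|lborel. indicator {-\<delta>..\<delta>} \<eta> *\<^sub>R (g \<eta> ^ n * V \<eta> * X n \<eta>))" for n
  define E1 where "E1 n = (LINT \<eta>|lborel. indicator {-\<delta>..\<delta>} \<eta> *\<^sub>R ((Z n \<eta> - g \<eta> ^ n * W (line \<eta>)) * X n \<eta>))" for n
  define E2 where "E2 n = (LINT \<eta>|lborel. indicator ({-pi..pi} - {-\<delta>..\<delta>}) \<eta> *\<^sub>R ((Z n \<eta> - W (of_real \<beta>) * g \<eta> ^ n) * X n \<eta>))" for n
  define Q where "Q n = exp (\<beta> * real_of_int (k n) - phi M xi \<beta> * real n)
          * (Lcount xi n (k n) w - Wi \<beta> * (\<integral>v. Lcount xi n (k n) v \<partial>M))" for n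
  have intc: "integrable lborel (\<lambda>\<eta>. indicator {u..v} \<eta> *\<^sub>R h \<eta>)" if "continuous_on {u..v} h" for h :: "real \<Rightarrow> complex" and u v
    using borel_integrable_atLeastAtMost'[OF that] by (simp add: set_integrable_def)
  have i1: "integrable lborel (\<lambda>\<eta>. indicator {-\<delta>..\<delta>} \<eta> *\<^sub>R (g \<eta> ^ n * V \<eta> * X n \<eta>))" for n
    by (intro intc continuous_intros gc Vc Xc)
  have Wlc: "continuous_on {-\<delta>..\<delta>} (\<lambda>\<eta>. W (line \<eta>))"
    by (intro continuous_on_compose2[OF holomorphic_on_imp_continuous_on[OF W(1)] lc]) (use lb in auto)
  have i2: "integrable lborel (\<lambda>\<eta>. indicator {-\<delta>..\<delta>} \<eta> *\<^sub>R ((Z n \<eta> - g \<eta> ^ n * W (line \<eta>)) * X n \<eta>))" for n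
    by (intro intc continuous_intros gc Wlc Xc Zc)
  have i4: "integrable lborel (\<lambda>\<eta>. indicator {u..v} \<eta> *\<^sub>R ((Z n \<eta> - W (of_real \<beta>) * g \<eta> ^ n) * X n \<eta>))" for n u v
    by (intro intc continuous_intros gc Xc Zc)
  have indd: "indicator ({-pi..pi} - {-\<delta>..\<delta>}) \<eta> = (indicator {-pi..pi} \<eta> - indicator {-\<delta>..\<delta>} \<eta> :: real)" for \<eta>
    using \<delta> by (auto simp: indicator_def)
  have i3: "integrable lborel (\<lambda>\<eta>. indicator ({-pi..pi} - {-\<delta>..\<delta>}) \<eta> *\<^sub>R ((Z n \<eta> - W (of_real \<beta>) * g \<eta> ^ n) * X n \<eta>))" for n
    unfolding indd scaleR_diff_left by (intro Bochner_Integration.integrable_diff i4)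
  \<comment> \<open>Near 0 the integrand Z_n - W(\<beta>) g^n is split into g^n (W - W(\<beta>)),
    the main term, and Z_n - g^n W, an error; far from 0 all of it is an error.\<close>
  have decomp: "of_real (2 * pi * Q n) = J n + E1 n + E2 n" for n
  proof -
    have pw: "indicator {-pi..pi} \<eta> *\<^sub>R ((Z n \<eta> - W (of_real \<beta>) * g \<eta> ^ n) * X n \<eta>) = 
      indicator {-\<delta>..\<delta>} \<eta> *\<^sub>R (g \<eta> ^ n * V \<eta> * X n \<eta>) + indicator {-\<delta>..\<delta>} \<eta> *\<^sub>R ((Z n \<eta> - g \<eta> ^ n * W (line \<eta>)) * X n \<eta>)
      + indicator ({-pi..pi} - {-\<delta>..\<delta>}) \<eta> *\<^sub>R ((Z n \<eta> - W (of_real \<beta>) * g \<eta> ^ n) * X n \<eta>)" for \<eta>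
    proof -
      have e: "g \<eta> ^ n * V \<eta> * X n \<eta> + (Z n \<eta> - g \<eta> ^ n * W (line \<eta>)) * X n \<eta> = (Z n \<eta> - W (of_real \<beta>) * g \<eta> ^ n) * X n \<eta>"
        by (simp add: V_def algebra_simps)
      show ?thesis unfolding indd scaleR_diff_left scaleR_add_right[symmetric] e by simp
    qed
    have "J n + E1 n + E2 n = (LINT \<eta>|lborel. indicator {-pi..pi} \<eta> *\<^sub>R ((Z n \<eta> - W (of_real \<beta>) * g \<eta> ^ n) * X n \<eta>))"
      unfolding pw J_def E1_def E2_def Bochner_Integration.integral_add[OF Bochner_Integration.integrable_add[OF i1 i2] i3]
        Bochner_Integration.integral_add[OF i1 i2] by (rule refl)
    also have "\<dots> = (LINT \<eta>|lborel. (1 / of_real m ^ n) * (indicator {-pi..pi} \<eta> *\<^sub>R (psum (line \<eta>) (particles xi n w) * X n \<eta>))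
        - (W (of_real \<beta>) / of_real m ^ n) * (indicator {-pi..pi} \<eta> *\<^sub>R (mC (line \<eta>) ^ n * X n \<eta>)))"
      by (intro Bochner_Integration.integral_cong refl)
        (simp add: Z_def g_def power_divide algebra_simps scaleR_diff_right)
    also have "\<dots> = (1 / of_real m ^ n) * (LINT \<eta>|lborel. indicator {-pi..pi} \<eta> *\<^sub>R (psum (line \<eta>) (particles xi n w) * X n \<eta>))
        - (W (of_real \<beta>) / of_real m ^ n) * (LINT \<eta>|lborel. indicator {-pi..pi} \<eta> *\<^sub>R (mC (line \<eta>) ^ n * X n \<eta>))"
    proof -
      have pc: "continuous_on A (\<lambda>\<eta>. psum (line \<eta>) (particles xi n w))" for A
        unfolding psum_def by (intro continuous_intros lc)
      have mc: "continuous_on A (\<lambda>\<eta>. mC (line \<eta>))" for A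
        by (rule continuous_on_subset[OF line_continuous]) simp
      show ?thesis
        by (subst Bochner_Integration.integral_diff)
           (intro integrable_mult_right intc continuous_intros pc mc Xc, intro integrable_mult_right intc continuous_intros pc mc Xc,
            simp only: integral_mult_right_zero)
    qed
    also have "\<dots> = (1 / of_real m ^ n) * of_real (2 * pi * exp (\<beta> * of_int (k n)) * Lcount xi n (k n) w)
        - (W (of_real \<beta>) / of_real m ^ n) * of_real (2 * pi * exp (\<beta> * of_int (k n)) * (\<integral>v. Lcount xi n (k n) v \<partial>M))"
      unfolding X_def Lcount_fourier Lcount_mean_fourier ..
    also have "\<dots> = of_real (2 * pi * (exp (\<beta> * of_int (k n)) / m ^ n * (Lcount xi n (k n) w - Wi \<beta> * (\<integral>v. Lcount xi n (k n) v \<partial>M))))"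
      using WWi[of \<beta>] r m by (simp add: field_simps)
    also have "exp (\<beta> * of_int (k n)) / m ^ n = exp (\<beta> * real_of_int (k n) - phi M xi \<beta> * real n)"
    proof -
      have "exp (phi M xi \<beta> * real n) = m ^ n"
        using m by (simp add: phi_eq[OF fin\<beta>] m_def mult.commute exp_of_nat_mult)
      then show ?thesis by (simp add: exp_diff)
    qed
    finally show ?thesis unfolding Q_def by simp
  qed
  have g1: "norm (g \<eta>) \<le> 1" if "\<bar>\<eta>\<bar> \<le> \<delta>" for \<eta>
  proof -
    have "norm (g \<eta>) \<le> exp (- (\<sigma>\<^sup>2 / 4) * \<eta>\<^sup>2)" unfolding g_def m_def by (rule fb[OF that])
    also have "\<dots> \<le> 1" by simp
    finally show ?thesis .
  qed
  have K1: "K1 \<ge> 0"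
  proof -
    have "0 \<le> norm (Wz 0 (of_real \<beta>) w - W (of_real \<beta>))" by simp
    also have "\<dots> \<le> K1 * \<rho>1 ^ 0" using r by (intro W(4)) auto
    finally show ?thesis by simp
  qed
  have E1b: "norm (E1 n) \<le> K1 * \<rho>1 ^ n * (2 * \<delta>)" for n
  proof -
    have "norm (E1 n) \<le> (LINT \<eta>|lborel. indicator {-\<delta>..\<delta>} \<eta> *\<^sub>R (K1 * \<rho>1 ^ n))"
      unfolding E1_def
    proof (rule order_trans[OF integral_norm_bound integral_mono])
      show "integrable lborel (\<lambda>\<eta>. norm (indicator {-\<delta>..\<delta>} \<eta> *\<^sub>R ((Z n \<eta> - g \<eta> ^ n * W (line \<eta>)) * X n \<eta>)))"
        using i2 by (rule integrable_norm)
      show "integrable lborel (\<lambda>\<eta>. indicator {-\<delta>..\<delta>} \<eta> *\<^sub>R (K1 * \<rho>1 ^ n))"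
        using borel_integrable_atLeastAtMost'[of "-\<delta>" \<delta> "\<lambda>_. K1 * \<rho>1 ^ n"] by (simp add: set_integrable_def)
      fix \<eta> :: real
      show "norm (indicator {-\<delta>..\<delta>} \<eta> *\<^sub>R ((Z n \<eta> - g \<eta> ^ n * W (line \<eta>)) * X n \<eta>)) \<le> indicator {-\<delta>..\<delta>} \<eta> *\<^sub>R (K1 * \<rho>1 ^ n)"
      proof (cases "\<eta> \<in> {-\<delta>..\<delta>}")
        case True
        then have \<eta>: "\<bar>\<eta>\<bar> \<le> \<delta>" by auto
        have "mC (line \<eta>) \<noteq> 0" by (rule mC0) (use lb[OF \<eta>] r in auto)
        \<comment> \<open>Near \<beta> division by m(z)^n is permitted, so the uniform convergence
          of \<open>Wz\<close> applies; the factor g^n is harmless since |g| \<le> 1.\<close>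
        then have "Z n \<eta> - g \<eta> ^ n * W (line \<eta>) = g \<eta> ^ n * (Wz n (line \<eta>) w - W (line \<eta>))"
          using m unfolding Z_def g_def Wz_def by (simp add: power_divide field_simps)
        also have "norm \<dots> \<le> 1 * (K1 * \<rho>1 ^ n)"
          unfolding norm_mult norm_power by (intro mult_mono power_le_one g1 \<eta> W(4) lb) auto
        finally show ?thesis using True by (simp add: norm_mult nX)
      qed simp
    qed
    also have "\<dots> = K1 * \<rho>1 ^ n * (2 * \<delta>)" using \<delta> by simp
    finally show ?thesis .
  qed
  have E2b: "norm (E2 n) \<le> K2 * s ^ n + norm (W (of_real \<beta>)) * \<rho> ^ n * (2 * pi)" for n
  proof -
    let ?A = "{\<eta>. \<delta> \<le> \<bar>\<eta>\<bar> \<and> \<bar>\<eta>\<bar> \<le> pi}"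
    let ?p = "\<lambda>\<eta>. norm (psum (line \<eta>) (particles xi n w))"
    have "ennreal (norm (E2 n)) \<le> (\<integral>\<^sup>+\<eta>. ennreal (norm (indicator ({-pi..pi} - {-\<delta>..\<delta>}) \<eta> *\<^sub>R ((Z n \<eta> - W (of_real \<beta>) * g \<eta> ^ n) * X n \<eta>))) \<partial>lborel)"
      unfolding E2_def by (rule integral_norm_bound_ennreal[OF i3])
    also have "\<dots> \<le> (\<integral>\<^sup>+\<eta>. ennreal (1 / m ^ n) * ennreal (?p \<eta> * indicator ?A \<eta>) + ennreal (norm (W (of_real \<beta>)) * \<rho> ^ n) * indicator {-pi..pi} \<eta> \<partial>lborel)"
    proof (rule nn_integral_mono)
      fix \<eta> :: real
      show "ennreal (norm (indicator ({-pi..pi} - {-\<delta>..\<delta>}) \<eta> *\<^sub>R ((Z n \<eta> - W (of_real \<beta>) * g \<eta> ^ n) * X n \<eta>)))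
        \<le> ennreal (1 / m ^ n) * ennreal (?p \<eta> * indicator ?A \<eta>) + ennreal (norm (W (of_real \<beta>)) * \<rho> ^ n) * indicator {-pi..pi} \<eta>"
      proof (cases "\<eta> \<in> {-pi..pi} - {-\<delta>..\<delta>}")
        case True
        then have \<eta>: "\<delta> \<le> \<bar>\<eta>\<bar>" "\<bar>\<eta>\<bar> \<le> pi" by auto
        then have ind: "indicator ?A \<eta> = (1::real)" "indicator {-pi..pi} \<eta> = (1::ennreal)" using True by auto
        have "norm (g \<eta>) \<le> \<rho>" using \<rho>(3)[OF \<eta>] m by (simp add: g_def norm_divide m_def field_simps)
        then have gn: "norm (g \<eta>) ^ n \<le> \<rho> ^ n" by (intro power_mono) auto
        have "norm (indicator ({-pi..pi} - {-\<delta>..\<delta>}) \<eta> *\<^sub>R ((Z n \<eta> - W (of_real \<beta>) * g \<eta> ^ n) * X n \<eta>)) = norm (Z n \<eta> - W (of_real \<beta>) * g \<eta> ^ n)"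
          unfolding indicator_simps(1)[OF True] by (simp add: norm_mult nX)
        also have "\<dots> \<le> norm (Z n \<eta>) + norm (W (of_real \<beta>) * g \<eta> ^ n)" by (rule norm_triangle_ineq4)
        also have "\<dots> \<le> 1 / m ^ n * ?p \<eta> + norm (W (of_real \<beta>)) * \<rho> ^ n"
          unfolding norm_mult norm_power using m gn
          by (intro add_mono mult_left_mono) (auto simp: Z_def norm_divide norm_power)
        finally have "ennreal (norm (indicator ({-pi..pi} - {-\<delta>..\<delta>}) \<eta> *\<^sub>R ((Z n \<eta> - W (of_real \<beta>) * g \<eta> ^ n) * X n \<eta>)))
          \<le> ennreal (1 / m ^ n * ?p \<eta> + norm (W (of_real \<beta>)) * \<rho> ^ n)" by (rule ennreal_leI)
        also have "\<dots> = ennreal (1 / m ^ n) * ennreal (?p \<eta>) + ennreal (norm (W (of_real \<beta>)) * \<rho> ^ n)"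
          using m \<rho> by (simp add: ennreal_mult[symmetric] ennreal_plus[symmetric] del: ennreal_plus)
        finally show ?thesis unfolding ind by simp
      next
        case False
        show ?thesis unfolding indicator_simps(2)[OF False] by simp
      qed
    qed
    also have "\<dots> = ennreal (1 / m ^ n) * (\<integral>\<^sup>+\<eta>. ennreal (?p \<eta> * indicator ?A \<eta>) \<partial>lborel) + ennreal (norm (W (of_real \<beta>)) * \<rho> ^ n) * ennreal (2 * pi)"
    proof -
      have "?A = {-pi..-\<delta>} \<union> {\<delta>..pi}" using \<delta> by auto
      then have [measurable]: "?A \<in> sets lborel" by simp
      have "continuous_on UNIV ?p" unfolding psum_def by (intro continuous_intros lc)
      then have [measurable]: "?p \<in> borel_measurable lborel" using borel_measurable_continuous_onI by simp
      have 1: "(\<lambda>\<eta>. ennreal (?p \<eta> * indicator ?A \<eta>)) \<in> borel_measurable lborel" by measurable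
      show ?thesis
        by (subst nn_integral_add) (use 1 in \<open>auto simp: nn_integral_cmult\<close>)
    qed
    also have "\<dots> \<le> ennreal (1 / m ^ n) * ennreal (K2 * (m * s) ^ n) + ennreal (norm (W (of_real \<beta>)) * \<rho> ^ n) * ennreal (2 * pi)"
      using tail(4)[of n] unfolding m_def by (intro add_right_mono mult_left_mono) auto
    also have "\<dots> = ennreal (K2 * s ^ n + norm (W (of_real \<beta>)) * \<rho> ^ n * (2 * pi))"
    proof -
      have "1 / m ^ n * (K2 * (m * s) ^ n) = K2 * s ^ n" using m by (simp add: power_mult_distrib)
      then show ?thesis using m tail \<rho>
        by (simp add: ennreal_mult[symmetric] ennreal_plus[symmetric] del: ennreal_plus)
    qed
    finally show ?thesis using tail \<rho> by (subst (asm) ennreal_le_iff) auto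
  qed
  \<comment> \<open>The rate 0 is treated apart, since \<open>\<rho>\<close> may be 0.\<close>
  have geo: "(\<lambda>n. real n powr (3/2) * y ^ n) \<longlonglongrightarrow> 0" if "0 \<le> y" "y < 1" for y :: real
  proof (cases "y = 0")
    case True
    have "\<forall>\<^sub>F n in sequentially. real n powr (3/2) * y ^ n = 0"
      using eventually_ge_at_top[of 1] by eventually_elim (simp add: True)
    then show ?thesis by (rule tendsto_eventually)
  next
    case False
    then show ?thesis using that by real_asymp
  qed
  have err: "(\<lambda>n. of_real (real n powr (3/2)) * (E1 n + E2 n)) \<longlonglongrightarrow> 0"
  proof (rule Lim_null_comparison)
    show "\<forall>\<^sub>F n in sequentially. norm (of_real (real n powr (3/2)) * (E1 n + E2 n)) \<le>
       (K1 * (2 * \<delta>)) * (real n powr (3/2) * \<rho>1 ^ n) + K2 * (real n powr (3/2) * s ^ n) + (norm (W (of_real \<beta>)) * (2 * pi)) * (real n powr (3/2) * \<rho> ^ n)"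
    proof (intro always_eventually allI)
      fix n
      have "norm (of_real (real n powr (3/2)) * (E1 n + E2 n)) = real n powr (3/2) * norm (E1 n + E2 n)" by (simp add: norm_mult)
      also have "\<dots> \<le> real n powr (3/2) * (K1 * \<rho>1 ^ n * (2 * \<delta>) + (K2 * s ^ n + norm (W (of_real \<beta>)) * \<rho> ^ n * (2 * pi)))"
        by (intro mult_left_mono order_trans[OF norm_triangle_ineq] add_mono E1b E2b) auto
      finally show "norm (of_real (real n powr (3/2)) * (E1 n + E2 n)) \<le>
       (K1 * (2 * \<delta>)) * (real n powr (3/2) * \<rho>1 ^ n) + K2 * (real n powr (3/2) * s ^ n) + (norm (W (of_real \<beta>)) * (2 * pi)) * (real n powr (3/2) * \<rho> ^ n)"
        by (simp add: algebra_simps)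
    qed
    have "(\<lambda>n. (K1 * (2 * \<delta>)) * (real n powr (3/2) * \<rho>1 ^ n) + K2 * (real n powr (3/2) * s ^ n) + (norm (W (of_real \<beta>)) * (2 * pi)) * (real n powr (3/2) * \<rho> ^ n))
      \<longlonglongrightarrow> K1 * (2 * \<delta>) * 0 + K2 * 0 + norm (W (of_real \<beta>)) * (2 * pi) * 0"
      using W \<rho> tail by (intro tendsto_add tendsto_mult_left geo) auto
    then show "(\<lambda>n. (K1 * (2 * \<delta>)) * (real n powr (3/2) * \<rho>1 ^ n) + K2 * (real n powr (3/2) * s ^ n) + (norm (W (of_real \<beta>)) * (2 * pi)) * (real n powr (3/2) * \<rho> ^ n)) \<longlonglongrightarrow> 0"
      by simp
  qed
  have fin_eq: "of_real (2 * pi * (real n powr (3/2) * Q n)) - G1 - G2 = (of_real (real n powr (3/2)) * J n - G1 - G2) + of_real (real n powr (3/2)) * (E1 n + E2 n)" for n G1 G2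
  proof -
    have "complex_of_real (2 * pi * (real n powr (3/2) * Q n)) = of_real (real n powr (3/2)) * of_real (2 * pi * Q n)" by simp
    then show ?thesis unfolding decomp by (simp add: algebra_simps)
  qed
  show ?thesis
    unfolding Q_def[symmetric] fin_eq a_def[symmetric] b_def[symmetric]
    using tendsto_add[OF J[folded X_def, folded J_def] err] by simp
qed

end

theorem theorem2p13:
  fixes M :: "'a measure" and xi :: "nat list \<Rightarrow> 'a \<Rightarrow> int list"
    and Winf :: "real \<Rightarrow> 'a \<Rightarrow> real" and \<beta> :: real and k :: "nat \<Rightarrow> int"
  assumes P: "prob_space M"
    and iid_indep: "prob_space.indep_vars M (\<lambda>_. count_space UNIV) xi UNIV"
    and iid_distr: "\<And>u. distr M (count_space UNIV) (xi u) = distr M (count_space UNIV) (xi [])"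
    and A: "\<exists>k1 k2. k1 \<noteq> k2 \<and> (\<integral>w. Lcount xi 1 k1 w \<partial>M) > 0 \<and> (\<integral>w. Lcount xi 1 k2 w \<partial>M) > 0"
    and B1: "AE w in M. Npart xi 1 w \<noteq> 0"
    and B2: "integrable M (Npart xi 1)" and B3: "(\<integral>w. Npart xi 1 w \<partial>M) > 1"
    and C: "\<exists>a b. a < 0 \<and> 0 < b \<and> {a<..<b} \<subseteq> {\<beta>. phi_finite M xi \<beta>}"
    and D: "\<exists>p>1. \<forall>K. compact K \<and> K \<subseteq> Ibeta M xi \<longrightarrow>
              (SUP b\<in>K. \<integral>\<^sup>+ w. ennreal (Wn M xi 1 b w powr p) \<partial>M) < \<infinity>"
    and E: "\<forall>h a :: int. h \<ge> 2 \<longrightarrow>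
              \<not> (\<forall>j. (\<integral>w. Lcount xi 1 j w \<partial>M) > 0 \<longrightarrow> h dvd (j - a))"
    and Winf: "AE w in M. \<forall>b\<in>Ibeta M xi. (\<lambda>n. Wn M xi n b w) \<longlonglongrightarrow> Winf b w"
    and beta: "\<beta> \<in> Ibeta M xi"
    and cO: "(\<lambda>n. real_of_int (k n) - deriv (phi M xi) \<beta> * real n) \<in> O(\<lambda>n. sqrt (real n))"
  shows
   "(\<forall>\<alpha>::real.
      (\<lambda>n. real_of_int (k n) - deriv (phi M xi) \<beta> * real n - \<alpha> * sigma_brw M xi \<beta> * sqrt (real n))
         \<in> o(\<lambda>n. sqrt (real n)) \<longrightarrow>
      (AE w in M. (\<lambda>n. real n * exp (\<beta> * real_of_int (k n) - phi M xi \<beta> * real n)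
                        * Lcirc M xi Winf \<beta> n (k n) w)
         \<longlonglongrightarrow> 1 / (sqrt (2 * pi) * (sigma_brw M xi \<beta>)\<^sup>2) * \<alpha> * exp (- \<alpha>\<^sup>2 / 2)
              * deriv (\<lambda>b. Winf b w) \<beta>))
    \<and>
    (filterlim (\<lambda>n. real_of_int (k n) - deriv (phi M xi) \<beta> * real n) at_top sequentially \<and>
     (\<lambda>n. real_of_int (k n) - deriv (phi M xi) \<beta> * real n) \<in> o(\<lambda>n. sqrt (real n)) \<longrightarrow>
      (AE w in M. (\<lambda>n. real n powr (3/2) / (real_of_int (k n) - deriv (phi M xi) \<beta> * real n)
                        * exp (\<beta> * real_of_int (k n) - phi M xi \<beta> * real n)
                        * Lcirc M xi Winf \<beta> n (k n) w)
         \<longlonglongrightarrow> 1 / (sqrt (2 * pi) * (sigma_brw M xi \<beta>) ^ 3) * deriv (\<lambda>b. Winf b w) \<beta>))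
    \<and>
    (Bseq (\<lambda>n. real_of_int (k n) - deriv (phi M xi) \<beta> * real n) \<longrightarrow>
      (AE w in M. (\<lambda>n. real n powr (3/2) * exp (\<beta> * real_of_int (k n) - phi M xi \<beta> * real n)
                        * Lcirc M xi Winf \<beta> n (k n) w
                     - 1 / (sqrt (2 * pi) * (sigma_brw M xi \<beta>) ^ 3)
                       * (deriv (\<lambda>b. Winf b w) \<beta>
                            * ((real_of_int (k n) - deriv (phi M xi) \<beta> * real n)
                               + kappa3 M xi \<beta> / (2 * (sigma_brw M xi \<beta>)\<^sup>2))
                          - 1/2 * deriv (deriv (\<lambda>b. Winf b w)) \<beta>))
         \<longlonglongrightarrow> 0))"
proof -
  let ?\<mu> = "deriv (phi M xi) \<beta>" and ?c = "\<lambda>n. real_of_int (k n) - deriv (phi M xi) \<beta> * real n"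
  let ?A = "\<lambda>w n. exp (\<beta> * real_of_int (k n) - phi M xi \<beta> * real n) * Lcirc M xi Winf \<beta> n (k n) w"
  obtain k1 k2 where k12: "k1 \<noteq> k2" "(\<integral>w. Lcount xi 1 k1 w \<partial>M) > 0" "(\<integral>w. Lcount xi 1 k2 w \<partial>M) > 0" using A by blast
  interpret prob_space M by (rule P)
  interpret N: brw_nd M xi k1 k2
    by unfold_locales (rule iid_indep iid_distr k12)+
  obtain r p q C F where loc: "brw_local M xi k1 k2 \<beta> r p q C" and F: "F holomorphic_on ball (of_real \<beta>) (2 * r)"
    and eF: "\<And>z. z \<in> ball (of_real \<beta>) (2 * r) \<Longrightarrow> exp (F z) = N.mC z"
    and Fx: "\<And>x. \<bar>x - \<beta>\<bar> < 2 * r \<Longrightarrow> F (of_real x) = of_real (phi M xi x)"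
    and rI: "{\<beta> - r..\<beta> + r} \<subseteq> Ibeta M xi"
    using N.local_setup_exists[OF beta D] by blast
  interpret L: brw_local M xi k1 k2 \<beta> r p q C by (rule loc)
  have \<beta>D: "\<beta> \<in> Dphi M xi" using N.Ibeta_beta_set[OF beta] by blast
  define \<sigma> where "\<sigma> = sigma_brw M xi \<beta>"
  have d2: "(deriv ^^ 2) (phi M xi) \<beta> > 0" by (rule N.phi_second_deriv_pos[OF \<beta>D])
  have \<sigma>: "\<sigma> > 0" "\<sigma>\<^sup>2 = (deriv ^^ 2) (phi M xi) \<beta>"
    using d2 by (simp_all add: \<sigma>_def sigma_brw_def eval_nat_numeral)
  obtain \<delta> K e where \<delta>: "0 < \<delta>" "\<delta> \<le> r / 4" "\<delta> \<le> pi" and K: "K \<ge> 0"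
    and exp: "\<And>\<eta>. \<bar>\<eta>\<bar> \<le> \<delta> \<Longrightarrow>
     N.mC (Complex \<beta> \<eta>) / of_real (N.mR \<beta>) = exp (\<i> * of_real (?\<mu> * \<eta>) - of_real (\<sigma>\<^sup>2 * \<eta>\<^sup>2 / 2)
       - \<i> * of_real (kappa3 M xi \<beta> * \<eta> ^ 3 / 6) + e \<eta>)"
     "\<And>\<eta>. \<bar>\<eta>\<bar> \<le> \<delta> \<Longrightarrow> norm (e \<eta>) \<le> K * \<bar>\<eta>\<bar> ^ 4" 
     "\<And>\<eta>. \<bar>\<eta>\<bar> \<le> \<delta> \<Longrightarrow> norm (N.mC (Complex \<beta> \<eta>) / of_real (N.mR \<beta>)) \<le> exp (- (\<sigma>\<^sup>2 / 4) * \<eta>\<^sup>2)"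
    using L.char_expansion[OF F eF Fx \<sigma>] unfolding kappa3_def by blast
  have strict: "norm (N.mC (Complex \<beta> \<eta>)) < N.mR \<beta>" if "\<delta> \<le> \<bar>\<eta>\<bar>" "\<bar>\<eta>\<bar> \<le> pi" for \<eta>
    by (rule N.norm_mC_less[OF L.fin\<beta> E]) (use that \<delta> in auto)
  obtain s \<rho> where s: "0 < s" "s < 1" and \<rho>: "0 \<le> \<rho>" "\<rho> < 1" 
      "\<And>\<eta>. \<delta> \<le> \<bar>\<eta>\<bar> \<Longrightarrow> \<bar>\<eta>\<bar> \<le> pi \<Longrightarrow> norm (N.mC (Complex \<beta> \<eta>)) \<le> \<rho> * N.mR \<beta>"
    and AE1: "AE w in M. \<exists>K\<ge>0. \<forall>n. (\<integral>\<^sup>+\<eta>. ennreal (norm (psum (Complex \<beta> \<eta>) (particles xi n w)) * indicator {\<eta>. \<delta> \<le> \<bar>\<eta>\<bar> \<and> \<bar>\<eta>\<bar> \<le> pi} \<eta>) \<partial>lborel)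
       \<le> ennreal (K * (N.mR \<beta> * s) ^ n)"
    using L.AE_tail_bound[OF \<delta>(1) \<delta>(3) strict] by blast
  obtain \<rho>1 where \<rho>1: "0 < \<rho>1" "\<rho>1 < 1" and AE2: "AE w in M. \<exists>W K. W holomorphic_on ball (of_real \<beta>) (r / 2) \<and>
     (\<forall>n. \<forall>z\<in>ball (of_real \<beta>) (r / 2). norm (L.Wz n z w - W z) \<le> K * \<rho>1 ^ n)"
    using L.AE_uniform_convergence by blast
  \<comment> \<open>One almost sure event serves all regimes and every \<alpha>: they differ only in
    the deterministic step that follows.\<close>
  have main: "AE w in M. (\<lambda>n. of_real (2 * pi * (real n powr (3/2) * ?A w n))
     - of_real (sqrt (real n)) * (\<i> * of_real (deriv (\<lambda>b. Winf b w) \<beta>) * gaussint \<sigma> 1 (?c n / sqrt (real n)))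
     - (of_real (kappa3 M xi \<beta> / 6) * of_real (deriv (\<lambda>b. Winf b w) \<beta>) * gaussint \<sigma> 4 (?c n / sqrt (real n)) 
       - of_real (deriv (deriv (\<lambda>b. Winf b w)) \<beta>) / 2 * gaussint \<sigma> 2 (?c n / sqrt (real n)))) \<longlonglongrightarrow> 0"
    using AE1 AE2 Winf
  proof eventually_elim
    case (elim w)
    from elim(1) obtain K2 where K2: "K2 \<ge> 0" "\<And>n. (\<integral>\<^sup>+\<eta>. ennreal (norm (psum (Complex \<beta> \<eta>) (particles xi n w)) * indicator {\<eta>. \<delta> \<le> \<bar>\<eta>\<bar> \<and> \<bar>\<eta>\<bar> \<le> pi} \<eta>) \<partial>lborel)
       \<le> ennreal (K2 * (N.mR \<beta> * s) ^ n)" by blast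
    from elim(2) obtain W K1 where W: "W holomorphic_on ball (of_real \<beta>) (r / 2)" 
      "\<And>n z. z \<in> ball (of_real \<beta>) (r / 2) \<Longrightarrow> norm (L.Wz n z w - W z) \<le> K1 * \<rho>1 ^ n" by blast
    have Wi: "(\<lambda>n. Wn M xi n x w) \<longlonglongrightarrow> Winf x w" if "\<bar>x - \<beta>\<bar> < r / 2" for x
    proof -
      have "x \<in> {\<beta> - r..\<beta> + r}" using that L.r unfolding atLeastAtMost_iff by linarith
      then show ?thesis using elim(3) rI by blast
    qed
    show ?case unfolding Lcirc_def
      by (rule L.pathwise_expansion[OF \<sigma>(1) \<delta> K exp \<rho> W(1) \<rho>1 W(2) s K2 Wi])
  qed
  have assoc: "x * exp (\<beta> * real_of_int (k n) - phi M xi \<beta> * real n) * z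
    = x * (exp (\<beta> * real_of_int (k n) - phi M xi \<beta> * real n) * z)" for x z :: real and n by simp
  show ?thesis
    unfolding assoc \<sigma>_def[symmetric]
  proof (intro conjI allI impI; (elim conjE)?)
    fix \<alpha> :: real
    assume o: "(\<lambda>n. ?c n - \<alpha> * \<sigma> * sqrt (real n)) \<in> o(\<lambda>n. sqrt (real n))"
    show "AE w in M. (\<lambda>n. real n * ?A w n) \<longlonglongrightarrow> 1 / (sqrt (2 * pi) * \<sigma>\<^sup>2) * \<alpha> * exp (- \<alpha>\<^sup>2 / 2) * deriv (\<lambda>b. Winf b w) \<beta>"
      using main by eventually_elim (rule three_regimes(1)[OF \<sigma>(1) _ o])
  next
    assume c: "filterlim ?c at_top sequentially" "?c \<in> o(\<lambda>n. sqrt (real n))"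
    show "AE w in M. (\<lambda>n. real n powr (3/2) / ?c n * ?A w n) \<longlonglongrightarrow> 1 / (sqrt (2 * pi) * \<sigma> ^ 3) * deriv (\<lambda>b. Winf b w) \<beta>"
      using main by eventually_elim (rule three_regimes(2)[OF \<sigma>(1) _ c])
  next
    assume c: "Bseq ?c"
    show "AE w in M. (\<lambda>n. real n powr (3/2) * ?A w n - 1 / (sqrt (2 * pi) * \<sigma> ^ 3)
       * (deriv (\<lambda>b. Winf b w) \<beta> * (?c n + kappa3 M xi \<beta> / (2 * \<sigma>\<^sup>2)) - 1/2 * deriv (deriv (\<lambda>b. Winf b w)) \<beta>)) \<longlonglongrightarrow> 0"
      using main by eventually_elim (rule three_regimes(3)[OF \<sigma>(1) _ c])
  qed
qed

end
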